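(* Let $I\subset\mathbb{R}$ be an open interval, $(F_i,g_{F_i})$ pseudo-Riemannian manifolds, $b_i:I\to(0,\infty)$ smooth ($i=1,\dots,m$), and let $M=I\times_{b_1}F_1\times_{b_2}F_2\cdots\times_{b_m}F_m$ be the multiply warped product with metric $g=-dt^2\oplus b_1^2g_{F_1}\oplus b_2^2g_{F_2}\cdots\oplus b_m^2g_{F_m}$; put $\overline n=\dim M$. Let $\lambda_1,\lambda_2$ be nonzero real constants, $P\in\Gamma(TF_r)$ for a fixed $r\in\{1,\dots,m\}$, and let $\overline\nabla$ be the quarter-symmetric connection on $M$ determined by $P,\lambda_1,\lambda_2$. Suppose $(M,\overline\nabla)$ has constant scalar curvature $\overline S$. Then: (1) each $(F_i,\nabla^{F_i})$ with $i\neq r$ has constant scalar curvature $S^{F_i}$; (2) if $\lambda_1+\lambda_2\neq0$, $\lambda_1^2+\lambda_2^2-\overline n\lambda_1\lambda_2=0$ and $div_{F_r}P$ is a constant, then $S^{F_r}$ is a constant; (3) if $\lambda_1=-\lambda_2\neq0$ and $g_{F_r}(P,P)$ is a constant, then $S^{F_r}$ is a constant; (4) if $\lambda_1+\lambda_2\neq0$, $\lambda_1^2+\lambda_2^2-\overline n\lambda_1\lambda_2\neq0$, and $div_{F_r}P$ and $g_{F_r}(P,P)$ are constants, then $S^{F_r}$ is a constant.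
   Context: On a pseudo-Riemannian manifold $(M,g)$ with Levi-Civita connection $\nabla$, a vector field $P$, the 1-form $\pi(X)=g(X,P)$ and nonzero real constants $\lambda_1,\lambda_2$, the quarter-symmetric connection is $\overline\nabla_XY=\nabla_XY+\lambda_1\pi(Y)X-\lambda_2g(X,Y)P$. Its curvature is $\overline R(X,Y)=\overline\nabla_X\overline\nabla_Y-\overline\nabla_Y\overline\nabla_X-\overline\nabla_{[X,Y]}$, its Ricci tensor is $\overline{Ric}(X,Y)=\sum_k\varepsilon_k\,g(\overline R(X,E_k)Y,E_k)$ and its scalar curvature is $\overline S=\sum_k\varepsilon_k\overline{Ric}(E_k,E_k)$, where $(E_k)$ is a local orthonormal frame with $g(E_k,E_k)=\varepsilon_k=\pm1$ (note the sign convention). $S^{F_i}$ is the scalar curvature of the Levi-Civita connection $\nabla^{F_i}$ of $(F_i,g_{F_i})$, with the same convention. $P\in\Gamma(TF_r)$ means that $P$ is (the lift to $M$ of) a vector field on $F_r$; $div_{F_r}P$ is its divergence on $(F_r,g_{F_r})$. *)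

theory Defs
  imports "HOL-Analysis.Analysis"
begin

section \<open>Smooth functions on open subsets of Euclidean space\<close>

text \<open>
  Real n-space is \<^term>\<open>Euclidean_space n\<close>, the set of all \<^term>\<open>x :: nat \<Rightarrow> real\<close> with
  \<^prop>\<open>x i = 0\<close> for \<^prop>\<open>i \<ge> n\<close>, so that manifolds of different dimensions (the factors and their
  product) can occur together. Coordinates are numbered from \<^term>\<open>0::nat\<close>.
\<close>

definition partial :: "nat \<Rightarrow> ((nat \<Rightarrow> real) \<Rightarrow> real) \<Rightarrow> (nat \<Rightarrow> real) \<Rightarrow> real" where
  "partial i f x = deriv (\<lambda>s. f (x(i := s))) (x i)"

text \<open>\<^term>\<open>V\<close> is meant to be an open subset of \<^term>\<open>Euclidean_space n\<close>.\<close>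

primrec Ck_on :: "nat \<Rightarrow> nat \<Rightarrow> (nat \<Rightarrow> real) set \<Rightarrow> ((nat \<Rightarrow> real) \<Rightarrow> real) \<Rightarrow> bool" where
  "Ck_on 0 n V f \<longleftrightarrow> continuous_on V f"
| "Ck_on (Suc k) n V f \<longleftrightarrow> continuous_on V f \<and>
     (\<forall>i<n. (\<forall>x\<in>V. (\<lambda>s. f (x(i := s))) differentiable (at (x i))) \<and> Ck_on k n V (partial i f))"

definition Cinf_on :: "nat \<Rightarrow> (nat \<Rightarrow> real) set \<Rightarrow> ((nat \<Rightarrow> real) \<Rightarrow> real) \<Rightarrow> bool" where
  "Cinf_on n V f \<longleftrightarrow> (\<forall>k. Ck_on k n V f)"


section \<open>Smooth manifolds\<close>

text \<open>A chart is a pair of its domain and its coordinate map. The atlas need not be maximal.\<close>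

record 'a manifold =
  mtop :: "'a topology"
  mdim :: nat
  charts :: "('a set \<times> ('a \<Rightarrow> nat \<Rightarrow> real)) set"

abbreviation points :: "'a manifold \<Rightarrow> 'a set" where
  "points M \<equiv> topspace (mtop M)"

definition smooth_manifold :: "'a manifold \<Rightarrow> bool" where
  "smooth_manifold M \<longleftrightarrow>
     Hausdorff_space (mtop M) \<and> second_countable (mtop M) \<and> points M \<noteq> {} \<and>
     (\<Union>(U, \<phi>)\<in>charts M. U) = points M \<and>
     (\<forall>(U, \<phi>)\<in>charts M.
        openin (mtop M) U \<and> openin (Euclidean_space (mdim M)) (\<phi> ` U) \<and>
        homeomorphic_map (subtopology (mtop M) U)
          (subtopology (Euclidean_space (mdim M)) (\<phi> ` U)) \<phi>) \<and>
     (\<forall>(U, \<phi>)\<in>charts M. \<forall>(V, \<psi>)\<in>charts M. \<forall>k<mdim M.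
        Cinf_on (mdim M) (\<phi> ` (U \<inter> V)) (\<lambda>x. \<psi> (inv_into U \<phi> x) k))"

text \<open>Here \<^term>\<open>W\<close> is meant to be open in \<^term>\<open>M\<close>; values of \<^term>\<open>f\<close> outside
  \<^term>\<open>W\<close> are irrelevant.\<close>

definition smooth_on :: "'a manifold \<Rightarrow> 'a set \<Rightarrow> ('a \<Rightarrow> real) \<Rightarrow> bool" where
  "smooth_on M W f \<longleftrightarrow>
     (\<forall>(U, \<phi>)\<in>charts M. Cinf_on (mdim M) (\<phi> ` (U \<inter> W)) (\<lambda>x. f (inv_into U \<phi> x)))"

definition smooth_at :: "'a manifold \<Rightarrow> 'a \<Rightarrow> ('a \<Rightarrow> real) \<Rightarrow> bool" where
  "smooth_at M p f \<longleftrightarrow> (\<exists>W. openin (mtop M) W \<and> p \<in> W \<and> smooth_on M W f)"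


section \<open>Tangent vectors and vector fields\<close>

type_synonym 'a tangent = "('a \<Rightarrow> real) \<Rightarrow> real"
type_synonym 'a vfield = "'a \<Rightarrow> 'a tangent"
type_synonym 'a metric = "'a \<Rightarrow> 'a tangent \<Rightarrow> 'a tangent \<Rightarrow> real"
type_synonym 'a connection = "'a vfield \<Rightarrow> 'a vfield \<Rightarrow> 'a vfield"

text \<open>
  Tangent vectors at \<^term>\<open>p\<close> are the derivations at \<^term>\<open>p\<close> of the functions that are smooth near
  \<^term>\<open>p\<close>. The Leibniz rule makes their values depend on germs only. The value
  \<^term>\<open>0::real\<close> at all other functions is a normalisation, so that equality of tangent vectors is
  equality in HOL.
\<close>

definition tangent_space :: "'a manifold \<Rightarrow> 'a \<Rightarrow> 'a tangent set" where
  "tangent_space M p = {v.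
     (\<forall>f g. smooth_at M p f \<longrightarrow> smooth_at M p g \<longrightarrow> v (\<lambda>q. f q + g q) = v f + v g) \<and>
     (\<forall>c f. smooth_at M p f \<longrightarrow> v (\<lambda>q. c * f q) = c * v f) \<and>
     (\<forall>f g. smooth_at M p f \<longrightarrow> smooth_at M p g \<longrightarrow>
        v (\<lambda>q. f q * g q) = f p * v g + v f * g p) \<and>
     (\<forall>f. \<not> smooth_at M p f \<longrightarrow> v f = 0)}"

text \<open>Smooth vector fields on an open set \<^term>\<open>W\<close>; the values outside \<^term>\<open>W\<close> are arbitrary.\<close>

definition vector_field :: "'a manifold \<Rightarrow> 'a set \<Rightarrow> 'a vfield \<Rightarrow> bool" where
  "vector_field M W X \<longleftrightarrow>
     (\<forall>p\<in>W. X p \<in> tangent_space M p) \<and>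
     (\<forall>W' f. openin (mtop M) W' \<longrightarrow> W' \<subseteq> W \<longrightarrow> smooth_on M W' f \<longrightarrow>
        smooth_on M W' (\<lambda>p. X p f))"

definition lie_bracket :: "'a manifold \<Rightarrow> 'a vfield \<Rightarrow> 'a vfield \<Rightarrow> 'a vfield" where
  "lie_bracket M X Y p f =
     (if smooth_at M p f then X p (\<lambda>q. Y q f) - Y p (\<lambda>q. X q f) else 0)"

text \<open>The differential at a point of a smooth map \<^term>\<open>h\<close> into \<^term>\<open>N\<close>, where \<^term>\<open>q\<close> is the
  image of that point.\<close>

definition pushforward :: "'b manifold \<Rightarrow> 'b \<Rightarrow> ('a \<Rightarrow> 'b) \<Rightarrow> 'a tangent \<Rightarrow> 'b tangent" where
  "pushforward N q h v f = (if smooth_at N q f then v (\<lambda>p. f (h p)) else 0)"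


section \<open>Pseudo-Riemannian metrics\<close>

definition metric_index :: "'a manifold \<Rightarrow> 'a metric \<Rightarrow> 'a \<Rightarrow> nat" where
  "metric_index M g p = (GREATEST k. \<exists>v. (\<forall>i<k. v i \<in> tangent_space M p) \<and>
     (\<forall>a. (\<exists>i<k. a i \<noteq> 0) \<longrightarrow>
        g p (\<lambda>f. \<Sum>i<k. a i * v i f) (\<lambda>f. \<Sum>i<k. a i * v i f) < 0))"

definition pseudo_riemannian :: "'a manifold \<Rightarrow> 'a metric \<Rightarrow> bool" where
  "pseudo_riemannian M g \<longleftrightarrow> smooth_manifold M \<and>
     (\<forall>p\<in>points M. \<forall>u\<in>tangent_space M p. \<forall>v\<in>tangent_space M p.
        g p u v = g p v u \<and>
        (\<forall>w\<in>tangent_space M p. g p (\<lambda>f. u f + v f) w = g p u w + g p v w) \<and>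
        (\<forall>c. g p (\<lambda>f. c * u f) v = c * g p u v)) \<and>
     (\<forall>p\<in>points M. \<forall>u\<in>tangent_space M p.
        (\<forall>v\<in>tangent_space M p. g p u v = 0) \<longrightarrow> u = (\<lambda>f. 0)) \<and>
     (\<forall>W X Y. openin (mtop M) W \<longrightarrow> vector_field M W X \<longrightarrow> vector_field M W Y \<longrightarrow>
        smooth_on M W (\<lambda>p. g p (X p) (Y p))) \<and>
     metric_index M g constant_on points M"

definition orthonormal_frame ::
    "'a manifold \<Rightarrow> 'a metric \<Rightarrow> 'a set \<Rightarrow> (nat \<Rightarrow> 'a vfield) \<Rightarrow> bool" where
  "orthonormal_frame M g W E \<longleftrightarrow>
     (\<forall>k<mdim M. vector_field M W (E k)) \<and>
     (\<forall>j<mdim M. \<forall>k<mdim M. j \<noteq> k \<longrightarrow> (\<forall>p\<in>W. g p (E j p) (E k p) = 0)) \<and>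
     (\<forall>k<mdim M. \<exists>\<epsilon>\<in>{1, -1}. \<forall>p\<in>W. g p (E k p) (E k p) = \<epsilon>)"

text \<open>A local orthonormal frame around \<^term>\<open>p\<close>; the traces below do not depend on the choice.\<close>

definition frame_at :: "'a manifold \<Rightarrow> 'a metric \<Rightarrow> 'a \<Rightarrow> nat \<Rightarrow> 'a vfield" where
  "frame_at M g p = (SOME E. \<exists>W. openin (mtop M) W \<and> p \<in> W \<and> orthonormal_frame M g W E)"


section \<open>Connections and curvature\<close>

text \<open>
  A connection acts on vector fields on arbitrary open sets. Since a function that is
  constant on an open set is smooth there whatever its values elsewhere, the two product rules
  force the value at \<^term>\<open>p\<close> to depend on the germs at \<^term>\<open>p\<close> of the arguments only.
\<close>

definition affine_connection :: "'a manifold \<Rightarrow> 'a connection \<Rightarrow> bool" where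
  "affine_connection M D \<longleftrightarrow>
     (\<forall>W X Y. openin (mtop M) W \<longrightarrow> vector_field M W X \<longrightarrow> vector_field M W Y \<longrightarrow>
        vector_field M W (D X Y) \<and>
        (\<forall>Z. vector_field M W Z \<longrightarrow> (\<forall>p\<in>W. \<forall>h.
           D (\<lambda>q f. X q f + Z q f) Y p h = D X Y p h + D Z Y p h \<and>
           D X (\<lambda>q f. Y q f + Z q f) p h = D X Y p h + D X Z p h)) \<and>
        (\<forall>a. smooth_on M W a \<longrightarrow> (\<forall>p\<in>W. \<forall>h.
           D (\<lambda>q f. a q * X q f) Y p h = a p * D X Y p h \<and>
           D X (\<lambda>q f. a q * Y q f) p h = a p * D X Y p h + X p a * Y p h)))"

text \<open>In \<^term>\<open>X p (\<lambda>q. g q (Y q) (Z q))\<close> the vector field \<^term>\<open>X\<close> differentiates the function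
  g(Y,Z).\<close>

definition levi_civita :: "'a manifold \<Rightarrow> 'a metric \<Rightarrow> 'a connection \<Rightarrow> bool" where
  "levi_civita M g D \<longleftrightarrow> affine_connection M D \<and>
     (\<forall>W X Y. openin (mtop M) W \<longrightarrow> vector_field M W X \<longrightarrow> vector_field M W Y \<longrightarrow>
        (\<forall>p\<in>W. \<forall>f. D X Y p f - D Y X p f = lie_bracket M X Y p f) \<and>
        (\<forall>Z. vector_field M W Z \<longrightarrow> (\<forall>p\<in>W.
           X p (\<lambda>q. g q (Y q) (Z q)) = g p (D X Y p) (Z p) + g p (Y p) (D X Z p))))"

definition curvature ::
    "'a manifold \<Rightarrow> 'a connection \<Rightarrow> 'a vfield \<Rightarrow> 'a vfield \<Rightarrow> 'a vfield \<Rightarrow> 'a vfield" where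
  "curvature M D X Y Z p f =
     D X (D Y Z) p f - D Y (D X Z) p f - D (lie_bracket M X Y) Z p f"

text \<open>The sign convention is that of Ric(X,Y) being the trace of g(R(X,E)Y,E).\<close>

definition ricci ::
    "'a manifold \<Rightarrow> 'a metric \<Rightarrow> 'a connection \<Rightarrow> 'a vfield \<Rightarrow> 'a vfield \<Rightarrow> 'a \<Rightarrow> real" where
  "ricci M g D X Y p = (let E = frame_at M g p in
     \<Sum>k<mdim M. g p (E k p) (E k p) * g p (curvature M D X (E k) Y p) (E k p))"

definition scalar_curvature :: "'a manifold \<Rightarrow> 'a metric \<Rightarrow> 'a connection \<Rightarrow> 'a \<Rightarrow> real" where
  "scalar_curvature M g D p = (let E = frame_at M g p in
     \<Sum>k<mdim M. g p (E k p) (E k p) * ricci M g D (E k) (E k) p)"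

definition divergence :: "'a manifold \<Rightarrow> 'a metric \<Rightarrow> 'a connection \<Rightarrow> 'a vfield \<Rightarrow> 'a \<Rightarrow> real" where
  "divergence M g D X p = (let E = frame_at M g p in
     \<Sum>k<mdim M. g p (E k p) (E k p) * g p (D (E k) X p) (E k p))"

definition quarter_symmetric ::
    "'a metric \<Rightarrow> 'a connection \<Rightarrow> 'a vfield \<Rightarrow> real \<Rightarrow> real \<Rightarrow> 'a connection" where
  "quarter_symmetric g D P l1 l2 X Y p f =
     D X Y p f + l1 * g p (Y p) (P p) * X p f - l2 * g p (X p) (Y p) * P p f"


section \<open>Multiply warped products\<close>

text \<open>
  The points of the product of an interval \<^term>\<open>I\<close> and manifolds \<^term>\<open>F i\<close>, for \<^term>\<open>i\<close> in
  \<^term>\<open>{1..m}\<close>, are the pairs of some \<^term>\<open>t\<close> in \<^term>\<open>I\<close> and some \<^term>\<open>x\<close> in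
  \<^term>\<open>Pi\<^sub>E {1..m} (\<lambda>i. points (F i))\<close>. In a product chart the coordinate with number 0 is
  \<^term>\<open>t\<close>, and those of \<^term>\<open>x i\<close> are numbered from \<^term>\<open>coord_offset F i\<close> on.
\<close>

definition coord_offset :: "(nat \<Rightarrow> 'a manifold) \<Rightarrow> nat \<Rightarrow> nat" where
  "coord_offset F i = 1 + (\<Sum>j=1..<i. mdim (F j))"

definition product_coords ::
    "nat \<Rightarrow> (nat \<Rightarrow> 'a manifold) \<Rightarrow> (nat \<Rightarrow> 'a \<Rightarrow> nat \<Rightarrow> real) \<Rightarrow> real \<times> (nat \<Rightarrow> 'a) \<Rightarrow> nat \<Rightarrow> real" where
  "product_coords m F \<phi> = (\<lambda>(t, x) k. if k = 0 then t else
     (\<Sum>i=1..m. if coord_offset F i \<le> k \<and> k < coord_offset F i + mdim (F i)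
                then \<phi> i (x i) (k - coord_offset F i) else 0))"

definition product_manifold ::
    "real set \<Rightarrow> nat \<Rightarrow> (nat \<Rightarrow> 'a manifold) \<Rightarrow> (real \<times> (nat \<Rightarrow> 'a)) manifold" where
  "product_manifold I m F =
     \<lparr>mtop = prod_topology (top_of_set I) (product_topology (\<lambda>i. mtop (F i)) {1..m}),
      mdim = 1 + (\<Sum>i=1..m. mdim (F i)),
      charts = {(I \<times> Pi\<^sub>E {1..m} U, product_coords m F \<phi>) | U \<phi>.
                  \<forall>i\<in>{1..m}. (U i, \<phi> i) \<in> charts (F i)}\<rparr>"

text \<open>The function \<^term>\<open>fst\<close> is the coordinate t, so \<^term>\<open>u fst\<close> is dt(u).\<close>

definition warped_metric ::
    "nat \<Rightarrow> (nat \<Rightarrow> 'a manifold) \<Rightarrow> (nat \<Rightarrow> 'a metric) \<Rightarrow> (nat \<Rightarrow> real \<Rightarrow> real) \<Rightarrow>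
     (real \<times> (nat \<Rightarrow> 'a)) metric" where
  "warped_metric m F gF b = (\<lambda>(t, x) u v. - (u fst * v fst) +
     (\<Sum>i=1..m. (b i t)\<^sup>2 * gF i (x i) (pushforward (F i) (x i) (\<lambda>p. snd p i) u)
                                     (pushforward (F i) (x i) (\<lambda>p. snd p i) v)))"

text \<open>The lift to \<^term>\<open>M\<close> of a vector field on the factor with number \<^term>\<open>r\<close>, by means of the
  inclusion of that factor as the slice through (t,x).\<close>

definition lift_field ::
    "(real \<times> (nat \<Rightarrow> 'a)) manifold \<Rightarrow> nat \<Rightarrow> 'a vfield \<Rightarrow> (real \<times> (nat \<Rightarrow> 'a)) vfield" where
  "lift_field M r P = (\<lambda>(t, x). pushforward M (t, x) (\<lambda>q. (t, x(r := q))) (P (x r)))"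

end

theory Submission
  imports Defs
begin

text \<open>
  Let n = dim M. Tracing the curvature of the quarter-symmetric connection over an orthonormal
  frame expresses its scalar curvature as S + (n - 1)(l1 + l2) div P
  - (n - 1)(l1^2 + l2^2 - n l1 l2) g(P,P), where S belongs to the Levi-Civita connection of M. For a
  multiply warped product, S(t,x) is a function of t plus the sum of the S_i(x_i) / b_i(t)^2, where
  S_i is the scalar curvature of the i-th factor, and if P is lifted from the factor r, then
  div P is the divergence on that factor and g(P,P) = b_r(t)^2 g_r(P,P). If the sum is constant, fixing t
  and varying a single x_i shows that the terms that depend on x_i are constant.

  Tangent vectors being derivations, Hadamard's lemma is what bounds the dimension of the tangent
  spaces: a derivation is determined by its values on the coordinate functions. Hence n orthonormal
  vectors span, and traces do not depend on the frame. For the product it also follows that a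
  tangent vector is determined by dt and by its projections to the factors; this is how all Lie
  brackets, and through the Koszul formula the connection, are computed.
\<close>

section \<open>Calculus of smooth functions\<close>

text \<open>Scalar curvature and divergence are defined through a frame picked by
  \<open>SOME\<close>, of which only orthonormality is known, and curvature is defined on fields,
  not on vectors. So each trace is first shown to be tensorial and then moved to a convenient frame.
  For the product this is dt together with lifts of factor frames; the lifts have norm +-b_i^2, and
  traces are divided by the norms instead of normalising the frame.

  No connection is constructed: \<open>D\<close> is given, and the Koszul formula paired with dt and
  with lifts identifies D_dt X = D_X dt = (b_i'/b_i) X, D_X Y = 0 for lifts from different factors,
  and, within one factor, D_X Y as the lifted derivative plus b_i b_i' g_i(X,Y) dt.

  The coefficients of div P and g(P,P) come from counting pairs of distinct frame fields. The three
  statements about the factor r are one: each of the two terms has a zero coefficient or a constant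
  function.\<close>

lemma Euclidean_space_eq: "Euclidean_space n = top_of_set {x. \<forall>i\<ge>n. x i = 0}"
  by (simp add: Euclidean_space_def euclidean_product_topology)

lemma openin_Euclidean_space_subset:
  assumes "openin (Euclidean_space n) V" "x \<in> V" "i \<ge> n"
  shows "x i = 0"
  using assms openin_subset[OF assms(1)] by (auto simp: Euclidean_space_eq)

text \<open>Only the first \<open>n\<close> coordinates can vary in
  \<open>Euclidean_space n\<close>, so the minimum of finitely many radii suffices although a basic
  neighbourhood has a factor for every natural number.\<close>

lemma openin_Euclidean_space_box:
  assumes V: "openin (Euclidean_space n) V" and x: "x \<in> V"
  obtains e where "e > 0" "\<And>y. (\<And>i. i \<ge> n \<Longrightarrow> y i = 0) \<Longrightarrow> (\<And>i. i < n \<Longrightarrow> \<bar>y i - x i\<bar> < e) \<Longrightarrow> y \<in> V"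
proof -
  obtain T where T: "open T" "V = {x. \<forall>i\<ge>n. x i = 0} \<inter> T"
    using V by (auto simp: Euclidean_space_eq openin_open)
  have "openin (product_topology (\<lambda>i. euclidean) UNIV) T"
    using T by (simp add: euclidean_product_topology)
  from product_topology_open_contains_basis[OF this, of x] x T
  obtain X where X: "x \<in> (\<Pi>\<^sub>E i\<in>UNIV. X i)" "\<And>i. open (X i)" "(\<Pi>\<^sub>E i\<in>UNIV. X i) \<subseteq> T"
    by auto
  have "\<exists>e>0. \<forall>y. \<bar>y - x i\<bar> < e \<longrightarrow> y \<in> X i" for i
    using X(1) X(2)[of i] by (auto simp: open_real PiE_iff)
  then obtain e where e: "\<And>i. e i > 0" "\<And>i y. \<bar>y - x i\<bar> < e i \<Longrightarrow> y \<in> X i" by metis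
  \<comment> \<open>Inserting 1 keeps the set nonempty for \<open>n = 0\<close>.\<close>
  define d where "d = Min (insert 1 (e ` {..<n}))"
  have d: "d > 0" "\<And>i. i < n \<Longrightarrow> d \<le> e i" using e(1) by (auto simp: d_def)
  show thesis
  proof (rule that[OF d(1)])
    fix y assume y: "\<And>i. i \<ge> n \<Longrightarrow> y i = 0" "\<And>i. i < n \<Longrightarrow> \<bar>y i - x i\<bar> < d"
    have "y i \<in> X i" for i
    proof (cases "i < n")
      case True
      then show ?thesis using e(2) y(2) d(2) by (meson less_le_trans)
    next
      case False
      then have "y i = x i" using y(1) openin_Euclidean_space_subset[OF V x] by simp
      then show ?thesis using X(1) by (auto simp: PiE_iff)
    qed
    then show "y \<in> V" using X(3) y(1) T(2) by (auto simp: PiE_iff)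
  qed
qed

lemma openin_Euclidean_boxI:
  assumes "\<And>i. i \<ge> n \<Longrightarrow> p i = 0"
  shows "openin (Euclidean_space n) {x. (\<forall>i\<ge>n. x i = 0) \<and> (\<forall>i<n. \<bar>x i - p i\<bar> < e)}"
proof -
  have "open {x :: nat \<Rightarrow> real. \<forall>i\<in>{..<n}. \<bar>x i - p i\<bar> < e}"
  proof -
    have "open {x :: nat \<Rightarrow> real. \<bar>x i - p i\<bar> < e}" for i
      by (intro open_Collect_less continuous_intros continuous_on_product_then_coordinatewise)
    moreover have "{x :: nat \<Rightarrow> real. \<forall>i\<in>{..<n}. \<bar>x i - p i\<bar> < e}
        = (\<Inter>i\<in>{..<n}. {x :: nat \<Rightarrow> real. \<bar>x i - p i\<bar> < e})" by auto
    ultimately show ?thesis by (simp add: open_INT)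
  qed
  then show ?thesis unfolding Euclidean_space_eq openin_open
    by (intro exI[of _ "{x :: nat \<Rightarrow> real. \<forall>i\<in>{..<n}. \<bar>x i - p i\<bar> < e}"]) auto
qed

lemma eventually_fun_upd_in_open:
  assumes V: "openin (Euclidean_space n) V" and x: "x \<in> V" and i: "i < n"
  shows "eventually (\<lambda>s. x(i := s) \<in> V) (nhds (x i))"
proof -
  obtain e where e: "e > 0" "\<And>y. (\<And>i. i \<ge> n \<Longrightarrow> y i = 0) \<Longrightarrow> (\<And>i. i < n \<Longrightarrow> \<bar>y i - x i\<bar> < e) \<Longrightarrow> y \<in> V"
    using openin_Euclidean_space_box[OF V x] by blast
  have "x(i := s) \<in> V" if "dist s (x i) < e" for s
    by (rule e(2)) (use that i openin_Euclidean_space_subset[OF V x] e(1) in \<open>auto simp: dist_real_def\<close>)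
  then show ?thesis using e(1) by (auto simp: eventually_nhds_metric)
qed

text \<open>Partial derivatives depend on germs only; this is what makes arbitrary values outside
  the open set \<open>V\<close> harmless.\<close>

lemma partial_cong:
  assumes V: "openin (Euclidean_space n) V" and x: "x \<in> V" and i: "i < n"
    and fg: "\<And>x. x \<in> V \<Longrightarrow> f x = g x"
  shows "partial i f x = partial i g x"
    and "((\<lambda>s. f (x(i := s))) has_real_derivative d) (at (x i)) \<longleftrightarrow>
         ((\<lambda>s. g (x(i := s))) has_real_derivative d) (at (x i))"
proof -
  have ev: "eventually (\<lambda>s. f (x(i := s)) = g (x(i := s))) (nhds (x i))"
    using eventually_fun_upd_in_open[OF V x i] by eventually_elim (rule fg)
  show "partial i f x = partial i g x"
    unfolding partial_def using ev by (rule deriv_cong_ev) simp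
  show "((\<lambda>s. f (x(i := s))) has_real_derivative d) (at (x i)) \<longleftrightarrow>
         ((\<lambda>s. g (x(i := s))) has_real_derivative d) (at (x i))"
    using ev by (intro DERIV_cong_ev) auto
qed

lemma partial_eqI:
  "((\<lambda>s. f (x(i := s))) has_real_derivative d) (at (x i)) \<Longrightarrow> partial i f x = d"
  unfolding partial_def by (rule DERIV_imp_deriv)

lemma Ck_on_SucD:
  assumes "Ck_on (Suc k) n V f"
  shows "continuous_on V f"
    and "\<And>i x. i < n \<Longrightarrow> x \<in> V \<Longrightarrow>
      ((\<lambda>s. f (x(i := s))) has_real_derivative partial i f x) (at (x i))"
    and "\<And>i. i < n \<Longrightarrow> Ck_on k n V (partial i f)"
  using assms by (auto simp: partial_def DERIV_deriv_iff_real_differentiable)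

lemma Ck_on_continuous: "Ck_on k n V f \<Longrightarrow> continuous_on V f"
  by (cases k) auto

lemma Ck_on_cong:
  assumes V: "openin (Euclidean_space n) V"
  shows "(\<And>x. x \<in> V \<Longrightarrow> f x = g x) \<Longrightarrow> Ck_on k n V f \<Longrightarrow> Ck_on k n V g"
proof (induction k arbitrary: f g)
  case 0
  then show ?case using continuous_on_cong[of V V f g] by simp
next
  case (Suc k)
  have eq: "\<And>x. x \<in> V \<Longrightarrow> f x = g x" by fact
  note f = Ck_on_SucD[OF Suc.prems(2)]
  have "(\<lambda>s. g (x(i := s))) differentiable at (x i)" if "i < n" "x \<in> V" for i x
    unfolding real_differentiable_def using f(2)[OF that] iffD1[OF partial_cong(2)[OF V that(2,1)]] eq by blast
  moreover have "Ck_on k n V (partial i g)" if "i < n" for i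
    by (rule Suc.IH[OF _ f(3)[OF that]]) (rule partial_cong(1)[OF V _ that eq])
  moreover have "continuous_on V g" using f(1) eq by (metis continuous_on_cong)
  ultimately show ?case by simp
qed

text \<open>Lets the partial derivatives be given by a formula valid on \<open>V\<close> only; most
  inductions on the order of smoothness go through it.\<close>

lemma Ck_on_SucI:
  assumes V: "openin (Euclidean_space n) V" and "continuous_on V f"
    and d: "\<And>i x. i < n \<Longrightarrow> x \<in> V \<Longrightarrow> ((\<lambda>s. f (x(i := s))) has_real_derivative f' i x) (at (x i))"
    and "\<And>i. i < n \<Longrightarrow> Ck_on k n V (f' i)"
  shows "Ck_on (Suc k) n V f"
proof -
  have "(\<lambda>s. f (x(i := s))) differentiable at (x i)" if "i < n" "x \<in> V" for i x
    using d[OF that] unfolding real_differentiable_def by blast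
  moreover have "Ck_on k n V (partial i f)" if i: "i < n" for i
  proof (rule Ck_on_cong[OF V])
    show "f' i x = partial i f x" if "x \<in> V" for x using partial_eqI[OF d[OF i that]] by simp
  qed (rule assms(4)[OF i])
  ultimately show ?thesis using assms(2) by simp
qed

lemma Ck_on_subset: "Ck_on k n V f \<Longrightarrow> V' \<subseteq> V \<Longrightarrow> Ck_on k n V' f"
  by (induction k arbitrary: f) (auto intro: continuous_on_subset)

lemma continuous_on_local:
  assumes "\<And>x. x \<in> V \<Longrightarrow> \<exists>V'. openin (Euclidean_space n) V' \<and> x \<in> V' \<and> V' \<subseteq> V \<and> continuous_on V' f"
  shows "continuous_on V f"
proof -
  have "continuous (at x within V) f" if x: "x \<in> V" for x
  proof -
    obtain V' where V': "openin (Euclidean_space n) V'" "x \<in> V'" "V' \<subseteq> V" "continuous_on V' f"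
      using assms x by force
    obtain T where T: "open T" "V' = {x. \<forall>i\<ge>n. x i = 0} \<inter> T"
      using V'(1) by (auto simp: Euclidean_space_eq openin_open)
    have sub: "V \<subseteq> {x. \<forall>i\<ge>n. x i = 0}"
      using assms openin_Euclidean_space_subset by blast
    \<comment> \<open>Both sets lie in the Euclidean space, and \<open>V'\<close> is cut out of it
      by the open set \<open>T\<close>, so near \<open>x\<close> they coincide.\<close>
    have "at x within V = at x within V'"
      by (rule at_within_nhd[of _ T]) (use V' T sub in auto)
    then show ?thesis using V' by (simp add: continuous_on_eq_continuous_within)
  qed
  then show ?thesis by (simp add: continuous_on_eq_continuous_within)
qed

lemma Ck_on_local:
  assumes "\<And>x. x \<in> V \<Longrightarrow> \<exists>V'. openin (Euclidean_space n) V' \<and> x \<in> V' \<and> V' \<subseteq> V \<and> Ck_on k n V' f"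
  shows "Ck_on k n V f"
  using assms
proof (induction k arbitrary: f)
  case 0
  then show ?case using continuous_on_local[of V n f] by simp
next
  case (Suc k)
  have nb: "\<exists>V'. openin (Euclidean_space n) V' \<and> x \<in> V' \<and> V' \<subseteq> V \<and> continuous_on V' f \<and>
      (\<forall>i<n. (\<lambda>s. f (x(i := s))) differentiable at (x i)) \<and> (\<forall>i<n. Ck_on k n V' (partial i f))"
    if x: "x \<in> V" for x
  proof -
    obtain V' where "openin (Euclidean_space n) V'" "x \<in> V'" "V' \<subseteq> V" "Ck_on (Suc k) n V' f"
      using Suc.prems[OF x] by blast
    then show ?thesis by (intro exI[of _ V']) (simp del: fun_upd_apply)
  qed
  have "Ck_on k n V (partial i f)" if "i < n" for i
    by (rule Suc.IH) (use nb that in meson)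
  moreover have "continuous_on V f"
    by (rule continuous_on_local[of V n]) (use nb in meson)
  moreover have "(\<lambda>s. f (x(i := s))) differentiable at (x i)" if "i < n" "x \<in> V" for i x
    using nb that by meson
  ultimately show ?case by simp
qed

lemma Ck_on_mono: "Ck_on k n V f \<Longrightarrow> j \<le> k \<Longrightarrow> Ck_on j n V f"
proof (induction j arbitrary: f k)
  case 0
  then show ?case by (simp add: Ck_on_continuous)
next
  case (Suc j)
  then obtain l where "k = Suc l" "j \<le> l" by (metis Suc_le_D Suc_le_mono)
  then show ?case using Suc by auto
qed

lemma Ck_on_const: "Ck_on k n V (\<lambda>x. c)"
proof (induction k arbitrary: c)
  case (Suc k)
  have "partial i (\<lambda>x. c) = (\<lambda>x. 0)" for i by (simp add: partial_def fun_eq_iff)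
  then show ?case using Suc by simp
qed simp

lemma Ck_on_coord:
  assumes V: "openin (Euclidean_space n) V"
  shows "Ck_on k n V (\<lambda>x. x j)"
proof (cases k)
  case 0
  then show ?thesis by (auto intro: continuous_on_product_then_coordinatewise)
next
  case (Suc l)
  show ?thesis unfolding Suc
  proof (rule Ck_on_SucI[OF V, where f' = "\<lambda>i x. if i = j then 1 else 0"])
    show "continuous_on V (\<lambda>x. x j)" by (auto intro: continuous_on_product_then_coordinatewise)
  qed (auto intro: Ck_on_const)
qed

lemma Ck_on_add:
  assumes V: "openin (Euclidean_space n) V"
  shows "Ck_on k n V f \<Longrightarrow> Ck_on k n V g \<Longrightarrow> Ck_on k n V (\<lambda>x. f x + g x)"
proof (induction k arbitrary: f g)
  case 0
  then show ?case by (simp add: continuous_on_add continuous_on_mult)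
next
  case (Suc k)
  note f = Ck_on_SucD[OF Suc.prems(1)] and g = Ck_on_SucD[OF Suc.prems(2)]
  show ?case
  proof (rule Ck_on_SucI[OF V, where f' = "\<lambda>i x. partial i f x + partial i g x"])
    show "((\<lambda>s. f (x(i := s)) + g (x(i := s))) has_real_derivative
        partial i f x + partial i g x) (at (x i))" if "i < n" "x \<in> V" for i x
      by (rule DERIV_add[OF f(2)[OF that] g(2)[OF that]])
  qed (intro continuous_on_add Suc.IH f g; assumption)+
qed

lemma Ck_on_mult:
  assumes V: "openin (Euclidean_space n) V"
  shows "Ck_on k n V f \<Longrightarrow> Ck_on k n V g \<Longrightarrow> Ck_on k n V (\<lambda>x. f x * g x)"
proof (induction k arbitrary: f g)
  case 0
  then show ?case by (simp add: continuous_on_add continuous_on_mult)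
next
  case (Suc k)
  note f = Ck_on_SucD[OF Suc.prems(1)] and g = Ck_on_SucD[OF Suc.prems(2)]
  note fg = Suc.prems[THEN Ck_on_mono, of k, simplified]
  show ?case
  proof (rule Ck_on_SucI[OF V, where f' = "\<lambda>i x. partial i f x * g x + f x * partial i g x"])
    show "Ck_on k n V (\<lambda>x. partial i f x * g x + f x * partial i g x)" if "i < n" for i
      by (intro Ck_on_add[OF V] Suc.IH f(3) g(3) that fg Suc.prems[THEN Ck_on_mono]) auto
    show "((\<lambda>s. f (x(i := s)) * g (x(i := s))) has_real_derivative
           partial i f x * g x + f x * partial i g x) (at (x i))" if "i < n" "x \<in> V" for i x
      using DERIV_mult[OF f(2)[OF that] g(2)[OF that]] by (simp del: fun_upd_apply add: algebra_simps)
  qed (intro continuous_intros f g)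
qed

lemma Ck_on_sum:
  assumes V: "openin (Euclidean_space n) V"
  shows "(\<And>j. j \<in> A \<Longrightarrow> Ck_on k n V (f j)) \<Longrightarrow> Ck_on k n V (\<lambda>x. \<Sum>j\<in>A. f j x)"
  by (induction A rule: infinite_finite_induct) (auto intro: Ck_on_add[OF V] Ck_on_const)

text \<open>The exponent is arbitrary in the induction because differentiation lowers it by 1.
  Exponent -1 later gives quotients, and -1/2 the normalisation of frame fields.\<close>

lemma Ck_on_powr:
  assumes V: "openin (Euclidean_space n) V" and pos: "\<And>x. x \<in> V \<Longrightarrow> f x > 0"
  shows "Ck_on k n V f \<Longrightarrow> Ck_on k n V (\<lambda>x. f x powr a)"
proof (induction k arbitrary: a)
  case 0
  have "\<forall>x\<in>V. f x \<noteq> 0" using pos by (metis less_irrefl)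
  then show ?case using 0 by (auto intro!: continuous_on_powr continuous_on_const)
next
  case (Suc k)
  note f = Ck_on_SucD[OF Suc.prems]
  show ?case
  proof (rule Ck_on_SucI[OF V, where f' = "\<lambda>i x. a * (f x powr (a - 1) * partial i f x)"])
    show "continuous_on V (\<lambda>x. f x powr a)"
      by (rule continuous_on_powr[OF f(1) continuous_on_const]) (use pos in force)
    show "Ck_on k n V (\<lambda>x. a * (f x powr (a - 1) * partial i f x))" if "i < n" for i
      by (intro Ck_on_mult[OF V] Ck_on_const Suc.IH f(3) that Ck_on_mono[OF Suc.prems]) auto
    show "((\<lambda>s. f (x(i := s)) powr a) has_real_derivative a * (f x powr (a - 1) * partial i f x))
        (at (x i))" if "i < n" "x \<in> V" for i x
      using DERIV_fun_powr[OF f(2)[OF that], of a] pos[OF that(2)] by (simp del: fun_upd_apply add: mult.assoc)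
  qed
qed

section \<open>Chain rule and composition of smooth maps\<close>

lemma tendsto_coordinatewise:
  fixes f :: "'a \<Rightarrow> 'b \<Rightarrow> 'c::topological_space"
  assumes "\<And>i. ((\<lambda>s. f s i) \<longlongrightarrow> l i) F"
  shows "(f \<longlongrightarrow> l) F"
  using assms limitin_componentwise[of "\<lambda>i. euclidean" UNIV f l F]
  by (simp add: euclidean_product_topology)

text \<open>Telescoping over the coordinates reduces the chain rule to one-dimensional mean value
  theorems.\<close>

lemma chain_rule_curve:
  fixes c :: "real \<Rightarrow> nat \<Rightarrow> real"
  assumes W: "openin (Euclidean_space m) W" and a: "c s0 \<in> W"
    and f: "Ck_on (Suc 0) m W f"
    and c: "\<And>j. j < m \<Longrightarrow> ((\<lambda>s. c s j) has_real_derivative c' j) (at s0)"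
    and c0: "\<And>s j. j \<ge> m \<Longrightarrow> c s j = 0"
  shows "((\<lambda>s. f (c s)) has_real_derivative (\<Sum>j<m. partial j f (c s0) * c' j)) (at s0)"
proof -
  define a where "a = c s0"
  note fd = Ck_on_SucD[OF f]
  have aW: "a \<in> W" using assms by (simp add: a_def)
  obtain e where e: "e > 0" "\<And>y. (\<And>i. i \<ge> m \<Longrightarrow> y i = 0) \<Longrightarrow> (\<And>i. i < m \<Longrightarrow> \<bar>y i - a i\<bar> < e) \<Longrightarrow> y \<in> W"
    using openin_Euclidean_space_box[OF W aW] by blast
  have a0: "a j = 0" if "j \<ge> m" for j using c0 that by (simp add: a_def)
  define h where "h j s = (\<lambda>i. if i < j then c s i else a i)" for j s
  have cont: "((\<lambda>s. c s i) \<longlongrightarrow> a i) (at s0)" for i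
  proof (cases "i < m")
    case True
    then show ?thesis using c[OF True] unfolding a_def
      by (metis DERIV_isCont isCont_def)
  next
    case False
    then show ?thesis using c0 by (simp add: a_def)
  qed
  have near: "eventually (\<lambda>s. \<forall>i\<in>{..<m}. \<bar>c s i - a i\<bar> < e) (at s0)"
    by (rule eventually_ball_finite)
      (use cont e(1) in \<open>auto simp: tendsto_iff dist_real_def\<close>)
  have mv: "\<exists>\<xi>. (\<forall>i. \<bar>\<xi> i - a i\<bar> \<le> \<bar>c s i - a i\<bar>) \<and> \<xi> \<in> W \<and>
      f (h (Suc j) s) - f (h j s) = partial j f \<xi> * (c s j - a j)"
    if j: "j < m" and s: "\<forall>i<m. \<bar>c s i - a i\<bar> < e" for j s
  proof -
    have upd: "h j s = (h j s)(j := a j)" "h (Suc j) s = (h j s)(j := c s j)"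
      by (auto simp: h_def fun_eq_iff)
    have inW: "(h j s)(j := u) \<in> W" if "\<bar>u - a j\<bar> \<le> \<bar>c s j - a j\<bar>" for u
    proof (rule e(2))
      show "((h j s)(j := u)) i = 0" if "i \<ge> m" for i
        using that j a0 c0 by (auto simp: h_def)
      show "\<bar>((h j s)(j := u)) i - a i\<bar> < e" if "i < m" for i
        using that s \<open>\<bar>u - a j\<bar> \<le> \<bar>c s j - a j\<bar>\<close> e(1) j
        by (auto simp: h_def intro: le_less_trans)
    qed
    have der: "((\<lambda>u. f ((h j s)(j := u))) has_real_derivative partial j f ((h j s)(j := u))) (at u)"
      if "\<bar>u - a j\<bar> \<le> \<bar>c s j - a j\<bar>" for u
      using fd(2)[OF j inW[OF that]] by (simp only: fun_upd_upd fun_upd_same)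
    have close: "\<bar>((h j s)(j := u)) i - a i\<bar> \<le> \<bar>c s i - a i\<bar>" if "\<bar>u - a j\<bar> \<le> \<bar>c s j - a j\<bar>" for u i
      using that by (auto simp: h_def)
    have "\<exists>u. \<bar>u - a j\<bar> \<le> \<bar>c s j - a j\<bar> \<and> f ((h j s)(j := c s j)) - f ((h j s)(j := a j))
        = partial j f ((h j s)(j := u)) * (c s j - a j)"
    proof (cases "c s j" "a j" rule: linorder_cases)
      case less
      have "\<exists>z>c s j. z < a j \<and> f ((h j s)(j := a j)) - f ((h j s)(j := c s j))
          = (a j - c s j) * partial j f ((h j s)(j := z))"
        by (rule MVT2[OF less]) (rule der, use less in linarith)
      then obtain z where "c s j < z" "z < a j" "f ((h j s)(j := a j)) - f ((h j s)(j := c s j))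
          = (a j - c s j) * partial j f ((h j s)(j := z))" by blast
      then show ?thesis using less by (intro exI[of _ z]) (simp del: fun_upd_apply add: algebra_simps)
    next
      case equal
      then show ?thesis by (intro exI[of _ "a j"]) auto
    next
      case greater
      have "\<exists>z>a j. z < c s j \<and> f ((h j s)(j := c s j)) - f ((h j s)(j := a j))
          = (c s j - a j) * partial j f ((h j s)(j := z))"
        by (rule MVT2[OF greater]) (rule der, use greater in linarith)
      then obtain z where "a j < z" "z < c s j" "f ((h j s)(j := c s j)) - f ((h j s)(j := a j))
          = (c s j - a j) * partial j f ((h j s)(j := z))" by blast
      then show ?thesis using greater by (intro exI[of _ z]) (simp del: fun_upd_apply add: algebra_simps)
    qed
    then obtain u where u: "\<bar>u - a j\<bar> \<le> \<bar>c s j - a j\<bar>" "f ((h j s)(j := c s j)) - f ((h j s)(j := a j))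
        = partial j f ((h j s)(j := u)) * (c s j - a j)" by blast
    show ?thesis
      by (rule exI[of _ "(h j s)(j := u)"]) (intro conjI allI close[OF u(1)] inW[OF u(1)], use u(2) upd in metis)
  qed
  \<comment> \<open>One intermediate point per coordinate and parameter. In no coordinate is it
    farther from \<open>a\<close> than the curve is, so it tends to \<open>a\<close> and continuity
    of the partial derivatives applies.\<close>
  define \<xi> where "\<xi> j s = (SOME \<xi>. (\<forall>i. \<bar>\<xi> i - a i\<bar> \<le> \<bar>c s i - a i\<bar>) \<and> \<xi> \<in> W \<and>
      f (h (Suc j) s) - f (h j s) = partial j f \<xi> * (c s j - a j))" for j s
  have \<xi>: "(\<forall>i. \<bar>\<xi> j s i - a i\<bar> \<le> \<bar>c s i - a i\<bar>) \<and> \<xi> j s \<in> W \<and>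
      f (h (Suc j) s) - f (h j s) = partial j f (\<xi> j s) * (c s j - a j)"
    if "j < m" "\<forall>i<m. \<bar>c s i - a i\<bar> < e" for j s
    unfolding \<xi>_def by (rule someI_ex[OF mv[OF that]])
  have lim: "((\<lambda>s. partial j f (\<xi> j s)) \<longlongrightarrow> partial j f a) (at s0)" if j: "j < m" for j
  proof -
    have "((\<lambda>s. \<xi> j s i) \<longlongrightarrow> a i) (at s0)" for i
    proof (rule Lim_transform_bound[where g = "\<lambda>s. c s i - a i" and f = "\<lambda>s. \<xi> j s i - a i", THEN Lim_null[THEN iffD2]])
      show "\<forall>\<^sub>F s in at s0. norm (\<xi> j s i - a i) \<le> norm (c s i - a i)"
        using near by eventually_elim (use \<xi>[OF j] in auto)
      show "((\<lambda>s. c s i - a i) \<longlongrightarrow> 0) (at s0)" using cont[of i] by (simp add: Lim_null[symmetric])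
    qed
    then have "((\<lambda>s. \<xi> j s) \<longlongrightarrow> a) (at s0)" by (rule tendsto_coordinatewise)
    moreover have "eventually (\<lambda>s. \<xi> j s \<in> W) (at s0)"
      using near by eventually_elim (use \<xi>[OF j] in auto)
    moreover have "continuous_on W (partial j f)" using fd(3)[OF j] by simp
    ultimately show ?thesis using aW continuous_on_tendsto_compose[of W "partial j f" "\<xi> j" a "at s0"] by blast
  qed
  have quot: "((\<lambda>s. \<Sum>j<m. partial j f (\<xi> j s) * ((c s j - c s0 j) / (s - s0))) \<longlongrightarrow>
      (\<Sum>j<m. partial j f a * c' j)) (at s0)"
    using lim c by (intro tendsto_sum tendsto_mult) (auto simp: has_field_derivative_iff)
  have "eventually (\<lambda>s. (\<Sum>j<m. partial j f (\<xi> j s) * ((c s j - c s0 j) / (s - s0)))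
      = (f (c s) - f (c s0)) / (s - s0)) (at s0)"
    using near
  proof eventually_elim
    case (elim s)
    have hm: "h m s = c s" using a0 c0 by (auto simp: h_def fun_eq_iff)
    have h0: "h 0 s = a" by (auto simp: h_def)
    have "f (c s) - f a = (\<Sum>j<m. f (h (Suc j) s) - f (h j s))"
      by (subst sum_lessThan_telescope) (simp add: hm h0)
    also have "\<dots> = (\<Sum>j<m. partial j f (\<xi> j s) * (c s j - a j))"
      using \<xi> elim by (intro sum.cong) auto
    finally show ?case by (simp add: a_def sum_divide_distrib)
  qed
  with quot have "((\<lambda>s. (f (c s) - f (c s0)) / (s - s0)) \<longlongrightarrow> (\<Sum>j<m. partial j f a * c' j)) (at s0)"
    by (rule Lim_transform_eventually)
  then show ?thesis by (simp add: has_field_derivative_iff a_def)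
qed

text \<open>The chain rule writes the first partial derivatives as sums of products, and to each
  factor either the induction hypothesis or the smoothness of the components applies at one order
  lower.\<close>

lemma Ck_on_compose:
  assumes V: "openin (Euclidean_space n) V" and W: "openin (Euclidean_space m) W"
    and G: "G ` V \<subseteq> W" and Gs: "\<And>j k. j < m \<Longrightarrow> Ck_on k n V (\<lambda>x. G x j)"
  shows "Ck_on k m W f \<Longrightarrow> Ck_on k n V (\<lambda>x. f (G x))"
proof (induction k arbitrary: f)
  case 0
  have "continuous_on V (\<lambda>x. G x j)" for j
  proof (cases "j < m")
    case True
    then show ?thesis using Gs Ck_on_continuous by blast
  next
    case False
    then have "G x j = 0" if "x \<in> V" for x
      using that G openin_Euclidean_space_subset[OF W] by (auto simp: not_less)
    then show ?thesis by (metis continuous_on_cong continuous_on_const)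
  qed
  then have "continuous_on V G" by (rule continuous_on_coordinatewise_then_product)
  then show ?case using 0 G continuous_on_compose2[of W f V G] by simp
next
  case (Suc k)
  have f1: "Ck_on (Suc 0) m W f" by (rule Ck_on_mono[OF Suc.prems]) simp
  have fk: "Ck_on k m W f" by (rule Ck_on_mono[OF Suc.prems]) simp
  have cc: "continuous_on V (\<lambda>x. f (G x))" using Suc.IH[OF fk] by (rule Ck_on_continuous)
  show ?case
  proof (rule Ck_on_SucI[OF V cc, where f' = "\<lambda>i x. \<Sum>j<m. partial j f (G x) * partial i (\<lambda>x. G x j) x"])
    show "Ck_on k n V (\<lambda>x. \<Sum>j<m. partial j f (G x) * partial i (\<lambda>x. G x j) x)" if i: "i < n" for i
    proof (intro Ck_on_sum[OF V] Ck_on_mult[OF V] Suc.IH)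
      fix j assume "j \<in> {..<m}"
      then have "j < m" by simp
      then show "Ck_on k m W (partial j f)" "Ck_on k n V (partial i (\<lambda>x. G x j))"
        using Ck_on_SucD(3)[OF Suc.prems] Ck_on_SucD(3)[OF Gs i] by auto
    qed
    show "((\<lambda>s. f (G (x(i := s)))) has_real_derivative
        (\<Sum>j<m. partial j f (G x) * partial i (\<lambda>x. G x j) x)) (at (x i))"
      if i: "i < n" and x: "x \<in> V" for i x
    proof -
      \<comment> \<open>\<open>chain_rule_curve\<close> asks for vanishing coordinates from
        \<open>m\<close> on at every parameter, which \<open>G\<close> guarantees only on
        \<open>V\<close>; so the curve gets the value \<open>G x\<close> at parameters that lead
        outside \<open>V\<close>.\<close>
      define c where "c s = (if x(i := s) \<in> V then G (x(i := s)) else G x)" for s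
      have c_x: "c (x i) = G x" by (simp add: c_def)
      have ev: "eventually (\<lambda>s. c s = G (x(i := s))) (nhds (x i))"
        using eventually_fun_upd_in_open[OF V x i] by eventually_elim (simp add: c_def)
      have "((\<lambda>s. f (c s)) has_real_derivative
          (\<Sum>j<m. partial j f (c (x i)) * partial i (\<lambda>x. G x j) x)) (at (x i))"
      proof (rule chain_rule_curve[OF W _ f1])
        show "c (x i) \<in> W" using G x c_x by auto
        show "c s j = 0" if "m \<le> j" for s j
          using that G x openin_Euclidean_space_subset[OF W] by (auto simp: c_def simp del: fun_upd_apply)
        show "((\<lambda>s. c s j) has_real_derivative partial i (\<lambda>x. G x j) x) (at (x i))" if "j < m" for j
        proof -
          have ev': "eventually (\<lambda>s. c s j = G (x(i := s)) j) (nhds (x i))"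
            using ev by eventually_elim simp
          show ?thesis
            using iffD2[OF DERIV_cong_ev[OF refl ev' refl] Ck_on_SucD(2)[OF Gs[OF that] i x]] .
        qed
      qed
      moreover have "eventually (\<lambda>s. f (c s) = f (G (x(i := s)))) (nhds (x i))"
        using ev by eventually_elim simp
      ultimately show ?thesis unfolding c_x using iffD1[OF DERIV_cong_ev[OF refl _ refl]] by fast
    qed
  qed
qed

text \<open>All derivatives of \<open>b\<close> are treated at once, since differentiating number
  \<open>l\<close> produces number \<open>Suc l\<close>.\<close>

lemma Ck_on_real_function:
  assumes V: "openin (Euclidean_space n) V" and I: "\<And>x. x \<in> V \<Longrightarrow> x j \<in> I" and j: "j < n"
    and I0: "open I" and b: "\<And>k. (deriv ^^ k) b differentiable_on I"
  shows "Ck_on k n V (\<lambda>x. (deriv ^^ l) b (x j))"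
proof (induction k arbitrary: l)
  case 0
  have "continuous_on I ((deriv ^^ l) b)" using b differentiable_imp_continuous_on by blast
  then have "continuous_on V (\<lambda>x. (deriv ^^ l) b (x j))"
    by (rule continuous_on_compose2) (auto intro: continuous_on_product_then_coordinatewise I)
  then show ?case by simp
next
  case (Suc k)
  have D: "((deriv ^^ l) b has_real_derivative (deriv ^^ Suc l) b t) (at t)" if "t \<in> I" for t
    using b[of l] that I0
    by (simp add: differentiable_on_eq_differentiable_at DERIV_deriv_iff_real_differentiable)
  show ?case
  proof (rule Ck_on_SucI[OF V, where f' = "\<lambda>i x. if i = j then (deriv ^^ Suc l) b (x j) else 0"])
    show "continuous_on V (\<lambda>x. (deriv ^^ l) b (x j))" using Suc[of l] Ck_on_continuous by blast
    show "Ck_on k n V (\<lambda>x. if i = j then (deriv ^^ Suc l) b (x j) else 0)" for i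
      using Suc[of "Suc l"] Ck_on_const by (cases "i = j") auto
    show "((\<lambda>s. (deriv ^^ l) b ((x(i := s)) j)) has_real_derivative
        (if i = j then (deriv ^^ Suc l) b (x j) else 0)) (at (x i))" if "x \<in> V" for i x
      using D[OF I[OF that]] by (cases "i = j") auto
  qed
qed

text \<open>Differentiation under the integral sign; the factor \<^term>\<open>t ^ a\<close> absorbs the inner
  derivative.\<close>

lemma Ck_on_ray_integral:
  assumes V: "openin (Euclidean_space n) V"
    and star: "\<And>t x. t \<in> {0..1} \<Longrightarrow> x \<in> V \<Longrightarrow> (\<lambda>j. p j + t * (x j - p j)) \<in> V"
    and conv: "\<And>x i. i < n \<Longrightarrow> x \<in> V \<Longrightarrow> convex {s. x(i := s) \<in> V} \<and> open {s. x(i := s) \<in> V}"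
  shows "Ck_on k n V f \<Longrightarrow> Ck_on k n V (\<lambda>x. integral {0..1} (\<lambda>t. t ^ a * f (\<lambda>j. p j + t * (x j - p j))))"
proof -
  have jc: "continuous_on (V \<times> {0..1}) (\<lambda>(x, t). t ^ a * f (\<lambda>j. p j + t * (x j - p j)))"
    if f: "continuous_on V f" for f :: "(nat \<Rightarrow> real) \<Rightarrow> real" and a :: nat
  proof -
    have "continuous_on (V \<times> {0..1::real}) (\<lambda>z j. p j + snd z * (fst z j - p j))"
      by (intro continuous_on_coordinatewise_then_product continuous_intros
          continuous_on_compose2[OF continuous_on_product_coordinates continuous_on_fst]) auto
    then have "continuous_on (V \<times> {0..1::real}) (\<lambda>z. f (\<lambda>j. p j + snd z * (fst z j - p j)))"
      by (rule continuous_on_compose2[OF f]) (use star in auto)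
    then show ?thesis unfolding split_beta by (intro continuous_intros)
  qed
  show "Ck_on k n V f \<Longrightarrow> Ck_on k n V (\<lambda>x. integral {0..1} (\<lambda>t. t ^ a * f (\<lambda>j. p j + t * (x j - p j))))"
  proof (induction k arbitrary: f a)
    case 0
    then have "continuous_on V f" by simp
    have "continuous_on V (\<lambda>x. integral (cbox 0 1) (\<lambda>t. t ^ a * f (\<lambda>j. p j + t * (x j - p j))))"
      by (rule integral_continuous_on_param) (use jc[OF \<open>continuous_on V f\<close>] in \<open>simp add: cbox_interval\<close>)
    then show ?case by (simp add: cbox_interval)
  next
    case (Suc k)
    note fd = Ck_on_SucD[OF Suc.prems]
    show ?case
    proof (rule Ck_on_SucI[OF V, where f' = "\<lambda>i x. integral {0..1}
          (\<lambda>t. t ^ Suc a * partial i f (\<lambda>j. p j + t * (x j - p j)))"])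
      show "continuous_on V (\<lambda>x. integral {0..1} (\<lambda>t. t ^ a * f (\<lambda>j. p j + t * (x j - p j))))"
      proof -
        have "continuous_on V (\<lambda>x. integral (cbox 0 1) (\<lambda>t. t ^ a * f (\<lambda>j. p j + t * (x j - p j))))"
          by (rule integral_continuous_on_param) (use jc[OF fd(1)] in \<open>simp add: cbox_interval\<close>)
        then show ?thesis by (simp add: cbox_interval)
      qed
      show "Ck_on k n V (\<lambda>x. integral {0..1} (\<lambda>t. t ^ Suc a * partial i f (\<lambda>j. p j + t * (x j - p j))))"
        if "i < n" for i using Suc.IH[OF fd(3)[OF that]] .
      show "((\<lambda>s. integral {0..1} (\<lambda>t. t ^ a * f (\<lambda>j. p j + t * ((x(i := s)) j - p j))))
          has_real_derivative
          integral {0..1} (\<lambda>t. t ^ Suc a * partial i f (\<lambda>j. p j + t * (x j - p j)))) (at (x i))"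
        if i: "i < n" and x: "x \<in> V" for i x
      proof -
        \<comment> \<open>The coordinate line through \<open>x\<close> cut with \<open>V\<close>.
          Leibniz's rule needs it convex, and its openness turns the derivative within
          \<open>U\<close> into the full derivative.\<close>
        define U where "U = {s. x(i := s) \<in> V}"
        have U: "convex U" "open U" "x i \<in> U" using conv[OF i x] x by (auto simp: U_def)
        have cU: "continuous_on (U \<times> {0..1}) (\<lambda>(s, t). t ^ a * f (\<lambda>j. p j + t * ((x(i := s)) j - p j)))"
          if f: "continuous_on V f" for f :: "(nat \<Rightarrow> real) \<Rightarrow> real" and a :: nat
        proof -
          have "continuous_on (U \<times> {0..1::real}) (\<lambda>z. (x(i := fst z), snd z))"
          proof (intro continuous_on_Pair continuous_on_coordinatewise_then_product)
            show "continuous_on (U \<times> {0..1::real}) (\<lambda>z. (x(i := fst z)) j)" for j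
              by (cases "j = i") (simp_all add: continuous_on_fst)
          qed (intro continuous_intros)
          then have "continuous_on (U \<times> {0..1::real})
              (\<lambda>z. (\<lambda>(x, t). t ^ a * f (\<lambda>j. p j + t * (x j - p j))) (x(i := fst z), snd z))"
            by (rule continuous_on_compose2[OF jc[OF f]]) (auto simp: U_def simp del: fun_upd_apply)
          then show ?thesis by (simp add: split_beta)
        qed
        have "((\<lambda>s. integral (cbox 0 1) (\<lambda>t. t ^ a * f (\<lambda>j. p j + t * ((x(i := s)) j - p j))))
          has_field_derivative
          integral (cbox 0 1) (\<lambda>t. t ^ Suc a * partial i f (\<lambda>j. p j + t * ((x(i := x i)) j - p j))))
          (at (x i) within U)"
        proof (rule leibniz_rule_field_derivative[OF _ _ _ U(3) U(1)])
          show "continuous_on (U \<times> cbox 0 1) (\<lambda>(s, t). t ^ Suc a * partial i f (\<lambda>j. p j + t * ((x(i := s)) j - p j)))"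
            unfolding cbox_interval by (rule cU) (rule Ck_on_continuous[OF fd(3)[OF i]])
          show "(\<lambda>t. t ^ a * f (\<lambda>j. p j + t * ((x(i := s)) j - p j))) integrable_on cbox 0 1"
            if s: "s \<in> U" for s
          proof (rule integrable_continuous)
            have "continuous_on {0..1::real} (\<lambda>t. (\<lambda>(s, t). t ^ a * f (\<lambda>j. p j + t * ((x(i := s)) j - p j))) (s, t))"
              by (rule continuous_on_compose2[OF cU[OF fd(1)] continuous_on_Pair[OF continuous_on_const continuous_on_id]]) (use s in auto)
            then show "continuous_on (cbox 0 1) (\<lambda>t. t ^ a * f (\<lambda>j. p j + t * ((x(i := s)) j - p j)))"
              by (simp only: cbox_interval split_conv)
          qed
          show "((\<lambda>s. t ^ a * f (\<lambda>j. p j + t * ((x(i := s)) j - p j))) has_real_derivative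
              t ^ Suc a * partial i f (\<lambda>j. p j + t * ((x(i := s)) j - p j))) (at s within U)"
            if s: "s \<in> U" and t: "t \<in> cbox 0 1" for s t
          proof -
            define y where "y = (\<lambda>j. p j + t * ((x(i := s)) j - p j))"
            have yV: "y \<in> V" unfolding y_def by (rule star) (use s t in \<open>simp_all add: U_def del: fun_upd_apply\<close>)
            \<comment> \<open>Moving coordinate \<open>i\<close> of the end point moves the point at
              parameter \<open>t\<close> by \<open>t\<close> times as much; this is the extra factor
              in \<open>t ^ Suc a\<close>.\<close>
            have upd: "(\<lambda>j. p j + t * ((x(i := s')) j - p j)) = y(i := p i + t * (s' - p i))" for s'
              by (auto simp: y_def)
            have yi: "y i = p i + t * (s - p i)" by (simp add: y_def)
            have "((\<lambda>s'. f (y(i := p i + t * (s' - p i)))) has_real_derivative partial i f y * t) (at s)"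
            proof (rule DERIV_chain2[where f = "\<lambda>u. f (y(i := u))"])
              show "((\<lambda>u. f (y(i := u))) has_real_derivative partial i f y) (at (p i + t * (s - p i)))"
                using fd(2)[OF i yV] unfolding yi .
              show "((\<lambda>s'. p i + t * (s' - p i)) has_real_derivative t) (at s)"
                by (auto intro!: derivative_eq_intros)
            qed
            then have "((\<lambda>s'. t ^ a * f (y(i := p i + t * (s' - p i)))) has_real_derivative
                t ^ a * (partial i f y * t)) (at s)" by (rule DERIV_cmult)
            then show ?thesis unfolding upd
              by (simp add: yi[symmetric] mult_ac has_field_derivative_at_within del: fun_upd_apply)
          qed
        qed
        then show ?thesis using at_within_open[OF U(3,2)]
          by (simp add: cbox_interval del: fun_upd_apply)
      qed
    qed
  qed
qed

text \<open>Integrate the derivative of \<open>f\<close> along the segment from \<open>p\<close> to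
  \<open>x\<close>: \<open>h i\<close> is the mean of \<open>partial i f\<close> over that segment.
  At \<open>x = p\<close> the segment is a point, which gives the value of \<open>h i\<close>
  there.\<close>

lemma Hadamard_factorization:
  assumes V: "openin (Euclidean_space n) V" and p: "p \<in> V" and f: "Cinf_on n V f"
  obtains V' h where "openin (Euclidean_space n) V'" "p \<in> V'" "V' \<subseteq> V"
    "\<And>i. i < n \<Longrightarrow> Cinf_on n V' (h i)" "\<And>i. i < n \<Longrightarrow> h i p = partial i f p"
    "\<And>x. x \<in> V' \<Longrightarrow> f x = f p + (\<Sum>i<n. (x i - p i) * h i x)"
proof -
  obtain e where e: "e > 0" "\<And>y. (\<And>i. i \<ge> n \<Longrightarrow> y i = 0) \<Longrightarrow> (\<And>i. i < n \<Longrightarrow> \<bar>y i - p i\<bar> < e) \<Longrightarrow> y \<in> V"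
    using openin_Euclidean_space_box[OF V p] by blast
  have p0: "p i = 0" if "i \<ge> n" for i using openin_Euclidean_space_subset[OF V p that] .
  \<comment> \<open>A cube around \<open>p\<close> is star-shaped with respect to \<open>p\<close>
    and meets coordinate lines in open intervals, as \<open>Ck_on_ray_integral\<close>
    requires.\<close>
  define V' where "V' = {x. (\<forall>i\<ge>n. x i = 0) \<and> (\<forall>i<n. \<bar>x i - p i\<bar> < e)}"
  have V': "openin (Euclidean_space n) V'" unfolding V'_def by (rule openin_Euclidean_boxI[OF p0])
  have sub: "V' \<subseteq> V" using e(2) by (auto simp: V'_def)
  have pV': "p \<in> V'" using e(1) p0 by (auto simp: V'_def)
  have star: "(\<lambda>j. p j + t * (x j - p j)) \<in> V'" if t: "t \<in> {0..1}" and x: "x \<in> V'" for t x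
  proof -
    have "\<bar>t * (x j - p j)\<bar> < e" if "j < n" for j
    proof -
      have "\<bar>t * (x j - p j)\<bar> \<le> 1 * \<bar>x j - p j\<bar>" unfolding abs_mult
        by (rule mult_right_mono) (use t in auto)
      then show ?thesis using x that by (auto simp: V'_def)
    qed
    then show ?thesis using x p0 by (auto simp: V'_def)
  qed
  have line: "{s. x(i := s) \<in> V'} = {p i - e<..<p i + e}" if "i < n" "x \<in> V'" for x i
    using that by (auto simp: V'_def abs_less_iff)
  have conv: "convex {s. x(i := s) \<in> V'} \<and> open {s. x(i := s) \<in> V'}" if "i < n" "x \<in> V'" for x i
    unfolding line[OF that] by simp
  \<comment> \<open>The factor \<open>t ^ 0\<close> only matches the shape of
    \<open>Ck_on_ray_integral\<close> with \<open>a = 0\<close>.\<close>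
  define h where "h i x = integral {0..1} (\<lambda>t. t ^ 0 * partial i f (\<lambda>j. p j + t * (x j - p j)))" for i x
  have fd: "Ck_on (Suc k) n V' f" for k
    using f Ck_on_subset[OF _ sub] unfolding Cinf_on_def by blast
  show thesis
  proof (rule that[OF V' pV' sub])
    show "Cinf_on n V' (h i)" if "i < n" for i
      unfolding Cinf_on_def h_def
      using Ck_on_ray_integral[OF V' star conv Ck_on_SucD(3)[OF fd that]] by blast
    show "h i p = partial i f p" for i by (simp add: h_def)
    show "f x = f p + (\<Sum>i<n. (x i - p i) * h i x)" if x: "x \<in> V'" for x
    proof -
      define c where "c t = (\<lambda>j. p j + max 0 (min 1 t) * (x j - p j))" for t :: real
      have cV: "c t \<in> V'" for t unfolding c_def by (rule star) (use x in auto)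
      define F where "F t = f (\<lambda>j. p j + t * (x j - p j))" for t :: real
      have ct: "c t = (\<lambda>j. p j + t * (x j - p j))" if "t \<in> {0..1}" for t using that by (auto simp: c_def)
      have der: "(F has_real_derivative (\<Sum>i<n. partial i f (\<lambda>j. p j + t * (x j - p j)) * (x i - p i))) (at t within {0..1})"
        if t: "t \<in> {0..1}" for t
      proof -
        have "((\<lambda>s. f (\<lambda>j. p j + s * (x j - p j))) has_real_derivative
            (\<Sum>i<n. partial i f (\<lambda>j. p j + t * (x j - p j)) * (x i - p i))) (at t)"
        proof (rule chain_rule_curve[where c = "\<lambda>s j. p j + s * (x j - p j)", OF V' star[OF t x] fd])
          show "((\<lambda>s. p j + s * (x j - p j)) has_real_derivative x j - p j) (at t)" for j
            by (auto intro!: derivative_eq_intros)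
          show "p j + s * (x j - p j) = 0" if "n \<le> j" for s j
            using that p0 x by (auto simp: V'_def)
        qed
        then show ?thesis unfolding F_def by (rule has_field_derivative_at_within)
      qed
      have "((\<lambda>t. \<Sum>i<n. partial i f (\<lambda>j. p j + t * (x j - p j)) * (x i - p i)) has_integral F 1 - F 0) {0..1}"
        by (rule fundamental_theorem_of_calculus)
          (use der in \<open>auto simp: has_real_derivative_iff_has_vector_derivative\<close>)
      moreover have "((\<lambda>t. \<Sum>i<n. partial i f (\<lambda>j. p j + t * (x j - p j)) * (x i - p i)) has_integral
          (\<Sum>i<n. h i x * (x i - p i))) {0..1}"
      proof (intro has_integral_sum has_integral_mult_left)
        fix i assume "i \<in> {..<n}"
        then have i: "i < n" by simp
        have "continuous_on {0..1} (\<lambda>t. partial i f (\<lambda>j. p j + t * (x j - p j)))"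
        proof (rule continuous_on_compose2[OF Ck_on_continuous[OF Ck_on_SucD(3)[OF fd i]]])
          show "continuous_on {0..1} (\<lambda>t j. p j + t * (x j - p j))"
            by (intro continuous_on_coordinatewise_then_product continuous_intros)
        qed (use star x in blast)
        then have "(\<lambda>t. partial i f (\<lambda>j. p j + t * (x j - p j))) integrable_on {0..1}"
          by (rule integrable_continuous_interval)
        then show "((\<lambda>t. partial i f (\<lambda>j. p j + t * (x j - p j))) has_integral h i x) {0..1}"
          by (simp add: h_def integrable_integral)
      qed simp
      ultimately have "F 1 - F 0 = (\<Sum>i<n. h i x * (x i - p i))" by (rule has_integral_unique)
      then show ?thesis by (simp add: F_def mult.commute algebra_simps)
    qed
  qed
qed

section \<open>Functions smooth of every order\<close>

lemma Cinf_on_continuous: "Cinf_on n V f \<Longrightarrow> continuous_on V f"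
  unfolding Cinf_on_def using Ck_on_continuous by blast

lemma Cinf_on_partial:
  assumes "Cinf_on n V f" "i < n"
  shows "Cinf_on n V (partial i f)"
    and "x \<in> V \<Longrightarrow> ((\<lambda>s. f (x(i := s))) has_real_derivative partial i f x) (at (x i))"
  using assms Ck_on_SucD(2,3) unfolding Cinf_on_def by blast+

lemma Cinf_on_subset: "Cinf_on n V f \<Longrightarrow> V' \<subseteq> V \<Longrightarrow> Cinf_on n V' f"
  unfolding Cinf_on_def using Ck_on_subset by blast

lemma Cinf_on_local:
  assumes "\<And>x. x \<in> V \<Longrightarrow> \<exists>V'. openin (Euclidean_space n) V' \<and> x \<in> V' \<and> V' \<subseteq> V \<and> Cinf_on n V' f"
  shows "Cinf_on n V f"
  unfolding Cinf_on_def by (intro allI Ck_on_local) (use assms in \<open>force simp: Cinf_on_def\<close>)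

lemma Cinf_on_const: "Cinf_on n V (\<lambda>x. c)"
  by (simp add: Cinf_on_def Ck_on_const)

context
  fixes n V
  assumes V: "openin (Euclidean_space n) V"
begin

lemma Cinf_on_cong: "(\<And>x. x \<in> V \<Longrightarrow> f x = g x) \<Longrightarrow> Cinf_on n V f \<Longrightarrow> Cinf_on n V g"
  using Ck_on_cong[OF V] unfolding Cinf_on_def by blast

lemma Cinf_on_coord: "Cinf_on n V (\<lambda>x. x j)"
  by (simp add: Cinf_on_def Ck_on_coord[OF V])

lemma Cinf_on_add: "Cinf_on n V f \<Longrightarrow> Cinf_on n V g \<Longrightarrow> Cinf_on n V (\<lambda>x. f x + g x)"
  by (simp add: Cinf_on_def Ck_on_add[OF V])

lemma Cinf_on_mult: "Cinf_on n V f \<Longrightarrow> Cinf_on n V g \<Longrightarrow> Cinf_on n V (\<lambda>x. f x * g x)"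
  by (simp add: Cinf_on_def Ck_on_mult[OF V])

lemma Cinf_on_powr: "(\<And>x. x \<in> V \<Longrightarrow> f x > 0) \<Longrightarrow> Cinf_on n V f \<Longrightarrow> Cinf_on n V (\<lambda>x. f x powr a)"
  by (simp add: Cinf_on_def Ck_on_powr[OF V])

lemma Cinf_on_compose:
  assumes "openin (Euclidean_space m) W" "G ` V \<subseteq> W"
    "\<And>j. j < m \<Longrightarrow> Cinf_on n V (\<lambda>x. G x j)" "Cinf_on m W f"
  shows "Cinf_on n V (\<lambda>x. f (G x))"
  using Ck_on_compose[OF V assms(1,2)] assms(3,4) unfolding Cinf_on_def by simp

end


section \<open>Smooth functions and tangent vectors on a manifold\<close>

text \<open>The homeomorphism condition on charts appears as openness of images and preimages, the
  form in which it is verified for product charts when the product becomes an instance.\<close>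

locale smooth_atlas =
  fixes M :: "'a manifold"
  assumes chart_cover: "p \<in> points M \<Longrightarrow> \<exists>U \<phi>. (U, \<phi>) \<in> charts M \<and> p \<in> U"
    and chart_open: "(U, \<phi>) \<in> charts M \<Longrightarrow> openin (mtop M) U"
    and chart_inj: "(U, \<phi>) \<in> charts M \<Longrightarrow> inj_on \<phi> U"
    and chart_image_open: "(U, \<phi>) \<in> charts M \<Longrightarrow> openin (mtop M) W \<Longrightarrow>
      openin (Euclidean_space (mdim M)) (\<phi> ` (U \<inter> W))"
    and chart_preimage_open: "(U, \<phi>) \<in> charts M \<Longrightarrow> openin (Euclidean_space (mdim M)) V \<Longrightarrow>
      openin (mtop M) {q \<in> U. \<phi> q \<in> V}"
    and chart_transition: "(U, \<phi>) \<in> charts M \<Longrightarrow> (U', \<psi>) \<in> charts M \<Longrightarrow> k < mdim M \<Longrightarrow>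
      Cinf_on (mdim M) (\<phi> ` (U \<inter> U')) (\<lambda>x. \<psi> (inv_into U \<phi> x) k)"

lemma smooth_manifold_imp_smooth_atlas:
  assumes M: "smooth_manifold M"
  shows "smooth_atlas M"
proof
  show "\<exists>U \<phi>. (U, \<phi>) \<in> charts M \<and> p \<in> U" if "p \<in> points M" for p
    using M that unfolding smooth_manifold_def by blast
  fix U \<phi> assume c: "(U, \<phi>) \<in> charts M"
  show U: "openin (mtop M) U" using M c unfolding smooth_manifold_def by blast
  have O: "openin (Euclidean_space (mdim M)) (\<phi> ` U)"
    using M c unfolding smooth_manifold_def by blast
  have H: "homeomorphic_map (subtopology (mtop M) U) (subtopology (Euclidean_space (mdim M)) (\<phi> ` U)) \<phi>"
    using M c unfolding smooth_manifold_def by blast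
  have ts: "topspace (subtopology (mtop M) U) = U"
    using openin_subset[OF U] by auto
  show "inj_on \<phi> U" using homeomorphic_imp_injective_map[OF H] ts by simp
  show "openin (Euclidean_space (mdim M)) (\<phi> ` (U \<inter> W))" if "openin (mtop M) W" for W
  proof -
    have "openin (subtopology (mtop M) U) (U \<inter> W)"
      using that by (auto simp: openin_subtopology)
    then have "openin (subtopology (Euclidean_space (mdim M)) (\<phi> ` U)) (\<phi> ` (U \<inter> W))"
      using homeomorphic_imp_open_map[OF H] by (auto simp: open_map_def)
    then show ?thesis using O openin_trans_full by blast
  qed
  show "openin (mtop M) {q \<in> U. \<phi> q \<in> V}" if V: "openin (Euclidean_space (mdim M)) V" for V
  proof -
    have "openin (subtopology (Euclidean_space (mdim M)) (\<phi> ` U)) (\<phi> ` U \<inter> V)"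
      using V by (auto simp: openin_subtopology)
    then have "openin (subtopology (mtop M) U) {q \<in> U. \<phi> q \<in> \<phi> ` U \<inter> V}"
      using openin_continuous_map_preimage[OF homeomorphic_imp_continuous_map[OF H]] ts by metis
    moreover have "{q \<in> U. \<phi> q \<in> \<phi> ` U \<inter> V} = {q \<in> U. \<phi> q \<in> V}" by auto
    ultimately show ?thesis using U openin_trans_full by metis
  qed
  fix V \<psi> k assume "(V, \<psi>) \<in> charts M" "k < mdim M"
  then show "Cinf_on (mdim M) (\<phi> ` (U \<inter> V)) (\<lambda>x. \<psi> (inv_into U \<phi> x) k)"
    using M c unfolding smooth_manifold_def by blast
qed

context smooth_atlas begin

lemma chart_inv: "(U, \<phi>) \<in> charts M \<Longrightarrow> q \<in> U \<Longrightarrow> inv_into U \<phi> (\<phi> q) = q"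
  using chart_inj inv_into_f_f by metis

lemma chart_inv_in: "(U, \<phi>) \<in> charts M \<Longrightarrow> x \<in> \<phi> ` (U \<inter> W) \<Longrightarrow> inv_into U \<phi> x \<in> U \<inter> W"
  using chart_inv by fastforce

lemma chart_image_subset_open:
  assumes "(U, \<phi>) \<in> charts M" "openin (mtop M) W" "W \<subseteq> U"
  shows "openin (Euclidean_space (mdim M)) (\<phi> ` W)"
  using chart_image_open[OF assms(1,2)] assms(3) by (simp add: inf.absorb2)

lemma openin_points: "openin (mtop M) W \<Longrightarrow> p \<in> W \<Longrightarrow> p \<in> points M"
  using openin_subset by blast

lemma smooth_onD:
  "smooth_on M W f \<Longrightarrow> (U, \<phi>) \<in> charts M \<Longrightarrow> Cinf_on (mdim M) (\<phi> ` (U \<inter> W)) (\<lambda>x. f (inv_into U \<phi> x))"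
  unfolding smooth_on_def by blast

lemma smooth_onI:
  "(\<And>U \<phi>. (U, \<phi>) \<in> charts M \<Longrightarrow> Cinf_on (mdim M) (\<phi> ` (U \<inter> W)) (\<lambda>x. f (inv_into U \<phi> x))) \<Longrightarrow> smooth_on M W f"
  unfolding smooth_on_def by blast

lemma smooth_on_subset: "smooth_on M W f \<Longrightarrow> W' \<subseteq> W \<Longrightarrow> smooth_on M W' f"
  by (rule smooth_onI, rule Cinf_on_subset, erule (1) smooth_onD) auto

lemma smooth_on_const: "smooth_on M W (\<lambda>q. c)"
  by (rule smooth_onI) (rule Cinf_on_const)

lemma smooth_on_cong:
  assumes W: "openin (mtop M) W" and eq: "\<And>q. q \<in> W \<Longrightarrow> f q = g q" and f: "smooth_on M W f"
  shows "smooth_on M W g"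
proof (rule smooth_onI)
  fix U \<phi> assume c: "(U, \<phi>) \<in> charts M"
  show "Cinf_on (mdim M) (\<phi> ` (U \<inter> W)) (\<lambda>x. g (inv_into U \<phi> x))"
    by (rule Cinf_on_cong[OF chart_image_open[OF c W] _ smooth_onD[OF f c]])
      (use eq chart_inv_in[OF c] in blast)
qed

lemma smooth_on_add:
  "openin (mtop M) W \<Longrightarrow> smooth_on M W f \<Longrightarrow> smooth_on M W g \<Longrightarrow> smooth_on M W (\<lambda>q. f q + g q)"
  by (rule smooth_onI) (metis Cinf_on_add chart_image_open smooth_onD)

lemma smooth_on_mult:
  "openin (mtop M) W \<Longrightarrow> smooth_on M W f \<Longrightarrow> smooth_on M W g \<Longrightarrow> smooth_on M W (\<lambda>q. f q * g q)"
  by (rule smooth_onI) (metis Cinf_on_mult chart_image_open smooth_onD)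

lemma smooth_on_cmult:
  "openin (mtop M) W \<Longrightarrow> smooth_on M W f \<Longrightarrow> smooth_on M W (\<lambda>q. c * f q)"
  by (intro smooth_on_mult smooth_on_const)

lemma smooth_on_uminus: "openin (mtop M) W \<Longrightarrow> smooth_on M W f \<Longrightarrow> smooth_on M W (\<lambda>q. - f q)"
  using smooth_on_cmult[of W f "-1"] by simp

lemma smooth_on_diff:
  "openin (mtop M) W \<Longrightarrow> smooth_on M W f \<Longrightarrow> smooth_on M W g \<Longrightarrow> smooth_on M W (\<lambda>q. f q - g q)"
  using smooth_on_add[of W f "\<lambda>q. - g q"] smooth_on_uminus[of W g] by simp

lemma smooth_on_sum:
  "openin (mtop M) W \<Longrightarrow> (\<And>j. j \<in> A \<Longrightarrow> smooth_on M W (f j)) \<Longrightarrow> smooth_on M W (\<lambda>q. \<Sum>j\<in>A. f j q)"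
  by (induction A rule: infinite_finite_induct) (auto intro: smooth_on_add smooth_on_const)

lemma smooth_on_powr:
  assumes W: "openin (mtop M) W" and pos: "\<And>q. q \<in> W \<Longrightarrow> f q > 0" and f: "smooth_on M W f"
  shows "smooth_on M W (\<lambda>q. f q powr a)"
proof (rule smooth_onI)
  fix U \<phi> assume c: "(U, \<phi>) \<in> charts M"
  show "Cinf_on (mdim M) (\<phi> ` (U \<inter> W)) (\<lambda>x. f (inv_into U \<phi> x) powr a)"
    by (rule Cinf_on_powr[OF chart_image_open[OF c W] _ smooth_onD[OF f c]])
      (use pos chart_inv_in[OF c] in blast)
qed

text \<open>The quotient is \<open>f * g\<close> times the power -1 of \<open>g * g\<close>, and
  this square is positive whatever the sign of \<open>g\<close>.\<close>

lemma smooth_on_divide: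
  assumes W: "openin (mtop M) W" and nz: "\<And>q. q \<in> W \<Longrightarrow> g q \<noteq> 0"
    and f: "smooth_on M W f" and g: "smooth_on M W g"
  shows "smooth_on M W (\<lambda>q. f q / g q)"
proof (rule smooth_on_cong[OF W])
  show "smooth_on M W (\<lambda>q. f q * (g q * (g q * g q) powr -1))"
    by (intro smooth_on_mult smooth_on_powr W f g) (use nz not_square_less_zero in \<open>auto simp: less_le\<close>)
  show "f q * (g q * (g q * g q) powr - 1) = f q / g q" if "q \<in> W" for q
  proof -
    have "(g q * g q) powr -1 = inverse (g q * g q)"
      using powr_minus[of "g q * g q" 1] by (simp add: powr_one)
    then show ?thesis using nz[OF that] by (simp add: field_simps)
  qed
qed

lemma smooth_on_local:
  assumes "\<And>q. q \<in> W \<Longrightarrow> \<exists>W'. openin (mtop M) W' \<and> q \<in> W' \<and> W' \<subseteq> W \<and> smooth_on M W' f"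
  shows "smooth_on M W f"
proof (rule smooth_onI, rule Cinf_on_local)
  fix U \<phi> x assume c: "(U, \<phi>) \<in> charts M" and x: "x \<in> \<phi> ` (U \<inter> W)"
  then obtain q where q: "q \<in> U" "q \<in> W" "x = \<phi> q" by blast
  with assms obtain W' where W': "openin (mtop M) W'" "q \<in> W'" "W' \<subseteq> W" "smooth_on M W' f" by blast
  show "\<exists>V'. openin (Euclidean_space (mdim M)) V' \<and> x \<in> V' \<and> V' \<subseteq> \<phi> ` (U \<inter> W) \<and>
      Cinf_on (mdim M) V' (\<lambda>x. f (inv_into U \<phi> x))"
    by (rule exI[of _ "\<phi> ` (U \<inter> W')"])
      (use q W' chart_image_open[OF c W'(1)] smooth_onD[OF W'(4) c] in auto)
qed

text \<open>Any other chart sees the same function composed with a transition map.\<close>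

lemma smooth_on_chartI:
  assumes c: "(U, \<phi>) \<in> charts M" and W: "openin (mtop M) W" "W \<subseteq> U"
    and f: "Cinf_on (mdim M) (\<phi> ` W) (\<lambda>x. f (inv_into U \<phi> x))"
  shows "smooth_on M W f"
proof (rule smooth_onI)
  fix U' \<psi> assume c': "(U', \<psi>) \<in> charts M"
  note V = chart_image_open[OF c' W(1)]
  have "Cinf_on (mdim M) (\<psi> ` (U' \<inter> W)) (\<lambda>x. f (inv_into U \<phi> (\<phi> (inv_into U' \<psi> x))))"
  proof (rule Cinf_on_compose[OF V chart_image_subset_open[OF c W] _ _ f])
    show "(\<lambda>x. \<phi> (inv_into U' \<psi> x)) ` \<psi> ` (U' \<inter> W) \<subseteq> \<phi> ` W"
      using chart_inv_in[OF c'] by blast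
    show "Cinf_on (mdim M) (\<psi> ` (U' \<inter> W)) (\<lambda>x. \<phi> (inv_into U' \<psi> x) j)" if "j < mdim M" for j
      by (rule Cinf_on_subset[OF chart_transition[OF c' c that]]) (use W(2) in blast)
  qed
  then show "Cinf_on (mdim M) (\<psi> ` (U' \<inter> W)) (\<lambda>x. f (inv_into U' \<psi> x))"
    by (rule Cinf_on_cong[OF V, rotated])
      (use chart_inv_in[OF c'] chart_inv[OF c] W(2) in \<open>metis IntD2 subsetD\<close>)
qed

lemma smooth_on_coord:
  assumes "(U, \<phi>) \<in> charts M" "k < mdim M"
  shows "smooth_on M U (\<lambda>q. \<phi> q k)"
  using chart_transition[OF _ assms] by (intro smooth_onI) blast

text \<open>Continuity of smooth functions; the construction of frames uses it to keep the sign of a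
  nonzero norm near a point.\<close>

lemma openin_smooth_preimage:
  assumes W: "openin (mtop M) W" and f: "smooth_on M W f" and A: "open A"
  shows "openin (mtop M) {q \<in> W. f q \<in> A}"
proof (subst openin_subopen, intro ballI)
  fix q assume "q \<in> {q \<in> W. f q \<in> A}"
  then have q: "q \<in> W" "f q \<in> A" by auto
  obtain U \<phi> where c: "(U, \<phi>) \<in> charts M" "q \<in> U"
    using chart_cover openin_points[OF W q(1)] by blast
  define V where "V = {x \<in> \<phi> ` (U \<inter> W). f (inv_into U \<phi> x) \<in> A}"
  have "openin (top_of_set (\<phi> ` (U \<inter> W))) V"
    using continuous_openin_preimage_gen[OF Cinf_on_continuous[OF smooth_onD[OF f c(1)]] A]
    by (simp add: V_def vimage_def Int_def conj_commute)
  moreover have "top_of_set (\<phi> ` (U \<inter> W)) = subtopology (Euclidean_space (mdim M)) (\<phi> ` (U \<inter> W))"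
    using openin_subset[OF chart_image_open[OF c(1) W]]
    by (auto simp: Euclidean_space_eq subtopology_subtopology inf.absorb2)
  ultimately have V: "openin (Euclidean_space (mdim M)) V"
    using openin_trans_full chart_image_open[OF c(1) W] by metis
  show "\<exists>T. openin (mtop M) T \<and> q \<in> T \<and> T \<subseteq> {q \<in> W. f q \<in> A}"
  proof (intro exI conjI)
    show "openin (mtop M) {q \<in> U. \<phi> q \<in> V}" by (rule chart_preimage_open[OF c(1) V])
    show "q \<in> {q \<in> U. \<phi> q \<in> V}" using q c chart_inv by (auto simp: V_def)
    show "{q \<in> U. \<phi> q \<in> V} \<subseteq> {q \<in> W. f q \<in> A}"
      using chart_inv[OF c(1)] inj_on_eq_iff[OF chart_inj[OF c(1)]] by (fastforce simp: V_def)
  qed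
qed

lemma smooth_atI: "openin (mtop M) W \<Longrightarrow> p \<in> W \<Longrightarrow> smooth_on M W f \<Longrightarrow> smooth_at M p f"
  unfolding smooth_at_def by blast

lemma smooth_at2E:
  assumes "smooth_at M p f" "smooth_at M p g"
  obtains W where "openin (mtop M) W" "p \<in> W" "smooth_on M W f" "smooth_on M W g"
proof -
  obtain W W' where "openin (mtop M) W" "p \<in> W" "smooth_on M W f"
    "openin (mtop M) W'" "p \<in> W'" "smooth_on M W' g"
    using assms unfolding smooth_at_def by blast
  then show thesis by (intro that[of "W \<inter> W'"]) (auto intro: smooth_on_subset)
qed

lemma smooth_at_const: "p \<in> points M \<Longrightarrow> smooth_at M p (\<lambda>q. c)"
  by (rule smooth_atI[OF openin_topspace _ smooth_on_const])

lemma smooth_at_add: "smooth_at M p f \<Longrightarrow> smooth_at M p g \<Longrightarrow> smooth_at M p (\<lambda>q. f q + g q)"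
  by (erule (1) smooth_at2E) (auto intro: smooth_atI smooth_on_add)

lemma smooth_at_mult: "smooth_at M p f \<Longrightarrow> smooth_at M p g \<Longrightarrow> smooth_at M p (\<lambda>q. f q * g q)"
  by (erule (1) smooth_at2E) (auto intro: smooth_atI smooth_on_mult)

lemma smooth_at_cong:
  assumes "openin (mtop M) W" "p \<in> W" "\<And>q. q \<in> W \<Longrightarrow> f q = g q" "smooth_at M p f"
  shows "smooth_at M p g"
proof -
  obtain W' where W': "openin (mtop M) W'" "p \<in> W'" "smooth_on M W' f"
    using assms(4) unfolding smooth_at_def by blast
  show ?thesis
  proof (rule smooth_atI)
    show "openin (mtop M) (W \<inter> W')" "p \<in> W \<inter> W'" using assms W' by auto
    then show "smooth_on M (W \<inter> W') g"
      by (rule_tac smooth_on_cong[of _ f]) (use assms W' smooth_on_subset in auto)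
  qed
qed

section \<open>Tangent vectors as derivations\<close>

lemma tangent_add:
  "v \<in> tangent_space M p \<Longrightarrow> smooth_at M p f \<Longrightarrow> smooth_at M p g \<Longrightarrow> v (\<lambda>q. f q + g q) = v f + v g"
  unfolding tangent_space_def by blast

lemma tangent_cmult: "v \<in> tangent_space M p \<Longrightarrow> smooth_at M p f \<Longrightarrow> v (\<lambda>q. c * f q) = c * v f"
  unfolding tangent_space_def by blast

lemma tangent_mult:
  "v \<in> tangent_space M p \<Longrightarrow> smooth_at M p f \<Longrightarrow> smooth_at M p g \<Longrightarrow>
    v (\<lambda>q. f q * g q) = f p * v g + v f * g p"
  unfolding tangent_space_def by blast

lemma tangent_not_smooth: "v \<in> tangent_space M p \<Longrightarrow> \<not> smooth_at M p f \<Longrightarrow> v f = 0"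
  unfolding tangent_space_def by blast

text \<open>The indicator function of an open set is smooth on this set, so no bump functions are
  needed.\<close>

lemma tangent_cong:
  assumes v: "v \<in> tangent_space M p" and W: "openin (mtop M) W" "p \<in> W"
    and eq: "\<And>q. q \<in> W \<Longrightarrow> f q = g q"
  shows "v f = v g"
proof (cases "smooth_at M p f")
  case True
  have g: "smooth_at M p g" by (rule smooth_at_cong[OF W eq True])
  define \<iota> :: "'a \<Rightarrow> real" where "\<iota> q = (if q \<in> W then 1 else 0)" for q
  have \<iota>: "smooth_at M p \<iota>"
    by (rule smooth_at_cong[OF W _ smooth_at_const[OF openin_points[OF W], of 1]]) (simp add: \<iota>_def)
  \<comment> \<open>The indicator is idempotent with value 1 at \<open>p\<close>, so the Leibniz
    rule forces its derivative to be its own double.\<close>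
  have "(\<lambda>q. \<iota> q * \<iota> q) = \<iota>" "\<iota> p = 1" using W by (auto simp: \<iota>_def)
  then have "v \<iota> = v \<iota> + v \<iota>" using tangent_mult[OF v \<iota> \<iota>] by simp
  then have v\<iota>: "v \<iota> = 0" by simp
  have "(\<lambda>q. \<iota> q * f q) = (\<lambda>q. \<iota> q * g q)" using eq by (auto simp: \<iota>_def)
  then show ?thesis
    using tangent_mult[OF v \<iota> True] tangent_mult[OF v \<iota> g] v\<iota> W by (simp add: \<iota>_def)
next
  case False
  then have "\<not> smooth_at M p g" using smooth_at_cong[OF W, of g f] eq by auto
  then show ?thesis using False tangent_not_smooth[OF v] by simp
qed

lemma tangent_const:
  assumes "v \<in> tangent_space M p" "p \<in> points M"
  shows "v (\<lambda>q. c) = 0"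
proof -
  have "v (\<lambda>q. 1 * 1) = 1 * v (\<lambda>q. 1) + v (\<lambda>q. 1) * 1"
    by (rule tangent_mult[OF assms(1) smooth_at_const smooth_at_const]) fact+
  then have "v (\<lambda>q. 1) = 0" by simp
  then show ?thesis using tangent_cmult[OF assms(1) smooth_at_const[OF assms(2), of 1], of c] by simp
qed

lemma smooth_at_sum:
  "p \<in> points M \<Longrightarrow> (\<And>j. j \<in> A \<Longrightarrow> smooth_at M p (f j)) \<Longrightarrow> smooth_at M p (\<lambda>q. \<Sum>j\<in>A. f j q)"
  by (induction A rule: infinite_finite_induct) (auto intro: smooth_at_add smooth_at_const)

lemma tangent_sum:
  assumes v: "v \<in> tangent_space M p" and p: "p \<in> points M"
  shows "(\<And>j. j \<in> A \<Longrightarrow> smooth_at M p (f j)) \<Longrightarrow> v (\<lambda>q. \<Sum>j\<in>A. f j q) = (\<Sum>j\<in>A. v (f j))"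
  by (induction A rule: infinite_finite_induct)
    (auto simp: tangent_const[OF v p] tangent_add[OF v] smooth_at_sum[OF p])

lemma tangent_diff:
  assumes v: "v \<in> tangent_space M p" and "smooth_at M p f" "smooth_at M p g"
  shows "v (\<lambda>q. f q - g q) = v f - v g"
proof -
  have "smooth_at M p (\<lambda>q. (-1) * g q)"
    using smooth_at2E[OF assms(3,3)] smooth_atI smooth_on_cmult by metis
  then show ?thesis using tangent_add[OF v assms(2), of "\<lambda>q. (-1) * g q"] tangent_cmult[OF v assms(3), of "-1"]
    by simp
qed

text \<open>Hadamard's lemma writes f near p as f(p) plus the sum of (\<phi>_i - \<phi>_i(p)) h_i.
  The first factors vanish at p, so the Leibniz rule leaves only v(\<phi>_i) h_i(p).\<close>

lemma tangent_chart:
  assumes v: "v \<in> tangent_space M p" and c: "(U, \<phi>) \<in> charts M" and p: "p \<in> U"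
    and f: "smooth_at M p f"
  shows "v f = (\<Sum>k<mdim M. v (\<lambda>q. \<phi> q k) * partial k (\<lambda>x. f (inv_into U \<phi> x)) (\<phi> p))"
proof -
  have pM: "p \<in> points M" using openin_points[OF chart_open[OF c] p] .
  obtain W where W: "openin (mtop M) W" "p \<in> W" "smooth_on M W f"
    using f unfolding smooth_at_def by blast
  obtain V' h where V': "openin (Euclidean_space (mdim M)) V'" "\<phi> p \<in> V'" "V' \<subseteq> \<phi> ` (U \<inter> W)"
    and h: "\<And>i. i < mdim M \<Longrightarrow> Cinf_on (mdim M) V' (h i)"
      "\<And>i. i < mdim M \<Longrightarrow> h i (\<phi> p) = partial i (\<lambda>x. f (inv_into U \<phi> x)) (\<phi> p)"
    and eq: "\<And>x. x \<in> V' \<Longrightarrow> f (inv_into U \<phi> x) = f (inv_into U \<phi> (\<phi> p)) +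
      (\<Sum>i<mdim M. (x i - \<phi> p i) * h i x)"
    using Hadamard_factorization[OF chart_image_open[OF c W(1)] _ smooth_onD[OF W(3) c], of "\<phi> p"] p W(2)
    by blast
  define W' where "W' = {q \<in> U. \<phi> q \<in> V'}"
  have W': "openin (mtop M) W'" "p \<in> W'" "W' \<subseteq> U"
    using chart_preimage_open[OF c V'(1)] p V' by (auto simp: W'_def)
  have im: "\<phi> ` W' = V'" using V'(3) by (auto simp: W'_def)
  have hs: "smooth_at M p (\<lambda>q. h i (\<phi> q))" if "i < mdim M" for i
  proof (rule smooth_atI[OF W'(1,2) smooth_on_chartI[OF c W'(1,3)]])
    show "Cinf_on (mdim M) (\<phi> ` W') (\<lambda>x. h i (\<phi> (inv_into U \<phi> x)))"
      unfolding im by (rule Cinf_on_cong[OF V'(1) _ h(1)[OF that]])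
        (use V'(3) in \<open>simp add: f_inv_into_f subset_iff image_iff, metis f_inv_into_f image_eqI IntD1\<close>)
  qed
  have cs: "smooth_at M p (\<lambda>q. \<phi> q i)" if "i < mdim M" for i
    by (rule smooth_atI[OF chart_open[OF c] p smooth_on_coord[OF c that]])
  have ds: "smooth_at M p (\<lambda>q. \<phi> q i - \<phi> p i)" if "i < mdim M" for i
    using smooth_at_add[OF cs[OF that] smooth_at_const[OF pM, of "- \<phi> p i"]] by simp
  have ps: "smooth_at M p (\<lambda>q. (\<phi> q i - \<phi> p i) * h i (\<phi> q))" if "i < mdim M" for i
    using smooth_at_mult[OF ds[OF that] hs[OF that]] .
  have "v f = v (\<lambda>q. f p + (\<Sum>i<mdim M. (\<phi> q i - \<phi> p i) * h i (\<phi> q)))"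
  proof (rule tangent_cong[OF v W'(1,2)])
    fix q assume "q \<in> W'"
    then show "f q = f p + (\<Sum>i<mdim M. (\<phi> q i - \<phi> p i) * h i (\<phi> q))"
      using eq[of "\<phi> q"] chart_inv[OF c] p by (simp add: W'_def)
  qed
  also have "\<dots> = (\<Sum>i<mdim M. v (\<lambda>q. (\<phi> q i - \<phi> p i) * h i (\<phi> q)))"
  proof -
    have "smooth_at M p (\<lambda>q. \<Sum>i<mdim M. (\<phi> q i - \<phi> p i) * h i (\<phi> q))"
      by (rule smooth_at_sum[OF pM]) (simp add: ps)
    moreover have "v (\<lambda>q. \<Sum>i<mdim M. (\<phi> q i - \<phi> p i) * h i (\<phi> q)) =
        (\<Sum>i<mdim M. v (\<lambda>q. (\<phi> q i - \<phi> p i) * h i (\<phi> q)))"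
      by (rule tangent_sum[OF v pM]) (simp add: ps)
    ultimately show ?thesis
      using tangent_add[OF v smooth_at_const[OF pM]] tangent_const[OF v pM] by simp
  qed
  also have "\<dots> = (\<Sum>i<mdim M. v (\<lambda>q. \<phi> q i) * h i (\<phi> p))"
  proof (rule sum.cong[OF refl])
    fix i assume "i \<in> {..<mdim M}"
    then have i: "i < mdim M" by simp
    have "v (\<lambda>q. \<phi> q i - \<phi> p i) = v (\<lambda>q. \<phi> q i)"
      using tangent_diff[OF v cs[OF i] smooth_at_const[OF pM, of "\<phi> p i"]] tangent_const[OF v pM] by simp
    then show "v (\<lambda>q. (\<phi> q i - \<phi> p i) * h i (\<phi> q)) = v (\<lambda>q. \<phi> q i) * h i (\<phi> p)"
      using tangent_mult[OF v ds[OF i] hs[OF i]] by simp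
  qed
  finally show ?thesis using h(2) by simp
qed

lemma tangent_chart_eqI:
  assumes "u \<in> tangent_space M p" "v \<in> tangent_space M p" "(U, \<phi>) \<in> charts M" "p \<in> U"
    and "\<And>k. k < mdim M \<Longrightarrow> u (\<lambda>q. \<phi> q k) = v (\<lambda>q. \<phi> q k)"
  shows "u = v"
proof
  fix f show "u f = v f"
    using tangent_chart[OF assms(1,3,4)] tangent_chart[OF assms(2,3,4)] assms(5)
      tangent_not_smooth[OF assms(1)] tangent_not_smooth[OF assms(2)]
    by (cases "smooth_at M p f") simp_all
qed

lemma tangent_space_zero: "p \<in> points M \<Longrightarrow> (\<lambda>f. 0) \<in> tangent_space M p"
  by (simp add: tangent_space_def)

lemma tangent_space_add:
  "u \<in> tangent_space M p \<Longrightarrow> v \<in> tangent_space M p \<Longrightarrow> (\<lambda>f. u f + v f) \<in> tangent_space M p"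
  unfolding tangent_space_def by (simp add: algebra_simps)

lemma tangent_space_cmult: "u \<in> tangent_space M p \<Longrightarrow> (\<lambda>f. c * u f) \<in> tangent_space M p"
  unfolding tangent_space_def by (simp add: algebra_simps)

lemma tangent_space_sum:
  "p \<in> points M \<Longrightarrow> (\<And>j. j \<in> A \<Longrightarrow> v j \<in> tangent_space M p) \<Longrightarrow> (\<lambda>f. \<Sum>j\<in>A. v j f) \<in> tangent_space M p"
  by (induction A rule: infinite_finite_induct) (auto intro: tangent_space_add tangent_space_zero)


section \<open>Vector fields\<close>

lemma vector_field_tangent: "vector_field M W X \<Longrightarrow> p \<in> W \<Longrightarrow> X p \<in> tangent_space M p"
  unfolding vector_field_def by blast

lemma vector_field_smooth:
  "vector_field M W X \<Longrightarrow> openin (mtop M) W' \<Longrightarrow> W' \<subseteq> W \<Longrightarrow> smooth_on M W' f \<Longrightarrow> smooth_on M W' (\<lambda>p. X p f)"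
  unfolding vector_field_def by blast

lemma vector_field_smooth_at:
  assumes X: "vector_field M W X" and W: "openin (mtop M) W" "p \<in> W" and f: "smooth_at M p f"
  shows "smooth_at M p (\<lambda>q. X q f)"
proof -
  obtain W' where W': "openin (mtop M) W'" "p \<in> W'" "smooth_on M W' f"
    using f unfolding smooth_at_def by blast
  show ?thesis
    by (rule smooth_atI[of "W \<inter> W'"])
      (use W W' in \<open>auto intro!: vector_field_smooth[OF X] intro: smooth_on_subset\<close>)
qed

lemma vector_field_subset: "vector_field M W X \<Longrightarrow> W' \<subseteq> W \<Longrightarrow> vector_field M W' X"
  unfolding vector_field_def by (meson subset_iff subset_trans)

lemma vector_field_cong:
  assumes X: "vector_field M W X" and eq: "\<And>p. p \<in> W \<Longrightarrow> X p = Y p"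
  shows "vector_field M W Y"
  unfolding vector_field_def
proof (intro conjI allI impI ballI)
  show "Y p \<in> tangent_space M p" if "p \<in> W" for p using vector_field_tangent[OF X that] eq that by simp
  fix W' f assume *: "openin (mtop M) W'" "W' \<subseteq> W" "smooth_on M W' f"
  show "smooth_on M W' (\<lambda>p. Y p f)"
    by (rule smooth_on_cong[OF *(1) _ vector_field_smooth[OF X *]]) (use eq * in auto)
qed

lemma vector_field_add:
  "vector_field M W X \<Longrightarrow> vector_field M W Y \<Longrightarrow> vector_field M W (\<lambda>q f. X q f + Y q f)"
  unfolding vector_field_def by (simp add: tangent_space_add smooth_on_add)

lemma vector_field_scale:
  "vector_field M W X \<Longrightarrow> smooth_on M W a \<Longrightarrow> vector_field M W (\<lambda>q f. a q * X q f)"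
  unfolding vector_field_def using tangent_space_cmult smooth_on_mult smooth_on_subset by fastforce

lemma vector_field_zero: "openin (mtop M) W \<Longrightarrow> vector_field M W (\<lambda>q f. 0)"
  unfolding vector_field_def by (simp add: tangent_space_zero openin_points smooth_on_const)

lemma vector_field_sum:
  "openin (mtop M) W \<Longrightarrow> (\<And>j. j \<in> A \<Longrightarrow> vector_field M W (X j)) \<Longrightarrow> vector_field M W (\<lambda>q f. \<Sum>j\<in>A. X j q f)"
  by (induction A rule: infinite_finite_induct) (auto intro: vector_field_add vector_field_zero)

lemma vector_field_local:
  assumes "\<And>p. p \<in> W \<Longrightarrow> \<exists>W'. openin (mtop M) W' \<and> p \<in> W' \<and> vector_field M W' X"
  shows "vector_field M W X"
  unfolding vector_field_def
proof (intro conjI allI impI ballI)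
  show "X p \<in> tangent_space M p" if "p \<in> W" for p using vector_field_tangent assms that by blast
  fix W' f assume *: "openin (mtop M) W'" "W' \<subseteq> W" "smooth_on M W' f"
  show "smooth_on M W' (\<lambda>p. X p f)"
  proof (rule smooth_on_local)
    fix q assume "q \<in> W'"
    then obtain W'' where W'': "openin (mtop M) W''" "q \<in> W''" "vector_field M W'' X"
      using assms * by blast
    have "smooth_on M (W' \<inter> W'') (\<lambda>p. X p f)"
      by (rule vector_field_smooth[OF W''(3)]) (use * W'' smooth_on_subset in auto)
    then show "\<exists>T. openin (mtop M) T \<and> q \<in> T \<and> T \<subseteq> W' \<and> smooth_on M T (\<lambda>p. X p f)"
      using * W'' \<open>q \<in> W'\<close> by (intro exI[of _ "W' \<inter> W''"]) auto
  qed
qed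

text \<open>The coordinate field d/dx_k. The value 0 at functions that are not smooth is the
  normalisation built into \<open>tangent_space\<close>.\<close>

definition coord_field :: "'a set \<Rightarrow> ('a \<Rightarrow> nat \<Rightarrow> real) \<Rightarrow> nat \<Rightarrow> 'a vfield" where
  "coord_field U \<phi> k p f = (if smooth_at M p f then partial k (\<lambda>x. f (inv_into U \<phi> x)) (\<phi> p) else 0)"

lemma chart_partial:
  assumes c: "(U, \<phi>) \<in> charts M" and p: "p \<in> U" and f: "smooth_at M p f" and k: "k < mdim M"
  shows "((\<lambda>s. f (inv_into U \<phi> ((\<phi> p)(k := s)))) has_real_derivative
      partial k (\<lambda>x. f (inv_into U \<phi> x)) (\<phi> p)) (at (\<phi> p k))"
proof -
  obtain W where W: "openin (mtop M) W" "p \<in> W" "smooth_on M W f"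
    using f unfolding smooth_at_def by blast
  show ?thesis by (rule Cinf_on_partial(2)[OF smooth_onD[OF W(3) c] k]) (use p W in auto)
qed

lemma vector_field_coord_field:
  assumes c: "(U, \<phi>) \<in> charts M" and k: "k < mdim M"
  shows "vector_field M U (coord_field U \<phi> k)"
  unfolding vector_field_def
proof (intro conjI allI impI ballI)
  fix p assume p: "p \<in> U"
  note D = chart_partial[OF c p _ k]
  show "coord_field U \<phi> k p \<in> tangent_space M p"
    unfolding tangent_space_def
  proof (intro CollectI conjI allI impI)
    fix f g a assume f: "smooth_at M p f"
    show "coord_field U \<phi> k p (\<lambda>q. a * f q) = a * coord_field U \<phi> k p f"
      using f smooth_at_mult[OF smooth_at_const f, of a] openin_points[OF chart_open[OF c] p]
        partial_eqI[OF DERIV_cmult[OF D[OF f]], of a]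
      by (simp add: coord_field_def)
    assume g: "smooth_at M p g"
    show "coord_field U \<phi> k p (\<lambda>q. f q + g q) = coord_field U \<phi> k p f + coord_field U \<phi> k p g"
      using f g smooth_at_add[OF f g] partial_eqI[OF DERIV_add[OF D[OF f] D[OF g]]]
      by (simp add: coord_field_def)
    show "coord_field U \<phi> k p (\<lambda>q. f q * g q) = f p * coord_field U \<phi> k p g + coord_field U \<phi> k p f * g p"
      using f g smooth_at_mult[OF f g] partial_eqI[OF DERIV_mult[OF D[OF f] D[OF g]]] chart_inv[OF c p]
      by (simp add: coord_field_def)
  qed (simp add: coord_field_def)
next
  fix W f assume W: "openin (mtop M) W" "W \<subseteq> U" and f: "smooth_on M W f"
  have im: "\<phi> ` (U \<inter> W) = \<phi> ` W" using W(2) by (simp add: inf.absorb2)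
  have "smooth_on M W (\<lambda>p. partial k (\<lambda>x. f (inv_into U \<phi> x)) (\<phi> p))"
  proof (rule smooth_on_chartI[OF c W])
    show "Cinf_on (mdim M) (\<phi> ` W) (\<lambda>x. partial k (\<lambda>x. f (inv_into U \<phi> x)) (\<phi> (inv_into U \<phi> x)))"
      by (rule Cinf_on_cong[OF chart_image_subset_open[OF c W] _
            Cinf_on_partial(1)[OF smooth_onD[OF f c, unfolded im] k]])
        (use W(2) in \<open>metis f_inv_into_f image_mono subsetD\<close>)
  qed
  then show "smooth_on M W (\<lambda>p. coord_field U \<phi> k p f)"
    by (rule smooth_on_cong[OF W(1), rotated]) (use smooth_atI[OF W(1) _ f] in \<open>simp add: coord_field_def\<close>)
qed

lemma coord_field_coord:
  assumes c: "(U, \<phi>) \<in> charts M" and p: "p \<in> U" and k: "k < mdim M" and j: "j < mdim M"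
  shows "coord_field U \<phi> k p (\<lambda>q. \<phi> q j) = (if j = k then 1 else 0)"
proof -
  have s: "smooth_at M p (\<lambda>q. \<phi> q j)" by (rule smooth_atI[OF chart_open[OF c] p smooth_on_coord[OF c j]])
  note V = chart_image_open[OF c chart_open[OF c], simplified]
  have "partial k (\<lambda>x. \<phi> (inv_into U \<phi> x) j) (\<phi> p) = partial k (\<lambda>x. x j) (\<phi> p)"
    by (rule partial_cong(1)[OF V _ k]) (use p in \<open>auto simp: f_inv_into_f\<close>)
  also have "\<dots> = (if j = k then 1 else 0)"
    by (rule partial_eqI) auto
  finally show ?thesis using s by (simp add: coord_field_def)
qed

lemma tangent_coord_field:
  assumes v: "v \<in> tangent_space M p" and c: "(U, \<phi>) \<in> charts M" and p: "p \<in> U"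
  shows "v = (\<lambda>f. \<Sum>k<mdim M. v (\<lambda>q. \<phi> q k) * coord_field U \<phi> k p f)"
proof
  fix f show "v f = (\<Sum>k<mdim M. v (\<lambda>q. \<phi> q k) * coord_field U \<phi> k p f)"
    using tangent_chart[OF v c p] tangent_not_smooth[OF v]
    by (cases "smooth_at M p f") (simp_all add: coord_field_def)
qed

text \<open>Constant coefficients with respect to the coordinate fields suffice; the extension lives
  on the chart domain only, so no cutoff enters.\<close>

lemma vector_field_extension:
  assumes v: "v \<in> tangent_space M p" and c: "(U, \<phi>) \<in> charts M" and p: "p \<in> U"
  obtains X where "vector_field M U X" "X p = v"
proof
  show "vector_field M U (\<lambda>q f. \<Sum>k<mdim M. v (\<lambda>q. \<phi> q k) * coord_field U \<phi> k q f)"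
    by (intro vector_field_sum vector_field_scale chart_open[OF c] vector_field_coord_field[OF c] smooth_on_const)
      simp
  show "(\<lambda>f. \<Sum>k<mdim M. v (\<lambda>q. \<phi> q k) * coord_field U \<phi> k p f) = v"
    using tangent_coord_field[OF v c p] by simp
qed

text \<open>In the Leibniz rule the mixed terms \<open>X f * Y g\<close> and
  \<open>Y f * X g\<close> occur in both compositions and cancel. The rules for the inner derivative
  hold only at points near \<open>p\<close>, where f and g are smooth, so
  \<open>tangent_cong\<close> comes before the outer derivative.\<close>

lemma lie_bracket_tangent:
  assumes W: "openin (mtop M) W" and X: "vector_field M W X" and Y: "vector_field M W Y" and p: "p \<in> W"
  shows "lie_bracket M X Y p \<in> tangent_space M p"
  unfolding tangent_space_def
proof (intro CollectI conjI allI impI)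
  note XT = vector_field_tangent[OF X] and YT = vector_field_tangent[OF Y]
  note Xs = vector_field_smooth_at[OF X W] and Ys = vector_field_smooth_at[OF Y W]
  fix f g a assume f: "smooth_at M p f"
  obtain W1 where W1: "openin (mtop M) W1" "p \<in> W1" "smooth_on M W1 f"
    using f unfolding smooth_at_def by blast
  note fs = smooth_atI[OF W1(1) _ W1(3)]
  have af: "smooth_at M p (\<lambda>q. a * f q)"
    using smooth_at_mult[OF smooth_at_const f] openin_points[OF W p] by simp
  have "X p (\<lambda>q. Y q (\<lambda>q. a * f q)) = X p (\<lambda>q. a * Y q f)"
    by (rule tangent_cong[OF XT[OF p], of "W \<inter> W1"]) (use W W1 p tangent_cmult[OF YT fs] in auto)
  moreover have "Y p (\<lambda>q. X q (\<lambda>q. a * f q)) = Y p (\<lambda>q. a * X q f)"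
    by (rule tangent_cong[OF YT[OF p], of "W \<inter> W1"]) (use W W1 p tangent_cmult[OF XT fs] in auto)
  ultimately show "lie_bracket M X Y p (\<lambda>q. a * f q) = a * lie_bracket M X Y p f"
    using f af tangent_cmult[OF XT[OF p] Ys[OF p f]] tangent_cmult[OF YT[OF p] Xs[OF p f]]
    by (simp add: lie_bracket_def algebra_simps)
  assume g: "smooth_at M p g"
  obtain W2 where W2: "openin (mtop M) W2" "p \<in> W2" "smooth_on M W2 g"
    using g unfolding smooth_at_def by blast
  note gs = smooth_atI[OF W2(1) _ W2(3)]
  define W' where "W' = W \<inter> W1 \<inter> W2"
  have W': "openin (mtop M) W'" "p \<in> W'" "W' \<subseteq> W" "W' \<subseteq> W1" "W' \<subseteq> W2" using W W1 W2 p by (auto simp: W'_def)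
  note fs' = fs[OF subsetD[OF W'(4)]] and gs' = gs[OF subsetD[OF W'(5)]]
  have "X p (\<lambda>q. Y q (\<lambda>q. f q + g q)) = X p (\<lambda>q. Y q f + Y q g)"
    by (rule tangent_cong[OF XT[OF p] W'(1,2)]) (use W' tangent_add[OF YT fs' gs'] in auto)
  moreover have "Y p (\<lambda>q. X q (\<lambda>q. f q + g q)) = Y p (\<lambda>q. X q f + X q g)"
    by (rule tangent_cong[OF YT[OF p] W'(1,2)]) (use W' tangent_add[OF XT fs' gs'] in auto)
  ultimately show "lie_bracket M X Y p (\<lambda>q. f q + g q) = lie_bracket M X Y p f + lie_bracket M X Y p g"
    using f g smooth_at_add[OF f g] tangent_add[OF XT[OF p] Ys[OF p f] Ys[OF p g]]
      tangent_add[OF YT[OF p] Xs[OF p f] Xs[OF p g]]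
    by (simp add: lie_bracket_def)
  have "X p (\<lambda>q. Y q (\<lambda>q. f q * g q)) = X p (\<lambda>q. f q * Y q g + Y q f * g q)"
    by (rule tangent_cong[OF XT[OF p] W'(1,2)]) (use W' tangent_mult[OF YT fs' gs'] in auto)
  moreover have "Y p (\<lambda>q. X q (\<lambda>q. f q * g q)) = Y p (\<lambda>q. f q * X q g + X q f * g q)"
    by (rule tangent_cong[OF YT[OF p] W'(1,2)]) (use W' tangent_mult[OF XT fs' gs'] in auto)
  moreover have "X p (\<lambda>q. f q * Y q g + Y q f * g q) =
      f p * X p (\<lambda>q. Y q g) + X p f * Y p g + (Y p f * X p g + X p (\<lambda>q. Y q f) * g p)"
    using tangent_add[OF XT[OF p] smooth_at_mult[OF f Ys[OF p g]] smooth_at_mult[OF Ys[OF p f] g]]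
      tangent_mult[OF XT[OF p] f Ys[OF p g]] tangent_mult[OF XT[OF p] Ys[OF p f] g] by simp
  moreover have "Y p (\<lambda>q. f q * X q g + X q f * g q) =
      f p * Y p (\<lambda>q. X q g) + Y p f * X p g + (X p f * Y p g + Y p (\<lambda>q. X q f) * g p)"
    using tangent_add[OF YT[OF p] smooth_at_mult[OF f Xs[OF p g]] smooth_at_mult[OF Xs[OF p f] g]]
      tangent_mult[OF YT[OF p] f Xs[OF p g]] tangent_mult[OF YT[OF p] Xs[OF p f] g] by simp
  ultimately show "lie_bracket M X Y p (\<lambda>q. f q * g q) = f p * lie_bracket M X Y p g + lie_bracket M X Y p f * g p"
    using f g smooth_at_mult[OF f g] by (simp add: lie_bracket_def algebra_simps)
qed (simp add: lie_bracket_def)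

lemma lie_bracket_vector_field:
  assumes W: "openin (mtop M) W" and X: "vector_field M W X" and Y: "vector_field M W Y"
  shows "vector_field M W (lie_bracket M X Y)"
  unfolding vector_field_def
proof (intro conjI allI impI ballI)
  show "lie_bracket M X Y p \<in> tangent_space M p" if "p \<in> W" for p
    using lie_bracket_tangent[OF W X Y that] .
  fix W' f assume *: "openin (mtop M) W'" "W' \<subseteq> W" "smooth_on M W' f"
  have "smooth_on M W' (\<lambda>p. X p (\<lambda>q. Y q f) - Y p (\<lambda>q. X q f))"
    by (intro smooth_on_diff vector_field_smooth[OF X *(1,2)] vector_field_smooth[OF Y *(1,2)] *)
  then show "smooth_on M W' (\<lambda>p. lie_bracket M X Y p f)"
    by (rule smooth_on_cong[OF *(1), rotated]) (use smooth_atI[OF *(1) _ *(3)] in \<open>simp add: lie_bracket_def\<close>)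
qed

end


section \<open>Orthogonal frames\<close>

text \<open>Gaussian elimination, by induction on the number of equations. The dimension arguments
  in tangent spaces rest on it, with values on coordinate functions or inner products as the
  matrix.\<close>

lemma homogeneous_system_nontrivial:
  fixes c :: "'i \<Rightarrow> nat \<Rightarrow> real"
  assumes "finite A" "k < card A"
  shows "\<exists>a. (\<exists>i\<in>A. a i \<noteq> 0) \<and> (\<forall>j<k. (\<Sum>i\<in>A. a i * c i j) = 0)"
  using assms
proof (induction k arbitrary: A c)
  case 0
  then show ?case by (intro exI[of _ "\<lambda>i. 1"]) (auto simp: card_gt_0_iff)
next
  case (Suc k)
  show ?case
  proof (cases "\<forall>i\<in>A. c i k = 0")
    case True
    obtain a where a: "\<exists>i\<in>A. a i \<noteq> 0" "\<forall>j<k. (\<Sum>i\<in>A. a i * c i j) = 0"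
      using Suc.IH[of A c] Suc.prems by auto
    have "(\<Sum>i\<in>A. a i * c i j) = 0" if "j < Suc k" for j
    proof (cases "j = k")
      case True
      then show ?thesis using \<open>\<forall>i\<in>A. c i k = 0\<close> by (simp add: sum.neutral)
    next
      case False
      then show ?thesis using a(2) that by simp
    qed
    then show ?thesis using a(1) by blast
  next
    case False
    then obtain i0 where i0: "i0 \<in> A" "c i0 k \<noteq> 0" by blast
    \<comment> \<open>The last equation is solved for the unknown \<open>i0\<close> and substituted
      into the others; \<open>a'\<close> puts that unknown back.\<close>
    define c' where "c' i j = c i j - c i k / c i0 k * c i0 j" for i j
    have "k < card (A - {i0})" "finite (A - {i0})" using Suc.prems i0(1) by auto
    then obtain a where a: "\<exists>i\<in>A - {i0}. a i \<noteq> 0" "\<forall>j<k. (\<Sum>i\<in>A - {i0}. a i * c' i j) = 0"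
      using Suc.IH[of "A - {i0}" c'] by auto
    define s where "s = (\<Sum>i\<in>A - {i0}. a i * c i k)"
    define a' where "a' = a(i0 := - s / c i0 k)"
    have split: "(\<Sum>i\<in>A. a' i * c i j) = - s / c i0 k * c i0 j + (\<Sum>i\<in>A - {i0}. a i * c i j)" for j
    proof -
      have "(\<Sum>i\<in>A. a' i * c i j) = a' i0 * c i0 j + (\<Sum>i\<in>A - {i0}. a' i * c i j)"
        using sum.remove[OF Suc.prems(1) i0(1)] .
      also have "(\<Sum>i\<in>A - {i0}. a' i * c i j) = (\<Sum>i\<in>A - {i0}. a i * c i j)"
        by (rule sum.cong) (auto simp: a'_def)
      finally show ?thesis by (simp add: a'_def)
    qed
    have "(\<Sum>i\<in>A. a' i * c i j) = 0" if "j < Suc k" for j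
    proof (cases "j = k")
      case True
      then show ?thesis unfolding split using i0(2) by (simp add: s_def)
    next
      case False
      then have "(\<Sum>i\<in>A - {i0}. a i * c' i j) = 0" using a(2) that by simp
      moreover have "(\<Sum>i\<in>A - {i0}. a i * c' i j) = (\<Sum>i\<in>A - {i0}. a i * c i j) - s / c i0 k * c i0 j"
        by (simp add: c'_def s_def algebra_simps sum_subtractf sum_distrib_left sum_divide_distrib)
      ultimately show ?thesis unfolding split by simp
    qed
    moreover have "\<exists>i\<in>A. a' i \<noteq> 0" using a(1) by (auto simp: a'_def)
    ultimately show ?thesis by blast
  qed
qed

locale metric_manifold = smooth_atlas M for M :: "'a manifold" +
  fixes g :: "'a metric"
  assumes g_sym: "p \<in> points M \<Longrightarrow> u \<in> tangent_space M p \<Longrightarrow> v \<in> tangent_space M p \<Longrightarrow> g p u v = g p v u"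
    and g_add_left: "p \<in> points M \<Longrightarrow> u \<in> tangent_space M p \<Longrightarrow> v \<in> tangent_space M p \<Longrightarrow>
      w \<in> tangent_space M p \<Longrightarrow> g p (\<lambda>f. u f + v f) w = g p u w + g p v w"
    and g_cmult_left: "p \<in> points M \<Longrightarrow> u \<in> tangent_space M p \<Longrightarrow> v \<in> tangent_space M p \<Longrightarrow>
      g p (\<lambda>f. c * u f) v = c * g p u v"
    and g_nondegenerate: "p \<in> points M \<Longrightarrow> u \<in> tangent_space M p \<Longrightarrow>
      (\<And>v. v \<in> tangent_space M p \<Longrightarrow> g p u v = 0) \<Longrightarrow> u = (\<lambda>f. 0)"
    and g_smooth: "openin (mtop M) W \<Longrightarrow> vector_field M W X \<Longrightarrow> vector_field M W Y \<Longrightarrow>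
      smooth_on M W (\<lambda>p. g p (X p) (Y p))"

lemma pseudo_riemannian_imp_metric_manifold:
  assumes "pseudo_riemannian M g"
  shows "metric_manifold M g"
proof -
  interpret smooth_atlas M
    by (rule smooth_manifold_imp_smooth_atlas) (use assms in \<open>simp add: pseudo_riemannian_def\<close>)
  note A = assms[unfolded pseudo_riemannian_def, THEN conjunct2]
  note bilinear = A[THEN conjunct1, THEN bspec, THEN bspec, THEN bspec]
  note nondegenerate = A[THEN conjunct2, THEN conjunct1, THEN bspec, THEN bspec]
  note smooth = A[THEN conjunct2, THEN conjunct2, THEN conjunct1]
  show ?thesis
  proof
    fix p u v assume *: "p \<in> points M" "u \<in> tangent_space M p" "v \<in> tangent_space M p"
    show "g p u v = g p v u" "\<And>c. g p (\<lambda>f. c * u f) v = c * g p u v"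
      using bilinear[OF *] by simp_all
    show "g p (\<lambda>f. u f + v f) w = g p u w + g p v w" if "w \<in> tangent_space M p" for w
      using bilinear[OF *] that by simp
  next
    fix p u assume "p \<in> points M" "u \<in> tangent_space M p" "\<And>v. v \<in> tangent_space M p \<Longrightarrow> g p u v = 0"
    then show "u = (\<lambda>f. 0)" using nondegenerate by simp
  next
    fix W X Y assume "openin (mtop M) W" "vector_field M W X" "vector_field M W Y"
    then show "smooth_on M W (\<lambda>p. g p (X p) (Y p))" using smooth by simp
  qed
qed

context metric_manifold begin

context
  fixes p
  assumes p: "p \<in> points M"
begin

lemma g_add_right: "u \<in> tangent_space M p \<Longrightarrow> v \<in> tangent_space M p \<Longrightarrow>
    w \<in> tangent_space M p \<Longrightarrow> g p w (\<lambda>f. u f + v f) = g p w u + g p w v"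
  using g_add_left[OF p, of u v w] g_sym[OF p] tangent_space_add by simp

lemma g_cmult_right: "u \<in> tangent_space M p \<Longrightarrow> v \<in> tangent_space M p \<Longrightarrow>
    g p v (\<lambda>f. c * u f) = c * g p v u"
  using g_cmult_left[OF p, of u v c] g_sym[OF p] tangent_space_cmult by simp

lemma g_zero_left: "u \<in> tangent_space M p \<Longrightarrow> g p (\<lambda>f. 0) u = 0"
  using g_cmult_left[OF p, of u u 0] by simp

lemma g_zero_right: "u \<in> tangent_space M p \<Longrightarrow> g p u (\<lambda>f. 0) = 0"
  using g_cmult_right[of u u 0] by simp

lemma g_sum_left:
  assumes "w \<in> tangent_space M p"
  shows "(\<And>j. j \<in> A \<Longrightarrow> u j \<in> tangent_space M p) \<Longrightarrow> g p (\<lambda>f. \<Sum>j\<in>A. u j f) w = (\<Sum>j\<in>A. g p (u j) w)"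
  by (induction A rule: infinite_finite_induct)
    (auto simp: g_zero_left[OF assms] g_add_left[OF p _ _ assms] tangent_space_sum[OF p])

lemma g_sum_right:
  assumes "w \<in> tangent_space M p"
  shows "(\<And>j. j \<in> A \<Longrightarrow> u j \<in> tangent_space M p) \<Longrightarrow> g p w (\<lambda>f. \<Sum>j\<in>A. u j f) = (\<Sum>j\<in>A. g p w (u j))"
  by (induction A rule: infinite_finite_induct)
    (auto simp: g_zero_right[OF assms] g_add_right[OF _ _ assms] tangent_space_sum[OF p])

lemma tangent_space_lincomb:
  assumes "\<And>j. j \<in> A \<Longrightarrow> u j \<in> tangent_space M p"
  shows "(\<lambda>f. \<Sum>j\<in>A. a j * u j f) \<in> tangent_space M p"
  by (intro tangent_space_sum[OF p] tangent_space_cmult assms)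

lemma g_lincomb_left:
  assumes w: "w \<in> tangent_space M p" and u: "\<And>j. j \<in> A \<Longrightarrow> u j \<in> tangent_space M p"
  shows "g p (\<lambda>f. \<Sum>j\<in>A. a j * u j f) w = (\<Sum>j\<in>A. a j * g p (u j) w)"
proof -
  have "g p (\<lambda>f. \<Sum>j\<in>A. a j * u j f) w = (\<Sum>j\<in>A. g p (\<lambda>f. a j * u j f) w)"
    by (rule g_sum_left[OF w tangent_space_cmult[OF u]])
  also have "\<dots> = (\<Sum>j\<in>A. a j * g p (u j) w)"
    by (rule sum.cong[OF refl g_cmult_left[OF p u w]])
  finally show ?thesis .
qed

lemma g_lincomb_right:
  assumes w: "w \<in> tangent_space M p" and u: "\<And>j. j \<in> A \<Longrightarrow> u j \<in> tangent_space M p"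
  shows "g p w (\<lambda>f. \<Sum>j\<in>A. a j * u j f) = (\<Sum>j\<in>A. a j * g p w (u j))"
proof -
  have "g p w (\<lambda>f. \<Sum>j\<in>A. a j * u j f) = (\<Sum>j\<in>A. g p w (\<lambda>f. a j * u j f))"
    by (rule g_sum_right[OF w tangent_space_cmult[OF u]])
  also have "\<dots> = (\<Sum>j\<in>A. a j * g p w (u j))"
    by (rule sum.cong[OF refl g_cmult_right[OF u w]])
  finally show ?thesis .
qed

lemma tangent_space_diff:
  assumes "u \<in> tangent_space M p" "v \<in> tangent_space M p"
  shows "(\<lambda>f. u f - v f) \<in> tangent_space M p"
  using tangent_space_add[OF assms(1) tangent_space_cmult[OF assms(2), of "-1"]] by simp

lemma g_diff_left:
  assumes "u \<in> tangent_space M p" "v \<in> tangent_space M p" "w \<in> tangent_space M p"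
  shows "g p (\<lambda>f. u f - v f) w = g p u w - g p v w"
  using g_add_left[OF p assms(1) tangent_space_cmult[OF assms(2), of "-1"] assms(3)]
    g_cmult_left[OF p assms(2,3), of "-1"] by simp

lemma g_diff_right:
  assumes "u \<in> tangent_space M p" "v \<in> tangent_space M p" "w \<in> tangent_space M p"
  shows "g p w (\<lambda>f. u f - v f) = g p w u - g p w v"
  using g_diff_left[OF assms] g_sym[OF p] assms tangent_space_diff by simp

text \<open>One Gram-Schmidt step. Only the norms of the \<open>e k\<close> are divided by, so
  \<open>v\<close> and the remainder may be isotropic.\<close>

lemma orthogonal_projection:
  fixes e :: "'i \<Rightarrow> 'a tangent"
  assumes K: "finite K" and e: "\<And>k. k \<in> K \<Longrightarrow> e k \<in> tangent_space M p"
    and orth: "\<And>j k. j \<in> K \<Longrightarrow> k \<in> K \<Longrightarrow> j \<noteq> k \<Longrightarrow> g p (e j) (e k) = 0"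
    and nz: "\<And>k. k \<in> K \<Longrightarrow> g p (e k) (e k) \<noteq> 0"
    and v: "v \<in> tangent_space M p"
  defines "w \<equiv> (\<lambda>f. v f - (\<Sum>k\<in>K. g p v (e k) / g p (e k) (e k) * e k f))"
  shows "w \<in> tangent_space M p" and "\<And>k. k \<in> K \<Longrightarrow> g p w (e k) = 0"
proof -
  have S: "(\<lambda>f. \<Sum>k\<in>K. g p v (e k) / g p (e k) (e k) * e k f) \<in> tangent_space M p"
    by (rule tangent_space_lincomb[OF e])
  show "w \<in> tangent_space M p" unfolding w_def by (rule tangent_space_diff[OF v S])
  fix k assume k: "k \<in> K"
  have "g p (\<lambda>f. \<Sum>j\<in>K. g p v (e j) / g p (e j) (e j) * e j f) (e k)
      = (\<Sum>j\<in>K. g p v (e j) / g p (e j) (e j) * g p (e j) (e k))"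
    by (rule g_lincomb_left[OF e[OF k] e])
  also have "\<dots> = (\<Sum>j\<in>K. if j = k then g p v (e k) else 0)"
    by (rule sum.cong) (use orth k nz in auto)
  finally show "g p w (e k) = 0" unfolding w_def using g_diff_left[OF v S e[OF k]] K k by simp
qed

text \<open>The remainder \<open>w\<close> together with the \<open>e k\<close> makes
  \<open>mdim M + 1\<close> vectors, which are dependent because a tangent vector is determined by
  \<open>mdim M\<close> coordinate values. Pairing a relation with \<open>e j\<close> removes its
  coefficient number \<open>j\<close>, so the relation reduces to a nonzero multiple of
  \<open>w\<close>.\<close>

lemma orthogonal_expansion:
  assumes e: "\<And>k. k < mdim M \<Longrightarrow> e k \<in> tangent_space M p"
    and orth: "\<And>j k. j < mdim M \<Longrightarrow> k < mdim M \<Longrightarrow> j \<noteq> k \<Longrightarrow> g p (e j) (e k) = 0"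
    and nz: "\<And>k. k < mdim M \<Longrightarrow> g p (e k) (e k) \<noteq> 0"
    and v: "v \<in> tangent_space M p"
  shows "v = (\<lambda>f. \<Sum>k<mdim M. g p v (e k) / g p (e k) (e k) * e k f)"
proof -
  define n where "n = mdim M"
  obtain U \<phi> where c: "(U, \<phi>) \<in> charts M" "p \<in> U" using chart_cover[OF p] by blast
  define w where "w = (\<lambda>f. v f - (\<Sum>k<n. g p v (e k) / g p (e k) (e k) * e k f))"
  have w: "w \<in> tangent_space M p" "\<And>k. k < n \<Longrightarrow> g p w (e k) = 0"
    using orthogonal_projection[of "{..<n}" e v] e orth nz v unfolding w_def n_def by auto
  define z where "z k = (if k < n then e k else w)" for k
  have z: "z k \<in> tangent_space M p" for k using e w by (auto simp: z_def n_def)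
  obtain a where a: "\<exists>k\<in>{..n}. a k \<noteq> 0" "\<And>j. j < n \<Longrightarrow> (\<Sum>k\<le>n. a k * z k (\<lambda>q. \<phi> q j)) = 0"
    using homogeneous_system_nontrivial[of "{..n}" n "\<lambda>k j. z k (\<lambda>q. \<phi> q j)"] by auto
  have rel: "(\<lambda>f. \<Sum>k\<le>n. a k * z k f) = (\<lambda>f. 0)"
    by (rule tangent_chart_eqI[OF tangent_space_lincomb[OF z]
          tangent_space_zero[OF p] c]) (use a(2) in \<open>simp add: n_def\<close>)
  have "a j = 0" if j: "j < n" for j
  proof -
    have "0 = g p (\<lambda>f. \<Sum>k\<le>n. a k * z k f) (e j)" unfolding rel using g_zero_left e j by (simp add: n_def)
    also have "\<dots> = (\<Sum>k\<le>n. a k * g p (z k) (e j))"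
      by (rule g_lincomb_left[OF _ z]) (use e j in \<open>simp add: n_def\<close>)
    also have "\<dots> = (\<Sum>k\<le>n. if k = j then a j * g p (e j) (e j) else 0)"
      by (rule sum.cong) (use orth j w in \<open>auto simp: z_def n_def\<close>)
    finally show ?thesis using j nz by (simp add: n_def)
  qed
  then have "a n \<noteq> 0" using a(1) by (metis atMost_iff le_neq_implies_less)
  moreover have "a n * w f = 0" for f
  proof -
    have "0 = (\<Sum>k\<le>n. a k * z k f)" using fun_cong[OF rel, of f] by simp
    also have "\<dots> = (\<Sum>k\<le>n. if k = n then a n * w f else 0)"
      by (rule sum.cong) (use \<open>\<And>j. j < n \<Longrightarrow> a j = 0\<close> in \<open>auto simp: z_def\<close>)
    finally show ?thesis by simp
  qed
  ultimately have "w f = 0" for f by simp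
  then show ?thesis by (auto simp: w_def n_def fun_eq_iff)
qed

text \<open>Otherwise the metric vanishes on the orthogonal complement of the vectors e j by polarisation,
  so that these k vectors span the tangent space, which contains mdim M independent ones.\<close>

lemma orthogonal_complement_nonisotropic:
  assumes k: "k < mdim M" and e: "\<And>j. j < k \<Longrightarrow> e j \<in> tangent_space M p"
    and orth: "\<And>i j. i < k \<Longrightarrow> j < k \<Longrightarrow> i \<noteq> j \<Longrightarrow> g p (e i) (e j) = 0"
    and nz: "\<And>j. j < k \<Longrightarrow> g p (e j) (e j) \<noteq> 0"
  shows "\<exists>u\<in>tangent_space M p. (\<forall>j<k. g p u (e j) = 0) \<and> g p u u \<noteq> 0"
proof (rule ccontr)
  assume "\<not> ?thesis"
  then have iso: "g p u u = 0" if "u \<in> tangent_space M p" "\<And>j. j < k \<Longrightarrow> g p u (e j) = 0" for u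
    using that by blast
  have polar: "g p u v = 0" if u: "u \<in> tangent_space M p" "\<And>j. j < k \<Longrightarrow> g p u (e j) = 0"
    and v: "v \<in> tangent_space M p" "\<And>j. j < k \<Longrightarrow> g p v (e j) = 0" for u v
  proof -
    have uv: "(\<lambda>f. u f + v f) \<in> tangent_space M p" using tangent_space_add u v by blast
    have "g p (\<lambda>f. u f + v f) (\<lambda>f. u f + v f) = 0"
      by (rule iso[OF uv]) (use u v e in \<open>simp add: g_add_left[OF p]\<close>)
    then show ?thesis
      using g_add_left[OF p u(1) v(1) uv] g_add_right[OF u(1) v(1)] u v iso[OF u] iso[OF v]
        g_sym[OF p u(1) v(1)] by simp
  qed
  obtain U \<phi> where c: "(U, \<phi>) \<in> charts M" "p \<in> U" using chart_cover[OF p] by blast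
  have expand: "v = (\<lambda>f. \<Sum>j<k. g p v (e j) / g p (e j) (e j) * e j f)"
    if v: "v \<in> tangent_space M p" for v
  proof -
    define pr where "pr v = (\<lambda>f. v f - (\<Sum>j<k. g p v (e j) / g p (e j) (e j) * e j f))" for v
    have pr: "pr v \<in> tangent_space M p" "\<And>j. j < k \<Longrightarrow> g p (pr v) (e j) = 0"
      if "v \<in> tangent_space M p" for v
      using orthogonal_projection[of "{..<k}" e v] e orth nz that unfolding pr_def by auto
    \<comment> \<open>The remainder \<open>pr v\<close> is orthogonal to the \<open>e j\<close> and,
      by \<open>polar\<close>, to every other remainder, hence to the whole tangent space.\<close>
    have "g p (pr v) v' = 0" if v': "v' \<in> tangent_space M p" for v'
    proof -
      have S: "(\<lambda>f. \<Sum>j<k. g p v' (e j) / g p (e j) (e j) * e j f) \<in> tangent_space M p"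
        by (rule tangent_space_lincomb[OF e]) simp
      have "g p (pr v) (\<lambda>f. \<Sum>j<k. g p v' (e j) / g p (e j) (e j) * e j f)
          = (\<Sum>j<k. g p v' (e j) / g p (e j) (e j) * g p (pr v) (e j))"
        by (rule g_lincomb_right[OF pr(1)[OF v] e]) simp
      then have "g p (pr v) (\<lambda>f. \<Sum>j<k. g p v' (e j) / g p (e j) (e j) * e j f) = 0"
        using pr(2)[OF v] by simp
      then have "g p (pr v) v' = g p (pr v) (pr v')"
        using g_diff_right[OF v' S pr(1)[OF v]] by (simp add: pr_def[of v'])
      then show ?thesis using polar[OF pr[OF v] pr[OF v']] by simp
    qed
    then have "pr v = (\<lambda>f. 0)" using g_nondegenerate[OF p pr(1)[OF v]] by blast
    then show ?thesis by (auto simp: pr_def fun_eq_iff)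
  qed
  define d where "d i = coord_field U \<phi> i p" for i
  have d: "d i \<in> tangent_space M p" if "i < mdim M" for i
    using vector_field_tangent[OF vector_field_coord_field[OF c(1) that] c(2)] by (simp add: d_def)
  \<comment> \<open>There are fewer equations than coordinate vectors, so some nontrivial
    combination of the \<open>d i\<close> has zero expansion. Evaluating it at the coordinate
    functions contradicts their independence.\<close>
  obtain a where a: "\<exists>i\<in>{..<mdim M}. a i \<noteq> 0"
    "\<And>j. j < k \<Longrightarrow> (\<Sum>i<mdim M. a i * (g p (d i) (e j) / g p (e j) (e j))) = 0"
    using homogeneous_system_nontrivial[of "{..<mdim M}" k "\<lambda>i j. g p (d i) (e j) / g p (e j) (e j)"] k by auto
  have "(\<Sum>i<mdim M. a i * d i f) = 0" for f
  proof -
    have "(\<Sum>i<mdim M. a i * d i f) = (\<Sum>i<mdim M. a i * (\<Sum>j<k. g p (d i) (e j) / g p (e j) (e j) * e j f))"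
      by (rule sum.cong[OF refl]) (use fun_cong[OF expand[OF d], of _ f] in simp)
    also have "\<dots> = (\<Sum>j<k. (\<Sum>i<mdim M. a i * (g p (d i) (e j) / g p (e j) (e j))) * e j f)"
      by (simp add: sum_distrib_left sum_distrib_right mult.assoc) (rule sum.swap)
    finally show ?thesis using a(2) by simp
  qed
  then have "a l = 0" if l: "l < mdim M" for l
  proof -
    have "0 = (\<Sum>i<mdim M. a i * d i (\<lambda>q. \<phi> q l))" using \<open>\<And>f. (\<Sum>i<mdim M. a i * d i f) = 0\<close> by simp
    also have "\<dots> = (\<Sum>i<mdim M. if i = l then a l else 0)"
      by (rule sum.cong) (use coord_field_coord[OF c _ l] in \<open>auto simp: d_def\<close>)
    finally show ?thesis using l by simp
  qed
  then show False using a(1) by auto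
qed

end

text \<open>Gram-Schmidt, one field at a time. In an indefinite metric a remainder may be isotropic,
  so the next vector is chosen orthogonal and non-isotropic at \<open>p\<close> beforehand. Its
  extension is orthogonalised, which leaves the value at \<open>p\<close> unchanged, and normalised
  where the norm keeps its sign.\<close>

lemma orthonormal_frame_exists:
  assumes p: "p \<in> points M"
  shows "\<exists>W E. openin (mtop M) W \<and> p \<in> W \<and> orthonormal_frame M g W E"
proof -
  have "\<exists>W E. openin (mtop M) W \<and> p \<in> W \<and> (\<forall>j<k. vector_field M W (E j)) \<and>
      (\<forall>i<k. \<forall>j<k. i \<noteq> j \<longrightarrow> (\<forall>q\<in>W. g q (E i q) (E j q) = 0)) \<and>
      (\<forall>j<k. \<exists>\<epsilon>\<in>{1, -1}. \<forall>q\<in>W. g q (E j q) (E j q) = \<epsilon>)" if "k \<le> mdim M" for k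
    using that
  proof (induction k)
    case 0
    show ?case by (intro exI[of _ "points M"] exI) (use p in auto)
  next
    case (Suc k)
    then have "k \<le> mdim M" by simp
    from Suc.IH[OF this] obtain W E where W: "openin (mtop M) W" "p \<in> W"
      and E: "\<forall>j<k. vector_field M W (E j)"
      and orth: "\<forall>i<k. \<forall>j<k. i \<noteq> j \<longrightarrow> (\<forall>q\<in>W. g q (E i q) (E j q) = 0)"
      and nrm: "\<forall>j<k. \<exists>\<epsilon>\<in>{1, -1}. \<forall>q\<in>W. g q (E j q) (E j q) = \<epsilon>"
      by (elim exE conjE)
    note E = E[rule_format] and orth = orth[rule_format] and nrm = nrm[rule_format]
    have nz: "g q (E j q) (E j q) \<noteq> 0" if "j < k" "q \<in> W" for j q
      using nrm[OF that(1)] that(2) by fastforce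
    note ET = vector_field_tangent[OF E]
    obtain u where u: "u \<in> tangent_space M p" "\<And>j. j < k \<Longrightarrow> g p u (E j p) = 0" "g p u u \<noteq> 0"
      using orthogonal_complement_nonisotropic[OF p, of k "\<lambda>j. E j p"] Suc.prems ET orth nz W(2) by auto
    obtain U \<phi> where c: "(U, \<phi>) \<in> charts M" "p \<in> U" using chart_cover[OF p] by blast
    obtain X where X: "vector_field M U X" "X p = u" using vector_field_extension[OF u(1) c] .
    define W' where "W' = W \<inter> U"
    have W': "openin (mtop M) W'" "p \<in> W'" using W c chart_open by (auto simp: W'_def)
    note E' = vector_field_subset[OF E, of _ W'] and X' = vector_field_subset[OF X(1), of W']
    have cs: "smooth_on M W' (\<lambda>q. g q (X q) (E j q) / g q (E j q) (E j q))" if "j < k" for j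
      by (intro smooth_on_divide g_smooth W' E' X') (use that nz in \<open>auto simp: W'_def\<close>)
    define Y where "Y q f = X q f - (\<Sum>j<k. g q (X q) (E j q) / g q (E j q) (E j q) * E j q f)" for q f
    have S: "vector_field M W' (\<lambda>q f. \<Sum>j<k. g q (X q) (E j q) / g q (E j q) (E j q) * E j q f)"
      by (intro vector_field_sum vector_field_scale W' cs E') (auto simp: W'_def)
    have Y: "vector_field M W' Y"
      using vector_field_add[OF X' vector_field_scale[OF S smooth_on_const[of _ "-1"]]]
      unfolding Y_def by (auto simp: W'_def)
    have Yo: "g q (Y q) (E j q) = 0" if "q \<in> W'" "j < k" for q j
      using orthogonal_projection(2)[OF openin_points[OF W'(1) that(1)], of "{..<k}" "\<lambda>j. E j q" "X q" j]
        ET orth nz vector_field_tangent[OF X(1)] that unfolding Y_def W'_def by auto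
    have Yp: "Y p = u" by (rule ext) (simp add: Y_def X(2) u(2))
    define s where "s q = g q (Y q) (Y q)" for q
    have s: "smooth_on M W' s" unfolding s_def by (rule g_smooth[OF W'(1) Y Y])
    \<comment> \<open>The sign of the norm at \<open>p\<close>. On \<open>W''\<close> the function
      \<sigma> * s is positive, so its power -1/2 is smooth, and scaling by it turns the norm into
      \<sigma>.\<close>
    define \<sigma> where "\<sigma> = sgn (s p)"
    have sp: "s p \<noteq> 0" using u(3) Yp by (simp add: s_def)
    then have \<sigma>: "\<sigma> \<in> {1, -1}" "\<sigma> * \<sigma> = 1" "\<sigma> * s p > 0" by (auto simp: \<sigma>_def sgn_if)
    define W'' where "W'' = {q \<in> W'. \<sigma> * s q \<in> {0<..}}"
    have W'': "openin (mtop M) W''" "p \<in> W''" "W'' \<subseteq> W'"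
      using openin_smooth_preimage[OF W'(1) smooth_on_cmult[OF W'(1) s], of "{0<..}" \<sigma>] W'(2) \<sigma>(3)
      by (auto simp: W''_def)
    have pos: "\<sigma> * s q > 0" if "q \<in> W''" for q using that by (simp add: W''_def)
    define N where "N q f = (\<sigma> * s q) powr (- (1 / 2)) * Y q f" for q f
    have N: "vector_field M W'' N" unfolding N_def
      by (intro vector_field_scale vector_field_subset[OF Y] smooth_on_powr smooth_on_cmult
          smooth_on_subset[OF s] W'' pos)
    define E'' where "E'' = E(k := N)"
    note YT = vector_field_tangent[OF Y subsetD[OF W''(3)]]
    have NN: "g q (N q) (N q) = \<sigma>" if q: "q \<in> W''" for q
    proof -
      note qM = openin_points[OF W''(1) q]
      define t where "t = (\<sigma> * s q) powr (- (1 / 2))"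
      have tt: "t * t * (\<sigma> * s q) = 1"
      proof -
        have "t * t = (\<sigma> * s q) powr (- (1 / 2) + - (1 / 2))" unfolding t_def by (rule powr_add[symmetric])
        also have "\<dots> = inverse (\<sigma> * s q)" using powr_minus[of "\<sigma> * s q" 1] pos[OF q] by simp
        finally show ?thesis using pos[OF q] left_inverse[of "\<sigma> * s q"] by (metis less_irrefl)
      qed
      have "N q = (\<lambda>f. t * Y q f)" by (rule ext) (simp add: N_def t_def)
      then have "g q (N q) (N q) = t * (t * s q)"
        using g_cmult_left[OF qM YT[OF q] tangent_space_cmult[OF YT[OF q], of t], of t]
          g_cmult_right[OF qM YT[OF q] YT[OF q], of t] by (simp add: s_def)
      also have "\<dots> = (\<sigma> * \<sigma>) * (t * (t * s q))" using \<sigma>(2) by simp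
      also have "\<dots> = \<sigma> * (t * t * (\<sigma> * s q))" by (simp only: mult_ac)
      finally show ?thesis using tt by simp
    qed
    have WW: "W'' \<subseteq> W" using W''(3) by (auto simp: W'_def)
    have NE: "g q (N q) (E j q) = 0" if "q \<in> W''" "j < k" for q j
      using g_cmult_left[OF openin_points[OF W''(1) that(1)] YT[OF that(1)]
          ET[OF that(2) subsetD[OF WW that(1)]]] Yo[OF subsetD[OF W''(3) that(1)] that(2)]
      unfolding N_def by simp
    have EN: "g q (E j q) (N q) = 0" if "q \<in> W''" "j < k" for q j
      using NE[OF that] g_sym[OF openin_points[OF W''(1) that(1)] vector_field_tangent[OF N that(1)]
        ET[OF that(2) subsetD[OF WW that(1)]]] by simp
    show ?case
    proof (intro exI conjI allI impI ballI)
      show "openin (mtop M) W''" "p \<in> W''" by fact+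
      show "vector_field M W'' (E'' j)" if "j < Suc k" for j
        using N vector_field_subset[OF E WW] that by (auto simp: E''_def less_Suc_eq)
      show "g q (E'' i q) (E'' j q) = 0" if "i < Suc k" "j < Suc k" "i \<noteq> j" "q \<in> W''" for i j q
        using that NE EN orth WW by (auto simp: E''_def less_Suc_eq)
      show "\<exists>\<epsilon>\<in>{1, -1}. \<forall>q\<in>W''. g q (E'' j q) (E'' j q) = \<epsilon>" if "j < Suc k" for j
      proof (cases "j = k")
        case True
        then show ?thesis using NN \<sigma>(1) by (auto simp: E''_def)
      next
        case False
        then show ?thesis using nrm[of j] that WW by (auto simp: E''_def)
      qed
    qed
  qed
  from this[of "mdim M"] show ?thesis unfolding orthonormal_frame_def by simp
qed

text \<open>Orthogonal frames are indexed by an arbitrary finite set and need not be normalised, which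
  suits the frames of a product.\<close>

definition orthogonal_frame :: "'a set \<Rightarrow> 'i set \<Rightarrow> ('i \<Rightarrow> 'a vfield) \<Rightarrow> bool" where
  "orthogonal_frame W K E \<longleftrightarrow> openin (mtop M) W \<and> finite K \<and> (\<forall>k\<in>K. vector_field M W (E k)) \<and>
     (\<forall>j\<in>K. \<forall>k\<in>K. j \<noteq> k \<longrightarrow> (\<forall>q\<in>W. g q (E j q) (E k q) = 0)) \<and>
     (\<forall>k\<in>K. \<forall>q\<in>W. g q (E k q) (E k q) \<noteq> 0) \<and>
     (\<forall>q\<in>W. \<forall>v\<in>tangent_space M q. v = (\<lambda>f. \<Sum>k\<in>K. g q v (E k q) / g q (E k q) (E k q) * E k q f))"

lemma orthogonal_frameD:
  assumes "orthogonal_frame W K E"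
  shows "openin (mtop M) W" "finite K" "\<And>k. k \<in> K \<Longrightarrow> vector_field M W (E k)"
    "\<And>j k q. j \<in> K \<Longrightarrow> k \<in> K \<Longrightarrow> j \<noteq> k \<Longrightarrow> q \<in> W \<Longrightarrow> g q (E j q) (E k q) = 0"
    "\<And>k q. k \<in> K \<Longrightarrow> q \<in> W \<Longrightarrow> g q (E k q) (E k q) \<noteq> 0"
    "\<And>q v. q \<in> W \<Longrightarrow> v \<in> tangent_space M q \<Longrightarrow>
      v = (\<lambda>f. \<Sum>k\<in>K. g q v (E k q) / g q (E k q) (E k q) * E k q f)"
  using assms unfolding orthogonal_frame_def by simp_all

lemma orthonormal_frame_norm:
  "orthonormal_frame M g W E \<Longrightarrow> k < mdim M \<Longrightarrow> q \<in> W \<Longrightarrow> g q (E k q) (E k q) \<in> {1, -1}"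
  unfolding orthonormal_frame_def by fastforce

lemma orthonormal_frame_imp_orthogonal_frame:
  assumes W: "openin (mtop M) W" and E: "orthonormal_frame M g W E"
  shows "orthogonal_frame W {..<mdim M} E"
proof -
  have v: "\<And>k. k < mdim M \<Longrightarrow> vector_field M W (E k)"
    and o: "\<And>j k q. j < mdim M \<Longrightarrow> k < mdim M \<Longrightarrow> j \<noteq> k \<Longrightarrow> q \<in> W \<Longrightarrow> g q (E j q) (E k q) = 0"
    using E unfolding orthonormal_frame_def by auto
  have n: "g q (E k q) (E k q) \<noteq> 0" if "k < mdim M" "q \<in> W" for k q
    using orthonormal_frame_norm[OF E that] by auto
  have "w = (\<lambda>f. \<Sum>k<mdim M. g q w (E k q) / g q (E k q) (E k q) * E k q f)"
    if "q \<in> W" "w \<in> tangent_space M q" for q w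
    by (rule orthogonal_expansion[OF openin_points[OF W that(1)]])
      (use that o n vector_field_tangent[OF v] in auto)
  then show ?thesis unfolding orthogonal_frame_def using W v o n by auto
qed

lemma frame_at:
  assumes "p \<in> points M"
  obtains W where "openin (mtop M) W" "p \<in> W" "orthonormal_frame M g W (frame_at M g p)"
proof -
  have "\<exists>E W. openin (mtop M) W \<and> p \<in> W \<and> orthonormal_frame M g W E"
    using orthonormal_frame_exists[OF assms] by blast
  from someI_ex[OF this] show thesis using that unfolding frame_at_def by blast
qed

lemma orthonormal_frame_subset:
  "orthonormal_frame M g W E \<Longrightarrow> W' \<subseteq> W \<Longrightarrow> orthonormal_frame M g W' E"
  unfolding orthonormal_frame_def using vector_field_subset by (meson subsetD)

text \<open>Bilinearity over smooth functions, read off at \<open>p\<close>. It is imposed on forms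
  in fields over \<open>W\<close>, since curvature and covariant derivative take fields as
  arguments.\<close>

definition tensorial_at :: "'a set \<Rightarrow> 'a \<Rightarrow> ('a vfield \<Rightarrow> 'a vfield \<Rightarrow> real) \<Rightarrow> bool" where
  "tensorial_at W p B \<longleftrightarrow> (\<forall>X Y Z. vector_field M W X \<longrightarrow> vector_field M W Y \<longrightarrow> vector_field M W Z \<longrightarrow>
      B (\<lambda>q f. X q f + Z q f) Y = B X Y + B Z Y \<and> B X (\<lambda>q f. Y q f + Z q f) = B X Y + B X Z) \<and>
    (\<forall>X Y a. vector_field M W X \<longrightarrow> vector_field M W Y \<longrightarrow> smooth_on M W a \<longrightarrow>
      B (\<lambda>q f. a q * X q f) Y = a p * B X Y \<and> B X (\<lambda>q f. a q * Y q f) = a p * B X Y)"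

text \<open>Multiplication by the indicator of \<open>W\<close>, which is smooth on \<open>W\<close>
  with value 1 at \<open>p\<close>, turns fields that agree on \<open>W\<close> into equal
  functions.\<close>

lemma tensorial_at_cong:
  assumes B: "tensorial_at W p B" and W: "openin (mtop M) W" "p \<in> W"
    and X: "vector_field M W X" and Y: "vector_field M W Y"
    and X': "\<And>q. q \<in> W \<Longrightarrow> X' q = X q" and Y': "\<And>q. q \<in> W \<Longrightarrow> Y' q = Y q"
  shows "B X' Y' = B X Y"
proof -
  have vX': "vector_field M W X'" and vY': "vector_field M W Y'"
    using vector_field_cong[OF X] vector_field_cong[OF Y] X' Y' by auto
  define \<iota> :: "'a \<Rightarrow> real" where "\<iota> q = (if q \<in> W then 1 else 0)" for q
  have \<iota>: "smooth_on M W \<iota>"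
    by (rule smooth_on_cong[OF W(1) _ smooth_on_const[of _ 1]]) (simp add: \<iota>_def)
  have "(\<lambda>q f. \<iota> q * X' q f) = (\<lambda>q f. \<iota> q * X q f)" "(\<lambda>q f. \<iota> q * Y' q f) = (\<lambda>q f. \<iota> q * Y q f)"
    using X' Y' by (auto simp: \<iota>_def fun_eq_iff)
  moreover have "\<iota> p = 1" using W by (simp add: \<iota>_def)
  ultimately show ?thesis
  proof -
    have "B X' Y' = B (\<lambda>q f. \<iota> q * X' q f) (\<lambda>q f. \<iota> q * Y' q f)"
      if "vector_field M W X'" "vector_field M W Y'" for X' Y'
      using B[unfolded tensorial_at_def, THEN conjunct2, rule_format, OF that \<iota>]
        B[unfolded tensorial_at_def, THEN conjunct2, rule_format, OF vector_field_scale[OF that(1) \<iota>] that(2) \<iota>]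
        \<open>\<iota> p = 1\<close> by simp
    from this[OF X Y] this[OF vX' vY'] show ?thesis
      using \<open>(\<lambda>q f. \<iota> q * X' q f) = (\<lambda>q f. \<iota> q * X q f)\<close>
        \<open>(\<lambda>q f. \<iota> q * Y' q f) = (\<lambda>q f. \<iota> q * Y q f)\<close> by simp
  qed
qed

lemma tensorial_at_sum:
  assumes B: "tensorial_at W p B" and W: "openin (mtop M) W"
    and Y: "vector_field M W Y" and X: "\<And>j. j \<in> A \<Longrightarrow> vector_field M W (X j)"
    and a: "\<And>j. j \<in> A \<Longrightarrow> smooth_on M W (a j)"
  shows "B (\<lambda>q f. \<Sum>j\<in>A. a j q * X j q f) Y = (\<Sum>j\<in>A. a j p * B (X j) Y)"
    and "B Y (\<lambda>q f. \<Sum>j\<in>A. a j q * X j q f) = (\<Sum>j\<in>A. a j p * B Y (X j))"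
proof -
  have z: "B (\<lambda>q f. 0) Y = 0 \<and> B Y (\<lambda>q f. 0) = 0"
  proof -
    have "B (\<lambda>q f. 0 * Y q f) Y = 0 * B Y Y \<and> B Y (\<lambda>q f. 0 * Y q f) = 0 * B Y Y"
      using B Y smooth_on_const[of W 0] unfolding tensorial_at_def by blast
    then show ?thesis by simp
  qed
  have "B (\<lambda>q f. \<Sum>j\<in>A. a j q * X j q f) Y = (\<Sum>j\<in>A. a j p * B (X j) Y) \<and>
      B Y (\<lambda>q f. \<Sum>j\<in>A. a j q * X j q f) = (\<Sum>j\<in>A. a j p * B Y (X j))"
    using X a
  proof (induction A rule: infinite_finite_induct)
    case (insert i A)
    have v1: "vector_field M W (\<lambda>q f. a i q * X i q f)" using insert by (intro vector_field_scale) auto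
    have v2: "vector_field M W (\<lambda>q f. \<Sum>j\<in>A. a j q * X j q f)"
      using insert by (intro vector_field_sum[OF W] vector_field_scale) auto
    have "B (\<lambda>q f. a i q * X i q f + (\<Sum>j\<in>A. a j q * X j q f)) Y
        = B (\<lambda>q f. a i q * X i q f) Y + B (\<lambda>q f. \<Sum>j\<in>A. a j q * X j q f) Y"
      "B Y (\<lambda>q f. a i q * X i q f + (\<Sum>j\<in>A. a j q * X j q f))
        = B Y (\<lambda>q f. a i q * X i q f) + B Y (\<lambda>q f. \<Sum>j\<in>A. a j q * X j q f)"
      using B Y v1 v2 unfolding tensorial_at_def by blast+
    moreover have "B (\<lambda>q f. a i q * X i q f) Y = a i p * B (X i) Y"
      "B Y (\<lambda>q f. a i q * X i q f) = a i p * B Y (X i)"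
      using B Y insert.prems unfolding tensorial_at_def by blast+
    ultimately show ?case using insert by simp
  qed (simp_all add: z)
  then show "B (\<lambda>q f. \<Sum>j\<in>A. a j q * X j q f) Y = (\<Sum>j\<in>A. a j p * B (X j) Y)"
    "B Y (\<lambda>q f. \<Sum>j\<in>A. a j q * X j q f) = (\<Sum>j\<in>A. a j p * B Y (X j))" by auto
qed

text \<open>Expand the fields of one frame in the other, with coefficients c_kj. Expanding
  g(L_i,L_j) in the frame E shows that the sum over k of c_ki c_kj / g(E_k,E_k) is 1 / g(L_i,L_i)
  for i = j and 0 otherwise, so only diagonal terms survive.\<close>

lemma trace_independent_of_frame:
  assumes B: "tensorial_at W p B" and p: "p \<in> W"
    and E: "orthogonal_frame W K E" and L: "orthogonal_frame W J L"
  shows "(\<Sum>k\<in>K. B (E k) (E k) / g p (E k p) (E k p)) = (\<Sum>j\<in>J. B (L j) (L j) / g p (L j p) (L j p))"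
proof -
  note W = orthogonal_frameD(1)[OF E] and Ev = orthogonal_frameD(3)[OF E]
    and Ex = orthogonal_frameD(6)[OF E]
  note J = orthogonal_frameD(2)[OF L] and Lv = orthogonal_frameD(3)[OF L]
    and Lo = orthogonal_frameD(4)[OF L] and Ln = orthogonal_frameD(5)[OF L]
    and Lx = orthogonal_frameD(6)[OF L]
  note pM = openin_points[OF W p]
  note ET = vector_field_tangent[OF Ev p] and LT = vector_field_tangent[OF Lv p]
  define c where "c k j q = g q (E k q) (L j q) / g q (L j q) (L j q)" for k j q
  have c: "smooth_on M W (c k j)" if "k \<in> K" "j \<in> J" for k j
    unfolding c_def by (intro smooth_on_divide g_smooth W Ev Lv Ln that)
  have BE: "B (E k) (E k) = (\<Sum>i\<in>J. \<Sum>j\<in>J. c k i p * c k j p * B (L i) (L j))" if k: "k \<in> K" for k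
  proof -
    define F where "F q f = (\<Sum>j\<in>J. c k j q * L j q f)" for q f
    have F: "vector_field M W F" unfolding F_def
      by (intro vector_field_sum[OF W] vector_field_scale Lv c k)
    have "B (E k) (E k) = B F F"
      by (rule tensorial_at_cong[OF B W p F F])
        (use Lx[OF _ vector_field_tangent[OF Ev[OF k]]] in \<open>simp_all add: F_def c_def fun_eq_iff\<close>)
    also have "\<dots> = (\<Sum>i\<in>J. c k i p * B (L i) F)"
      unfolding F_def by (rule tensorial_at_sum(1)[OF B W F[unfolded F_def] Lv c[OF k]])
    also have "\<dots> = (\<Sum>i\<in>J. c k i p * (\<Sum>j\<in>J. c k j p * B (L i) (L j)))"
      unfolding F_def by (intro sum.cong refl arg_cong2[where f = times]
          tensorial_at_sum(2)[OF B W Lv Lv c[OF k]])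
    finally show ?thesis by (simp add: sum_distrib_left mult.assoc)
  qed
  have cc: "(\<Sum>k\<in>K. c k i p * c k j p / g p (E k p) (E k p)) = (if i = j then 1 / g p (L i p) (L i p) else 0)"
    if ij: "i \<in> J" "j \<in> J" for i j
  proof -
    have "g p (L i p) (L j p) = g p (\<lambda>f. \<Sum>k\<in>K. g p (L i p) (E k p) / g p (E k p) (E k p) * E k p f) (L j p)"
      using Ex[OF p LT[OF ij(1)]] by simp
    also have "\<dots> = (\<Sum>k\<in>K. g p (L i p) (E k p) / g p (E k p) (E k p) * g p (E k p) (L j p))"
      by (rule g_lincomb_left[OF pM LT[OF ij(2)] ET])
    finally have 1: "(\<Sum>k\<in>K. g p (E k p) (L i p) * g p (E k p) (L j p) / g p (E k p) (E k p)) = g p (L i p) (L j p)"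
      using g_sym[OF pM LT[OF ij(1)] ET] by (simp add: mult_ac)
    have "(\<Sum>k\<in>K. c k i p * c k j p / g p (E k p) (E k p))
        = (\<Sum>k\<in>K. g p (E k p) (L i p) * g p (E k p) (L j p) / g p (E k p) (E k p)) /
          (g p (L i p) (L i p) * g p (L j p) (L j p))"
      by (simp add: c_def sum_divide_distrib mult_ac)
    then show ?thesis unfolding 1 using Lo ij p Ln by auto
  qed
  have "(\<Sum>k\<in>K. B (E k) (E k) / g p (E k p) (E k p))
      = (\<Sum>k\<in>K. \<Sum>i\<in>J. \<Sum>j\<in>J. c k i p * c k j p / g p (E k p) (E k p) * B (L i) (L j))"
    by (intro sum.cong refl) (simp add: BE sum_divide_distrib)
  also have "\<dots> = (\<Sum>i\<in>J. \<Sum>j\<in>J. (\<Sum>k\<in>K. c k i p * c k j p / g p (E k p) (E k p)) * B (L i) (L j))"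
    by (subst sum.swap, intro sum.cong refl, subst sum.swap) (simp add: sum_distrib_right)
  also have "\<dots> = (\<Sum>i\<in>J. \<Sum>j\<in>J. if i = j then B (L i) (L i) / g p (L i p) (L i p) else 0)"
    by (intro sum.cong refl) (simp add: cc)
  also have "\<dots> = (\<Sum>i\<in>J. B (L i) (L i) / g p (L i p) (L i p))" using J by (simp add: sum.delta)
  finally show ?thesis .
qed

end


section \<open>Curvature of the Levi-Civita connection\<close>

context smooth_atlas begin

lemma lie_bracket_swap: "lie_bracket M X Y p f = - lie_bracket M Y X p f"
  by (simp add: lie_bracket_def)

lemma tangent_locally_const:
  assumes "v \<in> tangent_space M p" "openin (mtop M) W" "p \<in> W" "\<And>q. q \<in> W \<Longrightarrow> a q = c"
  shows "v a = 0"
  using tangent_cong[OF assms(1-3), of a "\<lambda>q. c"] tangent_const[OF assms(1)] openin_points[OF assms(2,3)] assms(4)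
  by simp

context
  fixes W p
  assumes W: "openin (mtop M) W" and p: "p \<in> W"
begin

lemma lie_bracket_add_left:
  assumes X: "vector_field M W X" and Z: "vector_field M W Z" and Y: "vector_field M W Y"
  shows "lie_bracket M (\<lambda>q f. X q f + Z q f) Y p f = lie_bracket M X Y p f + lie_bracket M Z Y p f"
  using tangent_add[OF vector_field_tangent[OF Y p] vector_field_smooth_at[OF X W p]
      vector_field_smooth_at[OF Z W p]]
  by (simp add: lie_bracket_def)

lemma lie_bracket_scale_left:
  assumes X: "vector_field M W X" and Y: "vector_field M W Y" and a: "smooth_on M W a"
  shows "lie_bracket M (\<lambda>q f. a q * X q f) Y p f = a p * lie_bracket M X Y p f + (- Y p a) * X p f"
proof (cases "smooth_at M p f")
  case True
  then show ?thesis
    using tangent_mult[OF vector_field_tangent[OF Y p] smooth_atI[OF W p a] vector_field_smooth_at[OF X W p True]]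
    by (simp add: lie_bracket_def algebra_simps)
next
  case False
  then show ?thesis using tangent_not_smooth[OF vector_field_tangent[OF X p]] by (simp add: lie_bracket_def)
qed

end

end

locale levi_civita_manifold = metric_manifold M g for M :: "'a manifold" and g +
  fixes D :: "'a connection"
  assumes levi_civita: "levi_civita M g D"
begin

context
  fixes W
  assumes W: "openin (mtop M) W"
begin

lemmas affine = levi_civita[unfolded levi_civita_def affine_connection_def, THEN conjunct1, rule_format, OF W]
lemmas lc = levi_civita[unfolded levi_civita_def, THEN conjunct2, rule_format, OF W]

context
  fixes X Y
  assumes X: "vector_field M W X" and Y: "vector_field M W Y"
begin

lemma D_vector_field: "vector_field M W (D X Y)"
  using affine[OF X Y] by simp

lemma D_add_left: "vector_field M W Z \<Longrightarrow> p \<in> W \<Longrightarrow> D (\<lambda>q f. X q f + Z q f) Y p h = D X Y p h + D Z Y p h"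
  using affine[OF X Y] by simp

lemma D_add_right: "vector_field M W Z \<Longrightarrow> p \<in> W \<Longrightarrow> D X (\<lambda>q f. Y q f + Z q f) p h = D X Y p h + D X Z p h"
  using affine[OF X Y] by simp

lemma D_scale_left: "smooth_on M W a \<Longrightarrow> p \<in> W \<Longrightarrow> D (\<lambda>q f. a q * X q f) Y p h = a p * D X Y p h"
  using affine[OF X Y] by simp

lemma D_scale_right: "smooth_on M W a \<Longrightarrow> p \<in> W \<Longrightarrow>
    D X (\<lambda>q f. a q * Y q f) p h = a p * D X Y p h + X p a * Y p h"
  using affine[OF X Y] by simp

lemma D_torsion_free: "p \<in> W \<Longrightarrow> D X Y p f - D Y X p f = lie_bracket M X Y p f"
  using lc[OF X Y] by simp

lemma D_metric: "vector_field M W Z \<Longrightarrow> p \<in> W \<Longrightarrow>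
    X p (\<lambda>q. g q (Y q) (Z q)) = g p (D X Y p) (Z p) + g p (Y p) (D X Z p)"
  using lc[OF X Y] by simp

end

text \<open>The indicator of \<open>W\<close> once more; it is locally constant, so the derivative
  term of the product rule vanishes at \<open>p\<close>.\<close>

lemma D_cong:
  assumes X: "vector_field M W X" and Y: "vector_field M W Y" and p: "p \<in> W"
    and X': "\<And>q. q \<in> W \<Longrightarrow> X' q = X q" and Y': "\<And>q. q \<in> W \<Longrightarrow> Y' q = Y q"
  shows "D X' Y' p = D X Y p"
proof -
  have vX': "vector_field M W X'" and vY': "vector_field M W Y'"
    using vector_field_cong[OF X] vector_field_cong[OF Y] X' Y' by auto
  define \<iota> :: "'a \<Rightarrow> real" where "\<iota> q = (if q \<in> W then 1 else 0)" for q
  have \<iota>: "smooth_on M W \<iota>"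
    by (rule smooth_on_cong[OF W _ smooth_on_const[of _ 1]]) (simp add: \<iota>_def)
  have eq: "(\<lambda>q f. \<iota> q * X' q f) = (\<lambda>q f. \<iota> q * X q f)" "(\<lambda>q f. \<iota> q * Y' q f) = (\<lambda>q f. \<iota> q * Y q f)"
    using X' Y' by (auto simp: \<iota>_def fun_eq_iff)
  have "D X Y p h = D (\<lambda>q f. \<iota> q * X q f) (\<lambda>q f. \<iota> q * Y q f) p h"
    if X: "vector_field M W X" and Y: "vector_field M W Y" for X Y h
  proof -
    have "X p \<iota> = 0"
      by (rule tangent_locally_const[OF vector_field_tangent[OF X p] W p, of _ 1]) (simp add: \<iota>_def)
    then show ?thesis
      using D_scale_left[OF X vector_field_scale[OF Y \<iota>] \<iota> p] D_scale_right[OF X Y \<iota> p] p by (simp add: \<iota>_def)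
  qed
  from this[OF X Y] this[OF vX' vY'] show ?thesis unfolding eq by (simp add: fun_eq_iff)
qed

lemma curvature_tangent:
  assumes X: "vector_field M W X" and Y: "vector_field M W Y" and Z: "vector_field M W Z" and p: "p \<in> W"
  shows "curvature M D X Y Z p \<in> tangent_space M p"
proof -
  have "vector_field M W (\<lambda>q f. D X (D Y Z) q f + (- 1) * D Y (D X Z) q f + (- 1) * D (lie_bracket M X Y) Z q f)"
    by (intro vector_field_add vector_field_scale smooth_on_const D_vector_field
        lie_bracket_vector_field[OF W] X Y Z)
  from vector_field_tangent[OF this p] show ?thesis
    by (simp add: curvature_def[abs_def])
qed

lemma curvature_swap:
  assumes X: "vector_field M W X" and Y: "vector_field M W Y" and Z: "vector_field M W Z" and p: "p \<in> W"
  shows "curvature M D X Y Z p f = - curvature M D Y X Z p f"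
proof -
  have "lie_bracket M X Y = (\<lambda>q f. (-1) * lie_bracket M Y X q f)"
    using lie_bracket_swap[of X Y] by (auto simp: fun_eq_iff)
  then have "D (lie_bracket M X Y) Z p f = - D (lie_bracket M Y X) Z p f"
    using D_scale_left[OF lie_bracket_vector_field[OF W Y X] Z smooth_on_const p, of "-1" f] by simp
  then show ?thesis by (simp add: curvature_def)
qed

section \<open>Tensoriality of the curvature and of the covariant derivative\<close>

lemma curvature_add1:
  assumes X: "vector_field M W X" and X': "vector_field M W X'" and Y: "vector_field M W Y"
    and Z: "vector_field M W Z" and p: "p \<in> W"
  shows "curvature M D (\<lambda>q f. X q f + X' q f) Y Z p h = curvature M D X Y Z p h + curvature M D X' Y Z p h"
proof -
  note XX = vector_field_add[OF X X'] and DXZ = D_vector_field[OF X Z] and DX'Z = D_vector_field[OF X' Z]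
  note BX = lie_bracket_vector_field[OF W X Y] and BX' = lie_bracket_vector_field[OF W X' Y]
  have "D Y (D (\<lambda>q f. X q f + X' q f) Z) p = D Y (\<lambda>q f. D X Z q f + D X' Z q f) p"
    by (rule D_cong[OF Y vector_field_add[OF DXZ DX'Z] p refl]) (simp add: D_add_left[OF X Z X'] fun_eq_iff)
  moreover have "D (lie_bracket M (\<lambda>q f. X q f + X' q f) Y) Z p
      = D (\<lambda>q f. lie_bracket M X Y q f + lie_bracket M X' Y q f) Z p"
    by (rule D_cong[OF vector_field_add[OF BX BX'] Z p _ refl])
      (simp add: lie_bracket_add_left[OF W _ X X' Y] fun_eq_iff)
  ultimately show ?thesis
    using D_add_left[OF X D_vector_field[OF Y Z] X' p] D_add_right[OF Y DXZ DX'Z p]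
      D_add_left[OF BX Z BX' p]
    by (simp add: curvature_def)
qed

text \<open>The derivative of \<open>a\<close> enters through D_Y (a D_X Z) and through [aX,Y] = a
  [X,Y] - (Y a) X; the two contributions cancel.\<close>

lemma curvature_scale1:
  assumes X: "vector_field M W X" and Y: "vector_field M W Y" and Z: "vector_field M W Z"
    and a: "smooth_on M W a" and p: "p \<in> W"
  shows "curvature M D (\<lambda>q f. a q * X q f) Y Z p h = a p * curvature M D X Y Z p h"
proof -
  note aX = vector_field_scale[OF X a] and DXZ = D_vector_field[OF X Z]
  note BX = lie_bracket_vector_field[OF W X Y]
  have Ya: "smooth_on M W (\<lambda>q. - Y q a)"
    by (intro smooth_on_uminus W vector_field_smooth[OF Y W _ a]) simp
  have "D Y (D (\<lambda>q f. a q * X q f) Z) p = D Y (\<lambda>q f. a q * D X Z q f) p"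
    by (rule D_cong[OF Y vector_field_scale[OF DXZ a] p refl]) (simp add: D_scale_left[OF X Z a] fun_eq_iff)
  moreover have "D (lie_bracket M (\<lambda>q f. a q * X q f) Y) Z p
      = D (\<lambda>q f. a q * lie_bracket M X Y q f + (- Y q a) * X q f) Z p"
    by (rule D_cong[OF vector_field_add[OF vector_field_scale[OF BX a] vector_field_scale[OF X Ya]] Z p _ refl])
      (simp add: lie_bracket_scale_left[OF W _ X Y a] fun_eq_iff)
  ultimately show ?thesis
    using D_scale_left[OF X D_vector_field[OF Y Z] a p] D_scale_right[OF Y DXZ a p]
      D_add_left[OF vector_field_scale[OF BX a] Z vector_field_scale[OF X Ya] p]
      D_scale_left[OF BX Z a p] D_scale_left[OF X Z Ya p]
    by (simp add: curvature_def algebra_simps)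
qed

lemma curvature_add3:
  assumes X: "vector_field M W X" and Y: "vector_field M W Y"
    and Z: "vector_field M W Z" and Z': "vector_field M W Z'" and p: "p \<in> W"
  shows "curvature M D X Y (\<lambda>q f. Z q f + Z' q f) p h = curvature M D X Y Z p h + curvature M D X Y Z' p h"
proof -
  have *: "D X (D Y (\<lambda>q f. Z q f + Z' q f)) p h = D X (D Y Z) p h + D X (D Y Z') p h"
    if X: "vector_field M W X" and Y: "vector_field M W Y" for X Y
  proof -
    note v = D_vector_field[OF Y Z] and v' = D_vector_field[OF Y Z']
    have "D X (D Y (\<lambda>q f. Z q f + Z' q f)) p = D X (\<lambda>q f. D Y Z q f + D Y Z' q f) p"
      by (rule D_cong[OF X vector_field_add[OF v v'] p refl]) (simp add: D_add_right[OF Y Z Z'] fun_eq_iff)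
    then show ?thesis using D_add_right[OF X v v' p] by simp
  qed
  show ?thesis
    using *[OF X Y] *[OF Y X] D_add_right[OF lie_bracket_vector_field[OF W X Y] Z Z' p]
    by (simp add: curvature_def)
qed

text \<open>The terms with one derivative of \<open>a\<close> and one of \<open>Z\<close> are
  symmetric in \<open>X\<close> and \<open>Y\<close>. The second derivatives of \<open>a\<close>
  combine to [X,Y] a, which the bracket term removes.\<close>

lemma curvature_scale3:
  assumes X: "vector_field M W X" and Y: "vector_field M W Y" and Z: "vector_field M W Z"
    and a: "smooth_on M W a" and p: "p \<in> W"
  shows "curvature M D X Y (\<lambda>q f. a q * Z q f) p h = a p * curvature M D X Y Z p h"
proof -
  have *: "D X (D Y (\<lambda>q f. a q * Z q f)) p h = a p * D X (D Y Z) p h + X p a * D Y Z p h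
      + (Y p a * D X Z p h + X p (\<lambda>q. Y q a) * Z p h)"
    if X: "vector_field M W X" and Y: "vector_field M W Y" for X Y
  proof -
    have Ya: "smooth_on M W (\<lambda>q. Y q a)" by (rule vector_field_smooth[OF Y W _ a]) simp
    note v = D_vector_field[OF Y Z]
    note v1 = vector_field_scale[OF v a] and v2 = vector_field_scale[OF Z Ya]
    have "D X (D Y (\<lambda>q f. a q * Z q f)) p = D X (\<lambda>q f. a q * D Y Z q f + Y q a * Z q f) p"
      by (rule D_cong[OF X vector_field_add[OF v1 v2] p refl]) (simp add: D_scale_right[OF Y Z a] fun_eq_iff)
    then show ?thesis
      using D_add_right[OF X v1 v2 p] D_scale_right[OF X v a p] D_scale_right[OF X Z Ya p] by simp
  qed
  have lb: "lie_bracket M X Y p a = X p (\<lambda>q. Y q a) - Y p (\<lambda>q. X q a)"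
    using smooth_atI[OF W p a] by (simp add: lie_bracket_def)
  show ?thesis
    unfolding curvature_def *[OF X Y] *[OF Y X] D_scale_right[OF lie_bracket_vector_field[OF W X Y] Z a p] lb
    by (simp add: algebra_simps)
qed

lemma curvature_add2:
  assumes X: "vector_field M W X" and X': "vector_field M W X'" and Y: "vector_field M W Y"
    and Z: "vector_field M W Z" and p: "p \<in> W"
  shows "curvature M D Y (\<lambda>q f. X q f + X' q f) Z p h = curvature M D Y X Z p h + curvature M D Y X' Z p h"
  using curvature_add1[OF assms] curvature_swap[OF Y vector_field_add[OF X X'] Z p]
    curvature_swap[OF Y X Z p] curvature_swap[OF Y X' Z p] by simp

lemma curvature_scale2:
  assumes X: "vector_field M W X" and Y: "vector_field M W Y" and Z: "vector_field M W Z"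
    and a: "smooth_on M W a" and p: "p \<in> W"
  shows "curvature M D Y (\<lambda>q f. a q * X q f) Z p h = a p * curvature M D Y X Z p h"
  using curvature_scale1[OF assms] curvature_swap[OF Y vector_field_scale[OF X a] Z p]
    curvature_swap[OF Y X Z p] by simp

text \<open>The inner trace of the scalar curvature: the second and fourth slots vary while the
  first and third are fixed.\<close>

lemma tensorial_curvature2:
  assumes Z1: "vector_field M W Z1" and Z2: "vector_field M W Z2" and p: "p \<in> W"
  shows "tensorial_at W p (\<lambda>X Y. g p (curvature M D Z1 X Z2 p) (Y p))"
  unfolding tensorial_at_def
proof (intro conjI allI impI)
  note pM = openin_points[OF W p]
  fix X Y assume X: "vector_field M W X" and Y: "vector_field M W Y"
  note R = curvature_tangent[OF Z1 _ Z2 p] and T = vector_field_tangent[OF _ p]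
  fix Z assume Z: "vector_field M W Z"
  have "curvature M D Z1 (\<lambda>q f. X q f + Z q f) Z2 p = (\<lambda>f. curvature M D Z1 X Z2 p f + curvature M D Z1 Z Z2 p f)"
    by (rule ext) (rule curvature_add2[OF X Z Z1 Z2 p])
  then show "g p (curvature M D Z1 (\<lambda>q f. X q f + Z q f) Z2 p) (Y p) =
      g p (curvature M D Z1 X Z2 p) (Y p) + g p (curvature M D Z1 Z Z2 p) (Y p)"
    using g_add_left[OF pM R[OF X] R[OF Z] T[OF Y]] by simp
  show "g p (curvature M D Z1 X Z2 p) (\<lambda>f. Y p f + Z p f) =
      g p (curvature M D Z1 X Z2 p) (Y p) + g p (curvature M D Z1 X Z2 p) (Z p)"
    using g_add_right[OF pM T[OF Y] T[OF Z] R[OF X]] by simp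
next
  note pM = openin_points[OF W p]
  fix X Y a assume X: "vector_field M W X" and Y: "vector_field M W Y" and a: "smooth_on M W a"
  note R = curvature_tangent[OF Z1 _ Z2 p] and T = vector_field_tangent[OF _ p]
  have "curvature M D Z1 (\<lambda>q f. a q * X q f) Z2 p = (\<lambda>f. a p * curvature M D Z1 X Z2 p f)"
    by (rule ext) (rule curvature_scale2[OF X Z1 Z2 a p])
  then show "g p (curvature M D Z1 (\<lambda>q f. a q * X q f) Z2 p) (Y p) = a p * g p (curvature M D Z1 X Z2 p) (Y p)"
    using g_cmult_left[OF pM R[OF X] T[OF Y]] by simp
  show "g p (curvature M D Z1 X Z2 p) (\<lambda>f. a p * Y p f) = a p * g p (curvature M D Z1 X Z2 p) (Y p)"
    using g_cmult_right[OF pM T[OF Y] R[OF X]] by simp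
qed

text \<open>The outer trace: the first and third slots vary after the inner trace has been taken in
  the frame \<open>L\<close>, with \<open>c j\<close> in the place of the norms of that
  frame.\<close>

lemma tensorial_ricci:
  assumes L: "\<And>j. j \<in> J \<Longrightarrow> vector_field M W (L j)" and p: "p \<in> W"
  shows "tensorial_at W p (\<lambda>X Y. \<Sum>j\<in>J. g p (curvature M D X (L j) Y p) (L j p) / c j)"
  unfolding tensorial_at_def
proof (intro conjI allI impI)
  note pM = openin_points[OF W p]
  fix X Y assume X: "vector_field M W X" and Y: "vector_field M W Y"
  note R = curvature_tangent[OF _ L _ p] and T = vector_field_tangent[OF L p]
  fix Z assume Z: "vector_field M W Z"
  have 1: "curvature M D (\<lambda>q f. X q f + Z q f) (L j) Y p =
      (\<lambda>f. curvature M D X (L j) Y p f + curvature M D Z (L j) Y p f)" if "j \<in> J" for j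
    by (rule ext) (rule curvature_add1[OF X Z L[OF that] Y p])
  show "(\<Sum>j\<in>J. g p (curvature M D (\<lambda>q f. X q f + Z q f) (L j) Y p) (L j p) / c j) =
      (\<Sum>j\<in>J. g p (curvature M D X (L j) Y p) (L j p) / c j) +
      (\<Sum>j\<in>J. g p (curvature M D Z (L j) Y p) (L j p) / c j)"
    unfolding sum.distrib[symmetric] using g_add_left[OF pM R[OF X _ Y] R[OF Z _ Y] T]
    by (intro sum.cong refl) (simp add: 1 add_divide_distrib)
  have 2: "curvature M D X (L j) (\<lambda>q f. Y q f + Z q f) p =
      (\<lambda>f. curvature M D X (L j) Y p f + curvature M D X (L j) Z p f)" if "j \<in> J" for j
    by (rule ext) (rule curvature_add3[OF X L[OF that] Y Z p])
  show "(\<Sum>j\<in>J. g p (curvature M D X (L j) (\<lambda>q f. Y q f + Z q f) p) (L j p) / c j) =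
      (\<Sum>j\<in>J. g p (curvature M D X (L j) Y p) (L j p) / c j) +
      (\<Sum>j\<in>J. g p (curvature M D X (L j) Z p) (L j p) / c j)"
    unfolding sum.distrib[symmetric] using g_add_left[OF pM R[OF X _ Y] R[OF X _ Z] T]
    by (intro sum.cong refl) (simp add: 2 add_divide_distrib)
next
  note pM = openin_points[OF W p]
  fix X Y a assume X: "vector_field M W X" and Y: "vector_field M W Y" and a: "smooth_on M W a"
  note R = curvature_tangent[OF X L Y p] and T = vector_field_tangent[OF L p]
  have 1: "curvature M D (\<lambda>q f. a q * X q f) (L j) Y p = (\<lambda>f. a p * curvature M D X (L j) Y p f)"
    if "j \<in> J" for j by (rule ext) (rule curvature_scale1[OF X L[OF that] Y a p])
  show "(\<Sum>j\<in>J. g p (curvature M D (\<lambda>q f. a q * X q f) (L j) Y p) (L j p) / c j) =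
      a p * (\<Sum>j\<in>J. g p (curvature M D X (L j) Y p) (L j p) / c j)"
    unfolding sum_distrib_left using g_cmult_left[OF pM R T]
    by (intro sum.cong refl) (simp add: 1)
  have 2: "curvature M D X (L j) (\<lambda>q f. a q * Y q f) p = (\<lambda>f. a p * curvature M D X (L j) Y p f)"
    if "j \<in> J" for j by (rule ext) (rule curvature_scale3[OF X L[OF that] Y a p])
  show "(\<Sum>j\<in>J. g p (curvature M D X (L j) (\<lambda>q f. a q * Y q f) p) (L j p) / c j) =
      a p * (\<Sum>j\<in>J. g p (curvature M D X (L j) Y p) (L j p) / c j)"
    unfolding sum_distrib_left using g_cmult_left[OF pM R T]
    by (intro sum.cong refl) (simp add: 2)
qed

lemma tensorial_covariant_derivative:
  assumes P: "vector_field M W P" and p: "p \<in> W"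
  shows "tensorial_at W p (\<lambda>X Y. g p (D X P p) (Y p))"
  unfolding tensorial_at_def
proof (intro conjI allI impI)
  note pM = openin_points[OF W p]
  note DT = vector_field_tangent[OF D_vector_field[OF _ P] p] and T = vector_field_tangent[OF _ p]
  fix X Y assume X: "vector_field M W X" and Y: "vector_field M W Y"
  fix Z assume Z: "vector_field M W Z"
  have "D (\<lambda>q f. X q f + Z q f) P p = (\<lambda>f. D X P p f + D Z P p f)"
    by (rule ext) (rule D_add_left[OF X P Z p])
  then show "g p (D (\<lambda>q f. X q f + Z q f) P p) (Y p) = g p (D X P p) (Y p) + g p (D Z P p) (Y p)"
    using g_add_left[OF pM DT[OF X] DT[OF Z] T[OF Y]] by simp
  show "g p (D X P p) (\<lambda>f. Y p f + Z p f) = g p (D X P p) (Y p) + g p (D X P p) (Z p)"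
    using g_add_right[OF pM T[OF Y] T[OF Z] DT[OF X]] by simp
next
  note pM = openin_points[OF W p]
  note DT = vector_field_tangent[OF D_vector_field[OF _ P] p] and T = vector_field_tangent[OF _ p]
  fix X Y a assume X: "vector_field M W X" and Y: "vector_field M W Y" and a: "smooth_on M W a"
  have "D (\<lambda>q f. a q * X q f) P p = (\<lambda>f. a p * D X P p f)"
    by (rule ext) (rule D_scale_left[OF X P a p])
  then show "g p (D (\<lambda>q f. a q * X q f) P p) (Y p) = a p * g p (D X P p) (Y p)"
    using g_cmult_left[OF pM DT[OF X] T[OF Y]] by simp
  show "g p (D X P p) (\<lambda>f. a p * Y p f) = a p * g p (D X P p) (Y p)"
    using g_cmult_right[OF pM T[OF Y] DT[OF X]] by simp
qed

text \<open>Metric compatibility with each of the three fields differentiating in turn, and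
  differences such as D_X Y - D_Y X replaced by brackets. The right-hand side contains no
  connection, so \<open>D\<close> can be read off from brackets and inner products.\<close>

lemma koszul:
  assumes X: "vector_field M W X" and Y: "vector_field M W Y" and Z: "vector_field M W Z" and p: "p \<in> W"
  shows "2 * g p (D X Y p) (Z p) = X p (\<lambda>q. g q (Y q) (Z q)) + Y p (\<lambda>q. g q (X q) (Z q))
    - Z p (\<lambda>q. g q (X q) (Y q)) + g p (lie_bracket M X Y p) (Z p)
    - g p (lie_bracket M X Z p) (Y p) - g p (lie_bracket M Y Z p) (X p)"
proof -
  note pM = openin_points[OF W p]
  note T = vector_field_tangent[OF _ p]
  have br: "g p (lie_bracket M A B p) (C p) = g p (D A B p) (C p) - g p (D B A p) (C p)"
    if "vector_field M W A" "vector_field M W B" "vector_field M W C" for A B C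
  proof -
    have "lie_bracket M A B p = (\<lambda>f. D A B p f - D B A p f)"
      by (rule ext) (simp add: D_torsion_free[OF that(1,2) p])
    then show ?thesis using g_diff_left[OF pM T[OF D_vector_field] T[OF D_vector_field] T] that by simp
  qed
  show ?thesis
    using D_metric[OF X Y Z p] D_metric[OF Y X Z p] D_metric[OF Z X Y p] br[OF X Y Z] br[OF X Z Y] br[OF Y Z X]
      g_sym[OF pM T[OF X] T[OF D_vector_field[OF Y Z]]] g_sym[OF pM T[OF X] T[OF D_vector_field[OF Z Y]]]
      g_sym[OF pM T[OF Y] T[OF D_vector_field[OF X Z]]]
    by linarith
qed

end

lemma orthogonal_frame_subset:
  "orthogonal_frame W K E \<Longrightarrow> openin (mtop M) W' \<Longrightarrow> W' \<subseteq> W \<Longrightarrow> orthogonal_frame W' K E"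
  unfolding orthogonal_frame_def by (auto intro: vector_field_subset)

text \<open>The frame chosen by \<open>frame_at\<close> lives on some neighbourhood of its own; for
  a comparison with \<open>L\<close> both are restricted to the intersection.\<close>

lemma frame_at_orthogonal_common:
  assumes L: "orthogonal_frame W J L" and p: "p \<in> W"
  obtains W' where "p \<in> W'" "openin (mtop M) W'" "W' \<subseteq> W" "orthogonal_frame W' J L"
    "orthogonal_frame W' {..<mdim M} (frame_at M g p)" "orthonormal_frame M g W' (frame_at M g p)"
proof -
  note W = orthogonal_frameD(1)[OF L]
  obtain V where V: "openin (mtop M) V" "p \<in> V" "orthonormal_frame M g V (frame_at M g p)"
    using frame_at[OF openin_points[OF W p]] .
  have O: "openin (mtop M) (W \<inter> V)" using V W by blast
  show thesis
    by (rule that[of "W \<inter> V"])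
      (use O p V orthogonal_frame_subset[OF L O] orthonormal_frame_subset[OF V(3)]
        orthonormal_frame_imp_orthogonal_frame[OF O] in auto)
qed

text \<open>The two traces are moved to the frame \<open>L\<close> in turn: the inner one while the
  outer fields are still the \<open>E k\<close>, then the outer one.\<close>

lemma scalar_curvature_eq:
  assumes L: "orthogonal_frame W J L" and p: "p \<in> W"
  shows "scalar_curvature M g D p = (\<Sum>i\<in>J. \<Sum>j\<in>J. g p (curvature M D (L i) (L j) (L i) p) (L j p) /
      (g p (L i p) (L i p) * g p (L j p) (L j p)))"
proof -
  define E where "E = frame_at M g p"
  define n where "n = mdim M"
  obtain W' where W': "p \<in> W'" "openin (mtop M) W'" and L': "orthogonal_frame W' J L"
    and E: "orthogonal_frame W' {..<n} E" and En: "orthonormal_frame M g W' E"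
    using frame_at_orthogonal_common[OF L p] unfolding E_def n_def by metis
  note Ev = orthogonal_frameD(3)[OF E] and Lv = orthogonal_frameD(3)[OF L']
  \<comment> \<open>A norm of 1 or -1 is its own inverse, so the products in the definition become
    the quotients that traces over orthogonal frames use.\<close>
  have eps: "g p (E k p) (E k p) * x = x / g p (E k p) (E k p)" if "k < n" for k x
    using orthonormal_frame_norm[OF En _ W'(1), of k] that by (auto simp: n_def)
  have "scalar_curvature M g D p = (\<Sum>k<n. (\<Sum>j<n. g p (curvature M D (E k) (E j) (E k) p) (E j p) /
      g p (E j p) (E j p)) / g p (E k p) (E k p))"
    unfolding scalar_curvature_def ricci_def Let_def E_def[symmetric] n_def[symmetric]
    by (intro sum.cong refl) (simp add: eps)
  also have "\<dots> = (\<Sum>k<n. (\<Sum>j\<in>J. g p (curvature M D (E k) (L j) (E k) p) (L j p) /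
      g p (L j p) (L j p)) / g p (E k p) (E k p))"
    by (intro sum.cong refl arg_cong2[where f = divide]
        trace_independent_of_frame[OF tensorial_curvature2[OF W'(2)] W'(1) E L'] Ev W')
  also have "\<dots> = (\<Sum>i\<in>J. (\<Sum>j\<in>J. g p (curvature M D (L i) (L j) (L i) p) (L j p) /
      g p (L j p) (L j p)) / g p (L i p) (L i p))"
    by (rule trace_independent_of_frame[OF tensorial_ricci[OF W'(2) Lv W'(1)] W'(1) E L'])
  finally show ?thesis by (simp add: sum_divide_distrib mult_ac)
qed

lemma divergence_eq:
  assumes L: "orthogonal_frame W J L" and p: "p \<in> W" and P: "vector_field M W P"
  shows "divergence M g D P p = (\<Sum>j\<in>J. g p (D (L j) P p) (L j p) / g p (L j p) (L j p))"
proof -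
  define E where "E = frame_at M g p"
  define n where "n = mdim M"
  obtain W' where W': "p \<in> W'" "openin (mtop M) W'" "W' \<subseteq> W" and L': "orthogonal_frame W' J L"
    and E: "orthogonal_frame W' {..<n} E" and En: "orthonormal_frame M g W' E"
    using frame_at_orthogonal_common[OF L p] unfolding E_def n_def by metis
  have eps: "g p (E k p) (E k p) * x = x / g p (E k p) (E k p)" if "k < n" for k x
    using orthonormal_frame_norm[OF En _ W'(1), of k] that by (auto simp: n_def)
  have "divergence M g D P p = (\<Sum>k<n. g p (D (E k) P p) (E k p) / g p (E k p) (E k p))"
    unfolding divergence_def Let_def E_def[symmetric] n_def[symmetric]
    by (intro sum.cong refl) (simp add: eps)
  also have "\<dots> = (\<Sum>j\<in>J. g p (D (L j) P p) (L j p) / g p (L j p) (L j p))"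
    by (rule trace_independent_of_frame[OF
          tensorial_covariant_derivative[OF W'(2) vector_field_subset[OF P W'(3)] W'(1)] W'(1) E L'])
  finally show ?thesis .
qed


section \<open>Scalar curvature of the quarter-symmetric connection\<close>

text \<open>Expansion of the definition. Terms with D_X Y or D_Y X are cancelled by the bracket;
  terms with D_X Z or D_Y Z are symmetric in \<open>X\<close> and \<open>Y\<close> and drop out.
  Besides the curvature of \<open>D\<close>, only derivatives of \<open>P\<close> and products of
  values remain.\<close>

lemma quarter_symmetric_curvature:
  fixes l1 l2 :: real
  assumes W: "openin (mtop M) W" and P: "vector_field M W P" and X: "vector_field M W X"
    and Y: "vector_field M W Y" and Z: "vector_field M W Z" and p: "p \<in> W"
  shows "curvature M (quarter_symmetric g D P l1 l2) X Y Z p h = curvature M D X Y Z p h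
    + l1 * (g p (Z p) (D X P p) * Y p h - g p (Z p) (D Y P p) * X p h)
    + l2 * (g p (X p) (Z p) * D Y P p h - g p (Y p) (Z p) * D X P p h)
    + l1 * l2 * g p (P p) (P p) * (g p (X p) (Z p) * Y p h - g p (Y p) (Z p) * X p h)
    + l2 * l2 * (g p (Y p) (Z p) * g p (X p) (P p) - g p (X p) (Z p) * g p (Y p) (P p)) * P p h
    + l1 * l1 * g p (Z p) (P p) * (g p (Y p) (P p) * X p h - g p (X p) (P p) * Y p h)"
proof -
  note pM = openin_points[OF W p]
  note T = vector_field_tangent[OF _ p]
  define Q where "Q = quarter_symmetric g D P l1 l2"
  have Q: "Q A B q f = D A B q f + l1 * g q (B q) (P q) * A q f - l2 * g q (A q) (B q) * P q f" for A B q f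
    by (simp add: Q_def quarter_symmetric_def)
  have inner: "Q X (Q Y Z) p h = D X (D Y Z) p h
      + l1 * g p (Z p) (P p) * D X Y p h + l1 * (g p (D X Z p) (P p) + g p (Z p) (D X P p)) * Y p h
      - l2 * g p (Y p) (Z p) * D X P p h - l2 * (g p (D X Y p) (Z p) + g p (Y p) (D X Z p)) * P p h
      + l1 * (g p (D Y Z p) (P p) + l1 * g p (Z p) (P p) * g p (Y p) (P p)
          - l2 * g p (Y p) (Z p) * g p (P p) (P p)) * X p h
      - l2 * (g p (X p) (D Y Z p) + l1 * g p (Z p) (P p) * g p (X p) (Y p)
          - l2 * g p (Y p) (Z p) * g p (X p) (P p)) * P p h"
    if X: "vector_field M W X" and Y: "vector_field M W Y" for X Y
  proof -
    define a where "a q = l1 * g q (Z q) (P q)" for q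
    define c where "c q = (- l2) * g q (Y q) (Z q)" for q
    have as: "smooth_on M W a" and cs: "smooth_on M W c"
      unfolding a_def c_def by (intro smooth_on_cmult g_smooth W X Y Z P)+
    have QYZ: "Q Y Z = (\<lambda>q f. D Y Z q f + a q * Y q f + c q * P q f)"
      by (auto simp: Q a_def c_def fun_eq_iff)
    note v1 = D_vector_field[OF W Y Z] and v2 = vector_field_scale[OF Y as] and v3 = vector_field_scale[OF P cs]
    have d: "D X (Q Y Z) p h = D X (D Y Z) p h + (a p * D X Y p h + X p a * Y p h)
        + (c p * D X P p h + X p c * P p h)"
      unfolding QYZ D_add_right[OF W X vector_field_add[OF v1 v2] v3 p] D_add_right[OF W X v1 v2 p]
        D_scale_right[OF W X Y as p] D_scale_right[OF W X P cs p] ..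
    have Xa: "X p a = l1 * (g p (D X Z p) (P p) + g p (Z p) (D X P p))"
      unfolding a_def D_metric[OF W X Z P p, symmetric]
      by (rule tangent_cmult[OF T[OF X] smooth_atI[OF W p g_smooth[OF W Z P]]])
    have Xc: "X p c = (- l2) * (g p (D X Y p) (Z p) + g p (Y p) (D X Z p))"
      unfolding c_def D_metric[OF W X Y Z p, symmetric]
      by (rule tangent_cmult[OF T[OF X] smooth_atI[OF W p g_smooth[OF W Y Z]]])
    note t1 = T[OF v1] and t2 = T[OF v2] and t3 = T[OF v3] and tP = T[OF P] and tX = T[OF X] and tY = T[OF Y]
    have gP: "g p (Q Y Z p) (P p) = g p (D Y Z p) (P p) + a p * g p (Y p) (P p) + c p * g p (P p) (P p)"
      unfolding QYZ g_add_left[OF pM tangent_space_add[OF t1 t2] t3 tP] g_add_left[OF pM t1 t2 tP]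
        g_cmult_left[OF pM tY tP] g_cmult_left[OF pM tP tP] ..
    have gX: "g p (X p) (Q Y Z p) = g p (X p) (D Y Z p) + a p * g p (X p) (Y p) + c p * g p (X p) (P p)"
      unfolding QYZ g_add_right[OF pM tangent_space_add[OF t1 t2] t3 tX] g_add_right[OF pM t1 t2 tX]
        g_cmult_right[OF pM tY tX] g_cmult_right[OF pM tP tX] ..
    show ?thesis unfolding Q[of X "Q Y Z"] d gP gX Xa Xc by (simp add: a_def c_def algebra_simps)
  qed
  have br: "lie_bracket M X Y p = (\<lambda>f. D X Y p f - D Y X p f)"
    by (rule ext) (simp add: D_torsion_free[OF W X Y p])
  note B = lie_bracket_vector_field[OF W X Y]
  have brQ: "Q (lie_bracket M X Y) Z p h = D (lie_bracket M X Y) Z p h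
      + l1 * g p (Z p) (P p) * (D X Y p h - D Y X p h)
      - l2 * (g p (D X Y p) (Z p) - g p (D Y X p) (Z p)) * P p h"
    unfolding Q br using g_diff_left[OF pM T[OF D_vector_field[OF W X Y]] T[OF D_vector_field[OF W Y X]] T[OF Z]]
    by simp
  note s = g_sym[OF pM]
  \<comment> \<open>Inner products occur with their arguments in either order; a fixed order lets
    ring arithmetic find the cancellations.\<close>
  have syms: "g p (Y p) (X p) = g p (X p) (Y p)" "g p (X p) (D Y Z p) = g p (D Y Z p) (X p)"
    "g p (Y p) (D X Z p) = g p (D X Z p) (Y p)"
    using s T X Y D_vector_field[OF W X Z] D_vector_field[OF W Y Z] by auto
  show ?thesis
    unfolding Q_def[symmetric] curvature_def inner[OF X Y] inner[OF Y X] brQ syms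
    by (simp add: algebra_simps)
qed

text \<open>For distinct frame fields the correction is \<open>F j k\<close>. Summed over all pairs
  j <> k, a term in one index occurs n - 1 times and the constant l1 l2 g(P,P) occurs n (n - 1)
  times. This is the origin of (n - 1)(l1 + l2) and of (n - 1)(l1^2 + l2^2 - n l1 l2).\<close>

lemma scalar_curvature_quarter_symmetric:
  fixes l1 l2 :: real
  assumes W: "openin (mtop M) W" and P: "vector_field M W P" and p: "p \<in> W"
  defines "n \<equiv> real (mdim M)"
  shows "scalar_curvature M g (quarter_symmetric g D P l1 l2) p = scalar_curvature M g D p
    + (n - 1) * (l1 + l2) * divergence M g D P p
    - (n - 1) * (l1\<^sup>2 + l2\<^sup>2 - n * l1 * l2) * g p (P p) (P p)"
proof -
  note pM = openin_points[OF W p]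
  define E where "E = frame_at M g p"
  define N where "N = mdim M"
  obtain V where V: "openin (mtop M) V" "p \<in> V" "orthonormal_frame M g V E"
    using frame_at[OF pM] unfolding E_def .
  define W' where "W' = W \<inter> V"
  have W': "openin (mtop M) W'" "p \<in> W'" using V W p by (auto simp: W'_def)
  have En: "orthonormal_frame M g W' E" using orthonormal_frame_subset[OF V(3)] by (simp add: W'_def)
  note E = orthonormal_frame_imp_orthogonal_frame[OF W'(1) En, folded N_def]
  note Ev = orthogonal_frameD(3)[OF E]
  have P': "vector_field M W' P" using vector_field_subset[OF P] by (simp add: W'_def)
  note T = vector_field_tangent[OF _ W'(2)]
  note ET = T[OF Ev] and PT = T[OF P']
  define \<epsilon> where "\<epsilon> k = g p (E k p) (E k p)" for k
  define d where "d k = g p (D (E k) P p) (E k p)" for k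
  define \<pi> where "\<pi> k = g p (E k p) (P p)" for k
  define pp where "pp = g p (P p) (P p)"
  have \<epsilon>: "\<epsilon> k * \<epsilon> k = 1" if "k < N" for k
    using orthonormal_frame_norm[OF En _ W'(2), of k] that by (auto simp: N_def \<epsilon>_def)
  have ort: "g p (E j p) (E k p) = 0" if "j < N" "k < N" "j \<noteq> k" for j k
    using orthogonal_frameD(4)[OF E] that W'(2) by auto
  define R where "R j k = g p (curvature M D (E j) (E k) (E j) p) (E k p)" for j k
  define F where "F j k = (l1 * \<epsilon> j * d j - l1 * l1 * \<epsilon> j * \<pi> j * \<pi> j)
      + (l2 * \<epsilon> k * d k - l2 * l2 * \<epsilon> k * \<pi> k * \<pi> k) + l1 * l2 * pp" for j k
  have key: "\<epsilon> j * (\<epsilon> k * g p (curvature M (quarter_symmetric g D P l1 l2) (E j) (E k) (E j) p) (E k p))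
      = \<epsilon> j * (\<epsilon> k * R j k) + (if j = k then 0 else F j k)" if jk: "j < N" "k < N" for j k
  proof -
    have vj: "vector_field M W' (E j)" and vk: "vector_field M W' (E k)" using Ev jk by auto
    \<comment> \<open>The curvature as a combination of six vectors, kept as a list of coefficients
      and vectors so that linearity of the metric is applied to all terms at once.\<close>
    define A where "A = [(1, curvature M D (E j) (E k) (E j) p),
      (l1 * g p (E j p) (D (E j) P p) + l1 * l2 * pp * \<epsilon> j - l1 * l1 * \<pi> j * \<pi> j, E k p),
      (- l1 * g p (E j p) (D (E k) P p) - l1 * l2 * pp * g p (E k p) (E j p) + l1 * l1 * \<pi> j * \<pi> k, E j p),
      (l2 * \<epsilon> j, D (E k) P p), (- l2 * g p (E k p) (E j p), D (E j) P p),
      (l2 * l2 * (g p (E k p) (E j p) * \<pi> j - \<epsilon> j * \<pi> k), P p)]"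
    have tang: "snd (A ! i) \<in> tangent_space M p" if "i < 6" for i
    proof -
      have "\<forall>x\<in>set A. snd x \<in> tangent_space M p"
        using curvature_tangent[OF W'(1) vj vk vj W'(2)] T[OF D_vector_field[OF W'(1) vk P']]
          T[OF D_vector_field[OF W'(1) vj P']] PT T[OF vj] T[OF vk] by (simp add: A_def)
      moreover have "A ! i \<in> set A" using that by (intro nth_mem) (simp add: A_def)
      ultimately show ?thesis by blast
    qed
    have "curvature M (quarter_symmetric g D P l1 l2) (E j) (E k) (E j) p
        = (\<lambda>f. \<Sum>i<6. fst (A ! i) * snd (A ! i) f)"
    proof
      fix h
      show "curvature M (quarter_symmetric g D P l1 l2) (E j) (E k) (E j) p h
          = (\<Sum>i<6. fst (A ! i) * snd (A ! i) h)"
        unfolding quarter_symmetric_curvature[OF W'(1) P' vj vk vj W'(2)]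
        by (simp add: A_def eval_nat_numeral \<epsilon>_def \<pi>_def pp_def algebra_simps)
    qed
    then have "g p (curvature M (quarter_symmetric g D P l1 l2) (E j) (E k) (E j) p) (E k p)
        = (\<Sum>i<6. fst (A ! i) * g p (snd (A ! i)) (E k p))"
      using g_lincomb_left[OF pM T[OF vk], of "{..<6}" "\<lambda>i. snd (A ! i)" "\<lambda>i. fst (A ! i)"] tang by simp
    also have "\<dots> = R j k
        + (l1 * g p (E j p) (D (E j) P p) + l1 * l2 * pp * \<epsilon> j - l1 * l1 * \<pi> j * \<pi> j) * \<epsilon> k
        + (- l1 * g p (E j p) (D (E k) P p) - l1 * l2 * pp * g p (E k p) (E j p) + l1 * l1 * \<pi> j * \<pi> k)
            * g p (E j p) (E k p)
        + l2 * \<epsilon> j * d k - l2 * g p (E k p) (E j p) * g p (D (E j) P p) (E k p)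
        + l2 * l2 * (g p (E k p) (E j p) * \<pi> j - \<epsilon> j * \<pi> k) * g p (P p) (E k p)"
      by (simp add: A_def eval_nat_numeral R_def \<epsilon>_def d_def)
    finally have eq: "g p (curvature M (quarter_symmetric g D P l1 l2) (E j) (E k) (E j) p) (E k p) = \<dots>" .
    have s: "g p (E j p) (D (E j) P p) = d j" "g p (P p) (E k p) = \<pi> k"
      using g_sym[OF pM T[OF vj] T[OF D_vector_field[OF W'(1) vj P']]] g_sym[OF pM PT T[OF vk]]
      by (simp_all add: d_def \<pi>_def)
    show ?thesis
    proof (cases "j = k")
      \<comment> \<open>On the diagonal all corrections cancel, since the curvature is antisymmetric
        in its first two arguments.\<close>
      case True
      have "g p (E j p) (E j p) = \<epsilon> j" by (simp add: \<epsilon>_def)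
      then show ?thesis unfolding eq using True s by (simp add: d_def[symmetric] algebra_simps)
    next
      case False
      have o: "g p (E j p) (E k p) = 0" "g p (E k p) (E j p) = 0" using ort jk False by auto
      have "\<epsilon> j * (\<epsilon> k * ((l1 * d j + l1 * l2 * pp * \<epsilon> j - l1 * l1 * \<pi> j * \<pi> j) * \<epsilon> k + l2 * \<epsilon> j * d k
          + l2 * l2 * (- \<epsilon> j * \<pi> k) * \<pi> k))
        = (\<epsilon> k * \<epsilon> k) * (l1 * \<epsilon> j * d j - l1 * l1 * \<epsilon> j * \<pi> j * \<pi> j)
          + (\<epsilon> j * \<epsilon> j) * (l2 * \<epsilon> k * d k - l2 * l2 * \<epsilon> k * \<pi> k * \<pi> k)
          + (\<epsilon> j * \<epsilon> j) * (\<epsilon> k * \<epsilon> k) * (l1 * l2 * pp)"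
        by (simp add: algebra_simps)
      also have "\<dots> = F j k" by (simp add: \<epsilon> jk F_def)
      finally show ?thesis unfolding eq s o using False by (simp add: algebra_simps)
    qed
  qed
  have off_diagonal: "(\<Sum>j<N. \<Sum>k<N. if j = k then 0 else a j + b k + c)
      = (real N - 1) * ((\<Sum>j<N. a j) + (\<Sum>k<N. b k) + real N * c)" for a b and c :: real
  proof -
    have "(\<Sum>k<N. if j = k then 0 else a j + b k + c) = (\<Sum>k<N. a j + b k + c) - (a j + b j + c)"
      if "j < N" for j
    proof -
      have "(\<Sum>k<N. if j = k then 0 else a j + b k + c)
          = (\<Sum>k<N. (a j + b k + c) - (if k = j then a j + b j + c else 0))"
        by (rule sum.cong) auto
      then show ?thesis using that by (simp add: sum_subtractf)
    qed
    then have "(\<Sum>j<N. \<Sum>k<N. if j = k then 0 else a j + b k + c)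
        = (\<Sum>j<N. (\<Sum>k<N. a j + b k + c) - (a j + b j + c))" by simp
    also have "\<dots> = (real N - 1) * ((\<Sum>j<N. a j) + (\<Sum>k<N. b k) + real N * c)"
      by (simp add: sum.distrib sum_subtractf sum_distrib_left[symmetric] algebra_simps)
    finally show ?thesis .
  qed
  have div: "(\<Sum>k<N. \<epsilon> k * d k) = divergence M g D P p"
    unfolding divergence_def Let_def E_def[symmetric] N_def[symmetric] by (simp add: \<epsilon>_def d_def)
  \<comment> \<open>The norm of \<open>P\<close> from its components: \<open>P\<close> is expanded
    in the frame, and each \<epsilon> k is its own inverse.\<close>
  have ppsum: "(\<Sum>k<N. \<epsilon> k * \<pi> k * \<pi> k) = pp"
  proof -
    have "pp = g p (\<lambda>f. \<Sum>k<N. g p (P p) (E k p) / g p (E k p) (E k p) * E k p f) (P p)"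
      using orthogonal_frameD(6)[OF E W'(2) PT] by (simp add: pp_def)
    also have "\<dots> = (\<Sum>k<N. g p (P p) (E k p) / g p (E k p) (E k p) * g p (E k p) (P p))"
      by (rule g_lincomb_left[OF pM PT ET]) simp
    also have "\<dots> = (\<Sum>k<N. \<epsilon> k * \<pi> k * \<pi> k)"
    proof (rule sum.cong[OF refl])
      fix k assume "k \<in> {..<N}"
      then have k: "k < N" by simp
      have inv: "inverse (\<epsilon> k) = \<epsilon> k" by (rule inverse_unique[OF \<epsilon>[OF k]])
      have sym: "g p (P p) (E k p) = \<pi> k" using g_sym[OF pM PT ET] k by (simp add: \<pi>_def)
      show "g p (P p) (E k p) / g p (E k p) (E k p) * g p (E k p) (P p) = \<epsilon> k * \<pi> k * \<pi> k"
        unfolding sym divide_inverse \<epsilon>_def[symmetric] inv \<pi>_def[symmetric] by (simp only: mult_ac)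
    qed
    finally show ?thesis ..
  qed
  have "scalar_curvature M g (quarter_symmetric g D P l1 l2) p
      = (\<Sum>j<N. \<Sum>k<N. \<epsilon> j * (\<epsilon> k * g p (curvature M (quarter_symmetric g D P l1 l2) (E j) (E k) (E j) p) (E k p)))"
    unfolding scalar_curvature_def ricci_def Let_def E_def[symmetric] N_def[symmetric]
    by (simp add: \<epsilon>_def sum_distrib_left)
  also have "\<dots> = (\<Sum>j<N. \<Sum>k<N. \<epsilon> j * (\<epsilon> k * R j k)) + (\<Sum>j<N. \<Sum>k<N. if j = k then 0 else F j k)"
    unfolding sum.distrib[symmetric] by (intro sum.cong refl key) auto
  also have "(\<Sum>j<N. \<Sum>k<N. \<epsilon> j * (\<epsilon> k * R j k)) = scalar_curvature M g D p"
    unfolding scalar_curvature_def ricci_def Let_def E_def[symmetric] N_def[symmetric]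
    by (simp add: \<epsilon>_def R_def sum_distrib_left)
  also have "(\<Sum>j<N. \<Sum>k<N. if j = k then 0 else F j k)
      = (real N - 1) * ((\<Sum>j<N. l1 * \<epsilon> j * d j - l1 * l1 * \<epsilon> j * \<pi> j * \<pi> j)
        + (\<Sum>k<N. l2 * \<epsilon> k * d k - l2 * l2 * \<epsilon> k * \<pi> k * \<pi> k) + real N * (l1 * l2 * pp))"
    unfolding F_def by (rule off_diagonal)
  also have "(\<Sum>j<N. l1 * \<epsilon> j * d j - l1 * l1 * \<epsilon> j * \<pi> j * \<pi> j)
      = l1 * (\<Sum>j<N. \<epsilon> j * d j) - l1 * l1 * (\<Sum>j<N. \<epsilon> j * \<pi> j * \<pi> j)"
    by (simp add: sum_subtractf sum_distrib_left mult_ac)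
  also have "(\<Sum>k<N. l2 * \<epsilon> k * d k - l2 * l2 * \<epsilon> k * \<pi> k * \<pi> k)
      = l2 * (\<Sum>j<N. \<epsilon> j * d j) - l2 * l2 * (\<Sum>j<N. \<epsilon> j * \<pi> j * \<pi> j)"
    by (simp add: sum_subtractf sum_distrib_left mult_ac)
  finally show ?thesis unfolding div ppsum
    by (simp add: n_def N_def[symmetric] pp_def[symmetric] algebra_simps power2_eq_square)
qed

end


section \<open>The product of an interval and manifolds\<close>

locale interval_product =
  fixes I :: "real set" and m :: nat and F :: "nat \<Rightarrow> 'a manifold"
  assumes open_I: "open I" and F: "\<And>i. i \<in> {1..m} \<Longrightarrow> smooth_atlas (F i)"
begin

abbreviation "M \<equiv> product_manifold I m F"
abbreviation "off \<equiv> coord_offset F"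

lemma points_M: "points M = I \<times> Pi\<^sub>E {1..m} (\<lambda>i. points (F i))"
  by (simp add: product_manifold_def)

lemma in_points_M: "(t, x) \<in> points M \<longleftrightarrow> t \<in> I \<and> x \<in> Pi\<^sub>E {1..m} (\<lambda>i. points (F i))"
  by (simp add: points_M)

lemma mdim_M: "mdim M = 1 + (\<Sum>i=1..m. mdim (F i))"
  by (simp add: product_manifold_def)

lemma offset_le:
  assumes "1 \<le> i" "i < i'"
  shows "off i + mdim (F i) \<le> off i'"
proof -
  have "(\<Sum>j=1..<Suc i. mdim (F j)) \<le> (\<Sum>j=1..<i'. mdim (F j))"
    by (rule sum_mono2) (use assms in auto)
  then show ?thesis using assms by (simp add: coord_offset_def)
qed

lemma offset_Suc_m: "off (Suc m) = mdim M"
  by (simp add: coord_offset_def mdim_M atLeastLessThanSuc_atLeastAtMost)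

lemma offset_index:
  assumes "i \<in> {1..m}" "j < mdim (F i)"
  shows "off i + j < mdim M" "off i + j \<noteq> 0"
  using offset_le[of i "Suc m"] assms offset_Suc_m by (auto simp: coord_offset_def)

text \<open>Statements about product coordinates are reduced by this split to the time coordinate or
  to a single factor.\<close>

lemma coord_index_cases:
  assumes "k < mdim M"
  obtains "k = 0" | i j where "i \<in> {1..m}" "j < mdim (F i)" "k = off i + j"
proof -
  have "k = 0 \<or> (\<exists>i\<in>{1..l}. \<exists>j<mdim (F i). k = off i + j)" if "k < off (Suc l)" for l
    using that
  proof (induction l)
    case 0
    then show ?case by (simp add: coord_offset_def)
  next
    case (Suc l)
    show ?case
    proof (cases "k < off (Suc l)")
      case True
      then show ?thesis using Suc.IH by (meson atLeastAtMost_iff le_SucI)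
    next
      case False
      then have "k - off (Suc l) < mdim (F (Suc l))" "k = off (Suc l) + (k - off (Suc l))"
        using Suc.prems by (auto simp: coord_offset_def)
      moreover have "Suc l \<in> {1..Suc l}" by simp
      ultimately show ?thesis by blast
    qed
  qed
  from this[of m] that show thesis using assms offset_Suc_m by metis
qed

lemma product_coords_0: "product_coords m F \<phi> q 0 = fst q"
  by (cases q) (simp add: product_coords_def)

lemma product_coords_offset:
  assumes i: "i \<in> {1..m}" and j: "j < mdim (F i)"
  shows "product_coords m F \<phi> q (off i + j) = \<phi> i (snd q i) j"
proof (cases q)
  case (Pair t x)
  have "product_coords m F \<phi> (t, x) (off i + j) = (\<Sum>l=1..m. if l = i then \<phi> i (x i) j else 0)"
    unfolding product_coords_def split_conv
  proof (subst if_not_P, goal_cases)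
    case 1
    then show ?case using offset_index[OF assms] by simp
  next
    case 2
    show ?case
    proof (rule sum.cong[OF refl])
      fix l assume l: "l \<in> {1..m}"
      show "(if off l \<le> off i + j \<and> off i + j < off l + mdim (F l) then \<phi> l (x l) (off i + j - off l) else 0)
          = (if l = i then \<phi> i (x i) j else 0)"
        using offset_le[of l i] offset_le[of i l] l i j by (cases l i rule: linorder_cases) auto
    qed
  qed
  then show ?thesis using i Pair by simp
qed

lemma product_coords_eq_0:
  assumes "k \<ge> mdim M"
  shows "product_coords m F \<phi> q k = 0"
proof (cases q)
  case (Pair t x)
  have "\<not> (off l \<le> k \<and> k < off l + mdim (F l))" if "l \<in> {1..m}" for l
    using offset_le[of l "Suc m"] that assms offset_Suc_m by auto
  moreover have "k \<noteq> 0" using assms by (simp add: mdim_M)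
  ultimately show ?thesis unfolding Pair product_coords_def split_conv
    by (auto intro!: sum.neutral)
qed

text \<open>The block of coordinates that belongs to factor \<open>i\<close>, padded by 0 so as to
  be a point of \<open>Euclidean_space (mdim (F i))\<close>.\<close>

definition slice :: "nat \<Rightarrow> (nat \<Rightarrow> real) \<Rightarrow> nat \<Rightarrow> real" where
  "slice i y k = (if k < mdim (F i) then y (off i + k) else 0)"

definition chart_family :: "(nat \<Rightarrow> 'a set) \<Rightarrow> (nat \<Rightarrow> 'a \<Rightarrow> nat \<Rightarrow> real) \<Rightarrow> bool" where
  "chart_family U \<phi> \<longleftrightarrow> (\<forall>i\<in>{1..m}. (U i, \<phi> i) \<in> charts (F i))"

abbreviation "cube U \<equiv> I \<times> Pi\<^sub>E {1..m} U"

lemma charts_M: "charts M = {(cube U, product_coords m F \<phi>) | U \<phi>. chart_family U \<phi>}"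
  by (simp add: product_manifold_def chart_family_def)

lemma charts_MI: "chart_family U \<phi> \<Longrightarrow> (cube U, product_coords m F \<phi>) \<in> charts M"
  unfolding charts_M by blast

lemma chart_familyD: "chart_family U \<phi> \<Longrightarrow> i \<in> {1..m} \<Longrightarrow> (U i, \<phi> i) \<in> charts (F i)"
  unfolding chart_family_def by blast

lemma chart_family_open: "chart_family U \<phi> \<Longrightarrow> i \<in> {1..m} \<Longrightarrow> openin (mtop (F i)) (U i)"
  by (rule smooth_atlas.chart_open[OF F chart_familyD])

lemma chart_zero:
  assumes "i \<in> {1..m}" "(U, \<phi>) \<in> charts (F i)" "q \<in> U" "k \<ge> mdim (F i)"
  shows "\<phi> q k = 0"
  using openin_Euclidean_space_subset[OF smooth_atlas.chart_image_open[OF F[OF assms(1)] assms(2)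
      smooth_atlas.chart_open[OF F[OF assms(1)] assms(2)]], of "\<phi> q" k] assms by auto

lemma slice_product_coords:
  assumes c: "chart_family U \<phi>" and q: "q \<in> cube U" and i: "i \<in> {1..m}"
  shows "slice i (product_coords m F \<phi> q) = \<phi> i (snd q i)"
proof
  fix k
  have "snd q i \<in> U i" using q i by auto
  then show "slice i (product_coords m F \<phi> q) k = \<phi> i (snd q i) k"
    using product_coords_offset[OF i] chart_zero[OF i chart_familyD[OF c i]] by (simp add: slice_def)
qed

lemma inj_on_product_coords:
  assumes c: "chart_family U \<phi>"
  shows "inj_on (product_coords m F \<phi>) (cube U)"
proof (rule inj_onI)
  fix p q assume p: "p \<in> cube U" and q: "q \<in> cube U" and eq: "product_coords m F \<phi> p = product_coords m F \<phi> q"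
  have "fst p = fst q" using eq product_coords_0 by metis
  moreover have "snd p i = snd q i" if i: "i \<in> {1..m}" for i
  proof (rule inj_onD[OF smooth_atlas.chart_inj[OF F[OF i] chart_familyD[OF c i]]])
    show "\<phi> i (snd p i) = \<phi> i (snd q i)"
      using slice_product_coords[OF c p i] slice_product_coords[OF c q i] eq by simp
  qed (use p q i in auto)
  moreover have "snd p \<in> extensional {1..m}" "snd q \<in> extensional {1..m}"
    using p q by (auto simp: PiE_def)
  ultimately show "p = q" by (metis extensionalityI prod_eqI)
qed

lemma inv_product_coords:
  assumes c: "chart_family U \<phi>" and q: "q \<in> cube U"
  shows "inv_into (cube U) (product_coords m F \<phi>) (product_coords m F \<phi> q) = q"
  by (rule inv_into_f_f[OF inj_on_product_coords[OF c] q])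

lemma openin_M_box:
  assumes "openin (top_of_set I) T" "\<And>i. i \<in> {1..m} \<Longrightarrow> openin (mtop (F i)) (V i)"
  shows "openin (mtop M) (T \<times> Pi\<^sub>E {1..m} V)"
  using assms by (simp add: product_manifold_def openin_prod_Times_iff openin_PiE)

lemma openin_M_basis:
  assumes W: "openin (mtop M) W" and p: "(t, x) \<in> W"
  obtains T V where "openin (top_of_set I) T" "t \<in> T" "\<And>i. i \<in> {1..m} \<Longrightarrow> openin (mtop (F i)) (V i)"
    "\<And>i. i \<in> {1..m} \<Longrightarrow> x i \<in> V i" "T \<times> Pi\<^sub>E {1..m} V \<subseteq> W"
proof -
  obtain T S where T: "openin (top_of_set I) T" "t \<in> T"
    and S: "openin (product_topology (\<lambda>i. mtop (F i)) {1..m}) S" "x \<in> S" "T \<times> S \<subseteq> W"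
    using W p by (simp add: product_manifold_def openin_prod_topology_alt del: One_nat_def) blast
  obtain V where V: "x \<in> (\<Pi>\<^sub>E i\<in>{1..m}. V i)" "\<And>i. openin (mtop (F i)) (V i)" "(\<Pi>\<^sub>E i\<in>{1..m}. V i) \<subseteq> S"
    using product_topology_open_contains_basis[OF S(1,2)] by blast
  show thesis by (rule that[OF T, of V]) (use V S in auto)
qed

lemma continuous_on_slice: "continuous_on UNIV (slice i)"
proof (rule continuous_on_coordinatewise_then_product)
  show "continuous_on UNIV (\<lambda>y. slice i y k)" for k
    by (cases "k < mdim (F i)") (simp_all add: slice_def continuous_on_product_coordinates)
qed

lemma openin_slices:
  assumes T: "openin (top_of_set I) T" and A: "\<And>i. i \<in> {1..m} \<Longrightarrow> openin (Euclidean_space (mdim (F i))) (A i)"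
  shows "openin (Euclidean_space (mdim M))
    {y. (\<forall>k\<ge>mdim M. y k = 0) \<and> y 0 \<in> T \<and> (\<forall>i\<in>{1..m}. slice i y \<in> A i)}"
proof -
  have "\<forall>i\<in>{1..m}. \<exists>B. open B \<and> A i = {x. \<forall>k\<ge>mdim (F i). x k = 0} \<inter> B"
    using A by (auto simp: Euclidean_space_eq openin_open)
  from bchoice[OF this] obtain B where B: "\<And>i. i \<in> {1..m} \<Longrightarrow> open (B i)"
    "\<And>i. i \<in> {1..m} \<Longrightarrow> A i = {x. \<forall>k\<ge>mdim (F i). x k = 0} \<inter> B i" by blast
  have oT: "open T" using T open_I openin_open_eq by blast
  have "open ((\<lambda>y :: nat \<Rightarrow> real. y 0) -` T)"
    by (rule open_vimage[OF oT continuous_on_product_coordinates])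
  moreover have "open (slice i -` B i)" if "i \<in> {1..m}" for i
    by (rule open_vimage[OF B(1)[OF that] continuous_on_slice])
  ultimately have "open ((\<lambda>y :: nat \<Rightarrow> real. y 0) -` T \<inter> (\<Inter>i\<in>{1..m}. slice i -` B i))"
    by (intro open_Int open_INT) auto
  moreover have "{y. (\<forall>k\<ge>mdim M. y k = 0) \<and> y 0 \<in> T \<and> (\<forall>i\<in>{1..m}. slice i y \<in> A i)} =
      {y. \<forall>k\<ge>mdim M. y k = 0} \<inter> ((\<lambda>y. y 0) -` T \<inter> (\<Inter>i\<in>{1..m}. slice i -` B i))"
    using B(2) by (auto simp: slice_def)
  ultimately show ?thesis unfolding Euclidean_space_eq openin_open by blast
qed

lemma product_coords_in_image:
  assumes c: "chart_family U \<phi>" and y0: "y 0 \<in> T" "T \<subseteq> I" and y: "\<forall>k\<ge>mdim M. y k = 0"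
    and s: "\<And>i. i \<in> {1..m} \<Longrightarrow> slice i y \<in> \<phi> i ` (U i \<inter> V i)"
  obtains x where "x \<in> Pi\<^sub>E {1..m} (\<lambda>i. U i \<inter> V i)" "y = product_coords m F \<phi> (y 0, x)"
proof -
  have "\<forall>i\<in>{1..m}. \<exists>z. z \<in> U i \<inter> V i \<and> slice i y = \<phi> i z" using s by blast
  then obtain z where z: "\<And>i. i \<in> {1..m} \<Longrightarrow> z i \<in> U i \<inter> V i \<and> slice i y = \<phi> i (z i)" by metis
  \<comment> \<open>Points of the product are extensional functions on \<open>{1..m}\<close>, hence
    the restriction.\<close>
  define x where "x = restrict z {1..m}"
  have x: "x \<in> Pi\<^sub>E {1..m} (\<lambda>i. U i \<inter> V i)" using z by (auto simp: x_def)
  have "y k = product_coords m F \<phi> (y 0, x) k" for k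
  proof (cases "k < mdim M")
    case True
    then show ?thesis
    proof (cases rule: coord_index_cases)
      case 1
      then show ?thesis by (simp add: product_coords_0)
    next
      case (2 i j)
      have "y (off i + j) = slice i y j" using 2 by (simp add: slice_def)
      then show ?thesis using 2 z product_coords_offset[OF 2(1,2)] by (simp add: x_def)
    qed
  qed (use y product_coords_eq_0 in auto)
  then show thesis using that x by blast
qed

text \<open>Around each image point lies the image of a box, and this is described by separate
  conditions on the time coordinate and on each \<open>slice\<close>; such sets are open by
  \<open>openin_slices\<close>.\<close>

lemma image_product_coords_open:
  assumes c: "chart_family U \<phi>" and W: "openin (mtop M) W"
  shows "openin (Euclidean_space (mdim M)) (product_coords m F \<phi> ` (cube U \<inter> W))"
proof (subst openin_subopen, intro ballI)
  fix y assume "y \<in> product_coords m F \<phi> ` (cube U \<inter> W)"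
  then obtain t x where p: "(t, x) \<in> cube U" "(t, x) \<in> W" "y = product_coords m F \<phi> (t, x)" by auto
  obtain T V where T: "openin (top_of_set I) T" "t \<in> T" and V: "\<And>i. i \<in> {1..m} \<Longrightarrow> openin (mtop (F i)) (V i)"
    "\<And>i. i \<in> {1..m} \<Longrightarrow> x i \<in> V i" "T \<times> Pi\<^sub>E {1..m} V \<subseteq> W"
    using openin_M_basis[OF W p(2)] by blast
  define S where "S = {y. (\<forall>k\<ge>mdim M. y k = 0) \<and> y 0 \<in> T \<and> (\<forall>i\<in>{1..m}. slice i y \<in> \<phi> i ` (U i \<inter> V i))}"
  have TI: "T \<subseteq> I" using openin_imp_subset[OF T(1)] .
  show "\<exists>S. openin (Euclidean_space (mdim M)) S \<and> y \<in> S \<and> S \<subseteq> product_coords m F \<phi> ` (cube U \<inter> W)"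
  proof (intro exI conjI)
    show "openin (Euclidean_space (mdim M)) S" unfolding S_def
      by (rule openin_slices[OF T(1)]) (use smooth_atlas.chart_image_open[OF F] V(1) chart_familyD[OF c] in blast)
    show "y \<in> S"
      using p T V slice_product_coords[OF c p(1)] by (auto simp: S_def product_coords_eq_0 product_coords_0)
    show "S \<subseteq> product_coords m F \<phi> ` (cube U \<inter> W)"
    proof
      fix z assume z: "z \<in> S"
      obtain w where "w \<in> Pi\<^sub>E {1..m} (\<lambda>i. U i \<inter> V i)" "z = product_coords m F \<phi> (z 0, w)"
        by (rule product_coords_in_image[OF c, of z T V]) (use z TI in \<open>auto simp: S_def\<close>)
      moreover have "z 0 \<in> T" using z by (simp add: S_def)
      moreover have "(z 0, w) \<in> cube U \<inter> W"
        using calculation TI V(3) by (auto simp: PiE_iff subset_iff)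
      ultimately show "z \<in> product_coords m F \<phi> ` (cube U \<inter> W)" by blast
    qed
  qed
qed

lemma preimage_product_coords_open:
  assumes c: "chart_family U \<phi>" and V: "openin (Euclidean_space (mdim M)) V"
  shows "openin (mtop M) {q \<in> cube U. product_coords m F \<phi> q \<in> V}"
proof (subst openin_subopen, intro ballI)
  fix q assume "q \<in> {q \<in> cube U. product_coords m F \<phi> q \<in> V}"
  then obtain t x where q: "q = (t, x)" "(t, x) \<in> cube U" "product_coords m F \<phi> (t, x) \<in> V" by (cases q) auto
  define y where "y = product_coords m F \<phi> (t, x)"
  obtain e where e: "e > 0" "\<And>z. (\<And>i. i \<ge> mdim M \<Longrightarrow> z i = 0) \<Longrightarrow> (\<And>i. i < mdim M \<Longrightarrow> \<bar>z i - y i\<bar> < e) \<Longrightarrow> z \<in> V"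
    using openin_Euclidean_space_box[OF V q(3)] unfolding y_def by blast
  \<comment> \<open>Cubes of the same radius \<open>e\<close> in all factors; with the time interval
    of that radius they control every product coordinate.\<close>
  define N where "N i = {z \<in> U i. \<phi> i z \<in> {w. (\<forall>k\<ge>mdim (F i). w k = 0) \<and> (\<forall>k<mdim (F i). \<bar>w k - \<phi> i (x i) k\<bar> < e)}}" for i
  have xU: "x i \<in> U i" if "i \<in> {1..m}" for i using q(2) that by auto
  have N: "openin (mtop (F i)) (N i)" if i: "i \<in> {1..m}" for i
    unfolding N_def by (rule smooth_atlas.chart_preimage_open[OF F[OF i] chart_familyD[OF c i]
        openin_Euclidean_boxI]) (rule chart_zero[OF i chart_familyD[OF c i] xU[OF i]])
  have T: "openin (top_of_set I) (I \<inter> {t - e<..<t + e})" by (simp add: openin_open_Int)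
  show "\<exists>T. openin (mtop M) T \<and> q \<in> T \<and> T \<subseteq> {q \<in> cube U. product_coords m F \<phi> q \<in> V}"
  proof (intro exI conjI)
    show "openin (mtop M) ((I \<inter> {t - e<..<t + e}) \<times> Pi\<^sub>E {1..m} N)" by (rule openin_M_box[OF T N])
    show "q \<in> (I \<inter> {t - e<..<t + e}) \<times> Pi\<^sub>E {1..m} N"
    proof -
      have "x i \<in> N i" if i: "i \<in> {1..m}" for i
        using e(1) chart_zero[OF i chart_familyD[OF c i] xU[OF i]] xU[OF i] by (simp add: N_def)
      then show ?thesis using q e(1) by (auto simp: PiE_iff)
    qed
    show "(I \<inter> {t - e<..<t + e}) \<times> Pi\<^sub>E {1..m} N \<subseteq> {q \<in> cube U. product_coords m F \<phi> q \<in> V}"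
    proof clarify
      fix s z assume s: "s \<in> I" "s \<in> {t - e<..<t + e}" and z: "z \<in> Pi\<^sub>E {1..m} N"
      have "product_coords m F \<phi> (s, z) \<in> V"
      proof (rule e(2))
        show "product_coords m F \<phi> (s, z) i = 0" if "i \<ge> mdim M" for i by (rule product_coords_eq_0[OF that])
        fix k assume "k < mdim M"
        then show "\<bar>product_coords m F \<phi> (s, z) k - y k\<bar> < e"
        proof (cases rule: coord_index_cases)
          case 1
          then show ?thesis using s by (simp add: y_def product_coords_0 abs_less_iff)
        next
          case (2 i j)
          have "z i \<in> N i" using z 2 by auto
          then show ?thesis using 2 by (simp add: y_def product_coords_offset N_def)
        qed
      qed
      then show "(s, z) \<in> cube U \<and> product_coords m F \<phi> (s, z) \<in> V"
        using s z by (auto simp: N_def PiE_iff)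
    qed
  qed
qed

lemma Cinf_on_slice:
  assumes V: "openin (Euclidean_space (mdim M)) V" and A: "openin (Euclidean_space (mdim (F i))) A"
    and sub: "\<And>y. y \<in> V \<Longrightarrow> slice i y \<in> A" and f: "Cinf_on (mdim (F i)) A f"
  shows "Cinf_on (mdim M) V (\<lambda>y. f (slice i y))"
  by (rule Cinf_on_compose[OF V A _ _ f]) (use sub in \<open>auto simp: slice_def Cinf_on_coord[OF V]\<close>)

text \<open>Each component of a transition map is the time coordinate or a transition function of a
  single factor, applied to the slice of that factor.\<close>

lemma transition_product_coords:
  assumes c: "chart_family U \<phi>" and c': "chart_family U' \<psi>" and k: "k < mdim M"
  shows "Cinf_on (mdim M) (product_coords m F \<phi> ` (cube U \<inter> cube U'))
    (\<lambda>y. product_coords m F \<psi> (inv_into (cube U) (product_coords m F \<phi>) y) k)"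
proof -
  have oU': "openin (mtop M) (cube U')"
    by (rule openin_M_box[OF _ chart_family_open[OF c']]) simp
  note V = image_product_coords_open[OF c oU']
  from k show ?thesis
  proof (cases rule: coord_index_cases)
    case 1
    show ?thesis unfolding 1
      by (rule Cinf_on_cong[OF V _ Cinf_on_coord[OF V, of 0]])
        (use inv_product_coords[OF c] in \<open>auto simp: product_coords_0\<close>)
  next
    case (2 i j)
    interpret Fi: smooth_atlas "F i" by (rule F[OF 2(1)])
    note ci = chart_familyD[OF c 2(1)] and ci' = chart_familyD[OF c' 2(1)]
    have "Cinf_on (mdim M) (product_coords m F \<phi> ` (cube U \<inter> cube U'))
        (\<lambda>y. \<psi> i (inv_into (U i) (\<phi> i) (slice i y)) j)"
    proof (rule Cinf_on_slice[OF V Fi.chart_image_open[OF ci Fi.chart_open[OF ci']] _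
          Fi.chart_transition[OF ci ci' 2(2)]])
      fix y assume "y \<in> product_coords m F \<phi> ` (cube U \<inter> cube U')"
      then obtain q where q: "q \<in> cube U" "q \<in> cube U'" "y = product_coords m F \<phi> q" by blast
      have "snd q i \<in> U i \<inter> U' i" using q 2(1) by auto
      then show "slice i y \<in> \<phi> i ` (U i \<inter> U' i)" using slice_product_coords[OF c q(1) 2(1)] q(3) by simp
    qed
    then show ?thesis
    proof (rule Cinf_on_cong[OF V, rotated])
      fix y assume "y \<in> product_coords m F \<phi> ` (cube U \<inter> cube U')"
      then obtain q where q: "q \<in> cube U" "q \<in> cube U'" "y = product_coords m F \<phi> q" by blast
      have "snd q i \<in> U i" using q 2(1) by auto
      then show "\<psi> i (inv_into (U i) (\<phi> i) (slice i y)) j =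
          product_coords m F \<psi> (inv_into (cube U) (product_coords m F \<phi>) y) k"
        using slice_product_coords[OF c q(1) 2(1)] inv_product_coords[OF c q(1)] Fi.chart_inv[OF ci]
        by (simp add: q(3) 2(3) product_coords_offset[OF 2(1,2)])
    qed
  qed
qed

lemma chart_family_cover:
  assumes p: "(t, x) \<in> points M"
  obtains U \<phi> where "chart_family U \<phi>" "(t, x) \<in> cube U"
proof -
  have "\<exists>U \<phi>. (U, \<phi>) \<in> charts (F i) \<and> x i \<in> U" if i: "i \<in> {1..m}" for i
    by (rule smooth_atlas.chart_cover[OF F[OF i]]) (use p i in \<open>auto simp: in_points_M\<close>)
  then obtain U \<phi> where "\<And>i. i \<in> {1..m} \<Longrightarrow> (U i, \<phi> i) \<in> charts (F i) \<and> x i \<in> U i" by metis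
  then show thesis using p by (intro that[of U \<phi>]) (auto simp: chart_family_def in_points_M PiE_iff)
qed

sublocale M: smooth_atlas "M"
proof
  show "\<exists>U \<phi>. (U, \<phi>) \<in> charts M \<and> p \<in> U" if "p \<in> points M" for p
    using chart_family_cover[of "fst p" "snd p"] charts_MI that by (metis prod.collapse)
  fix U \<phi> assume "(U, \<phi>) \<in> charts M"
  then obtain V \<psi> where c: "chart_family V \<psi>" "U = cube V" "\<phi> = product_coords m F \<psi>"
    unfolding charts_M by blast
  show "openin (mtop M) U" unfolding c
    by (rule openin_M_box[OF _ chart_family_open[OF c(1)]]) simp
  show "inj_on \<phi> U" unfolding c by (rule inj_on_product_coords[OF c(1)])
  show "openin (Euclidean_space (mdim M)) (\<phi> ` (U \<inter> W))" if "openin (mtop M) W" for W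
    unfolding c by (rule image_product_coords_open[OF c(1) that])
  show "openin (mtop M) {q \<in> U. \<phi> q \<in> A}" if "openin (Euclidean_space (mdim M)) A" for A
    unfolding c by (rule preimage_product_coords_open[OF c(1) that])
  fix U' \<phi>' k assume "(U', \<phi>') \<in> charts M" and k: "k < mdim M"
  then obtain V' \<psi>' where c': "chart_family V' \<psi>'" "U' = cube V'" "\<phi>' = product_coords m F \<psi>'"
    unfolding charts_M by blast
  show "Cinf_on (mdim M) (\<phi> ` (U \<inter> U')) (\<lambda>x. \<phi>' (inv_into U \<phi> x) k)"
    unfolding c c' by (rule transition_product_coords[OF c(1) c'(1) k])
qed


section \<open>Smooth functions and tangent vectors on the product\<close>

definition cylinder :: "nat \<Rightarrow> 'a set \<Rightarrow> (real \<times> (nat \<Rightarrow> 'a)) set" where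
  "cylinder i W = {q \<in> points M. snd q i \<in> W}"

lemma openin_cylinder:
  assumes i: "i \<in> {1..m}" and W: "openin (mtop (F i)) W"
  shows "openin (mtop M) (cylinder i W)"
proof -
  have "cylinder i W = I \<times> Pi\<^sub>E {1..m} (\<lambda>j. if j = i then W else points (F j))"
    using i openin_subset[OF W] by (auto simp: cylinder_def points_M PiE_iff subset_iff split: if_splits)
  moreover have "openin (mtop M) (I \<times> Pi\<^sub>E {1..m} (\<lambda>j. if j = i then W else points (F j)))"
    by (rule openin_M_box) (use W in auto)
  ultimately show ?thesis by simp
qed

lemma smooth_on_factor:
  assumes i: "i \<in> {1..m}" and W: "openin (mtop (F i)) W" and f: "smooth_on (F i) W f"
  shows "smooth_on M (cylinder i W) (\<lambda>q. f (snd q i))"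
proof (rule M.smooth_onI)
  fix U' \<phi>' assume "(U', \<phi>') \<in> charts M"
  then obtain U \<phi> where c: "chart_family U \<phi>" "U' = cube U" "\<phi>' = product_coords m F \<phi>"
    unfolding charts_M by blast
  interpret Fi: smooth_atlas "F i" by (rule F[OF i])
  note ci = chart_familyD[OF c(1) i]
  note V = image_product_coords_open[OF c(1) openin_cylinder[OF i W]]
  have q: "\<exists>q. q \<in> cube U \<and> snd q i \<in> U i \<inter> W \<and> y = product_coords m F \<phi> q"
    if "y \<in> product_coords m F \<phi> ` (cube U \<inter> cylinder i W)" for y
  proof -
    from that obtain q where "q \<in> cube U" "q \<in> cylinder i W" "y = product_coords m F \<phi> q" by blast
    moreover have "snd q i \<in> U i" using \<open>q \<in> cube U\<close> i by auto
    ultimately show ?thesis by (intro exI[of _ q]) (simp add: cylinder_def)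
  qed
  have "Cinf_on (mdim M) (product_coords m F \<phi> ` (cube U \<inter> cylinder i W)) (\<lambda>y. f (inv_into (U i) (\<phi> i) (slice i y)))"
  proof (rule Cinf_on_slice[OF V Fi.chart_image_open[OF ci W] _ Fi.smooth_onD[OF f ci]])
    fix y assume "y \<in> product_coords m F \<phi> ` (cube U \<inter> cylinder i W)"
    from q[OF this] show "slice i y \<in> \<phi> i ` (U i \<inter> W)"
      using slice_product_coords[OF c(1) _ i] by (metis image_eqI)
  qed
  then show "Cinf_on (mdim M) (\<phi>' ` (U' \<inter> cylinder i W)) (\<lambda>y. f (snd (inv_into U' \<phi>' y) i))"
    unfolding c
  proof (rule Cinf_on_cong[OF V, rotated])
    fix y assume "y \<in> product_coords m F \<phi> ` (cube U \<inter> cylinder i W)"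
    from q[OF this] show "f (inv_into (U i) (\<phi> i) (slice i y)) =
        f (snd (inv_into (cube U) (product_coords m F \<phi>) y) i)"
      using slice_product_coords[OF c(1) _ i] inv_product_coords[OF c(1)] Fi.chart_inv[OF ci] by fastforce
  qed
qed

lemma smooth_at_factor:
  assumes i: "i \<in> {1..m}" and p: "(t, x) \<in> points M" and f: "smooth_at (F i) (x i) f"
  shows "smooth_at M (t, x) (\<lambda>q. f (snd q i))"
proof -
  obtain W where W: "openin (mtop (F i)) W" "x i \<in> W" "smooth_on (F i) W f"
    using f unfolding smooth_at_def by blast
  show ?thesis
    by (rule M.smooth_atI[OF openin_cylinder[OF i W(1)] _ smooth_on_factor[OF i W(1,3)]])
      (use p W(2) in \<open>simp add: cylinder_def\<close>)
qed

text \<open>Derivatives of \<beta> are included because the derivatives of the warping functions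
  enter the connection.\<close>

lemma smooth_on_time:
  assumes "\<And>k. (deriv ^^ k) \<beta> differentiable_on I"
  shows "smooth_on M (points M) (\<lambda>q. (deriv ^^ l) \<beta> (fst q))"
proof (rule M.smooth_onI)
  fix U' \<phi>' assume cM: "(U', \<phi>') \<in> charts M"
  then obtain U \<phi> where c: "chart_family U \<phi>" "U' = cube U" "\<phi>' = product_coords m F \<phi>"
    unfolding charts_M by blast
  note V = M.chart_image_open[OF cM openin_topspace]
  have fi: "y 0 = fst (inv_into U' \<phi>' y) \<and> y 0 \<in> I" if "y \<in> \<phi>' ` (U' \<inter> points M)" for y
    using that M.chart_inv[OF cM] c(2) by (auto simp: c(3) product_coords_0)
  have "Cinf_on (mdim M) (\<phi>' ` (U' \<inter> points M)) (\<lambda>y. (deriv ^^ l) \<beta> (y 0))"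
    unfolding Cinf_on_def
    by (intro allI Ck_on_real_function[OF V _ _ open_I assms]) (use fi in \<open>auto simp: mdim_M\<close>)
  then show "Cinf_on (mdim M) (\<phi>' ` (U' \<inter> points M)) (\<lambda>y. (deriv ^^ l) \<beta> (fst (inv_into U' \<phi>' y)))"
    by (rule Cinf_on_cong[OF V, rotated]) (use fi in simp)
qed

lemma smooth_on_fst: "smooth_on M (points M) fst"
proof -
  have d: "(deriv ^^ k) (\<lambda>t :: real. t) differentiable_on I" for k
  proof -
    have "(deriv ^^ k) (\<lambda>t :: real. t) = (\<lambda>t. t) \<or> (\<exists>c. (deriv ^^ k) (\<lambda>t :: real. t) = (\<lambda>t. c))"
    proof (induction k)
      case (Suc k)
      have "f = (\<lambda>t. t) \<or> (\<exists>c. f = (\<lambda>t. c)) \<Longrightarrow> (\<exists>c. deriv f = (\<lambda>t. c))" for f :: "real \<Rightarrow> real"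
        by auto
      from this[OF Suc] show ?case by simp
    qed simp
    then show ?thesis by (elim disjE exE) (simp_all add: differentiable_on_ident)
  qed
  have "smooth_on M (points M) (\<lambda>q. (deriv ^^ 0) (\<lambda>t. t) (fst q))" by (rule smooth_on_time[OF d])
  then show ?thesis by simp
qed

lemma fun_upd_in_points:
  assumes "(t, x) \<in> points M" "r \<in> {1..m}" "q \<in> points (F r)"
  shows "(t, x(r := q)) \<in> points M"
  using assms by (auto simp: in_points_M PiE_iff extensional_def)

text \<open>In charts the inclusion of the slice through \<open>(t, x)\<close> is constant in the
  time coordinate and in the blocks of the other factors, and the identity in block
  \<open>r\<close>.\<close>

lemma smooth_on_slice_inclusion:
  assumes p: "(t, x) \<in> points M" and r: "r \<in> {1..m}" and W: "openin (mtop M) W" and f: "smooth_on M W f"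
  defines "W' \<equiv> {q \<in> points (F r). (t, x(r := q)) \<in> W}"
  shows "openin (mtop (F r)) W'" and "smooth_on (F r) W' (\<lambda>q. f (t, x(r := q)))"
proof -
  interpret Fr: smooth_atlas "F r" by (rule F[OF r])
  show W': "openin (mtop (F r)) W'"
  proof (subst openin_subopen, intro ballI)
    fix q assume "q \<in> W'"
    then have q: "q \<in> points (F r)" "(t, x(r := q)) \<in> W" by (auto simp: W'_def)
    obtain T V where T: "openin (top_of_set I) T" "t \<in> T" and V: "\<And>i. i \<in> {1..m} \<Longrightarrow> openin (mtop (F i)) (V i)"
      "\<And>i. i \<in> {1..m} \<Longrightarrow> (x(r := q)) i \<in> V i" "T \<times> Pi\<^sub>E {1..m} V \<subseteq> W"
      using openin_M_basis[OF W q(2)] by blast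
    have "V r \<subseteq> W'"
    proof
      fix z assume z: "z \<in> V r"
      have "(x(r := z)) i \<in> V i" if "i \<in> {1..m}" for i
        using V(2)[OF that] z by (cases "i = r") auto
      then have "(t, x(r := z)) \<in> T \<times> Pi\<^sub>E {1..m} V"
        using T(2) fun_upd_in_points[OF p r] z Fr.openin_points[OF V(1)[OF r]]
        by (auto simp: in_points_M PiE_iff simp del: fun_upd_apply)
      then show "z \<in> W'" using V(3) z Fr.openin_points[OF V(1)[OF r]] by (auto simp: W'_def)
    qed
    then show "\<exists>T. openin (mtop (F r)) T \<and> q \<in> T \<and> T \<subseteq> W'"
      using V(1,2)[OF r] by (intro exI[of _ "V r"]) auto
  qed
  show "smooth_on (F r) W' (\<lambda>q. f (t, x(r := q)))"
  proof (rule Fr.smooth_onI)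
    fix Ur \<phi>r assume cr: "(Ur, \<phi>r) \<in> charts (F r)"
    obtain U \<phi> where c: "chart_family U \<phi>" "(t, x) \<in> cube U" using chart_family_cover[OF p] .
    \<comment> \<open>The given family of charts covers \<open>x r\<close> but perhaps not the rest
      of the slice; with its member number \<open>r\<close> replaced by \<open>Ur\<close> it covers
      the slice over \<open>Ur\<close>.\<close>
    define U' where "U' = U(r := Ur)"
    define \<phi>' where "\<phi>' = \<phi>(r := \<phi>r)"
    have c': "chart_family U' \<phi>'" using c(1) cr by (auto simp: chart_family_def U'_def \<phi>'_def)
    define \<Phi> where "\<Phi> = product_coords m F \<phi>'"
    have inbox: "(t, x(r := q)) \<in> cube U'" if "q \<in> Ur" for q
      using c(2) that r by (auto simp: U'_def PiE_iff extensional_def)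
    define G where "G y = \<Phi> (t, x(r := inv_into Ur \<phi>r y))" for y
    note V = Fr.chart_image_open[OF cr W']
    have "Cinf_on (mdim (F r)) (\<phi>r ` (Ur \<inter> W')) (\<lambda>y. f (inv_into (cube U') \<Phi> (G y)))"
    proof (rule Cinf_on_compose[OF V M.chart_image_open[OF charts_MI[OF c'] W, folded \<Phi>_def] _ _
          M.smooth_onD[OF f charts_MI[OF c'], folded \<Phi>_def]])
      show "G ` \<phi>r ` (Ur \<inter> W') \<subseteq> \<Phi> ` (cube U' \<inter> W)"
      proof clarify
        fix q assume "q \<in> Ur" "q \<in> W'"
        then show "G (\<phi>r q) \<in> \<Phi> ` (cube U' \<inter> W)"
          unfolding G_def Fr.chart_inv[OF cr \<open>q \<in> Ur\<close>] using inbox by (simp add: W'_def)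
      qed
      fix k assume "k < mdim M"
      then show "Cinf_on (mdim (F r)) (\<phi>r ` (Ur \<inter> W')) (\<lambda>y. G y k)"
      proof (cases rule: coord_index_cases)
        case 1
        then show ?thesis by (simp add: G_def \<Phi>_def product_coords_0 Cinf_on_const)
      next
        case (2 i j)
        show ?thesis
        proof (cases "i = r")
          case True
          show ?thesis
            by (rule Cinf_on_cong[OF V _ Cinf_on_coord[OF V, of j]])
              (use 2 True in \<open>auto simp: G_def \<Phi>_def product_coords_offset \<phi>'_def f_inv_into_f\<close>)
        next
          case False
          then show ?thesis using 2 by (simp add: G_def \<Phi>_def product_coords_offset \<phi>'_def Cinf_on_const)
        qed
      qed
    qed
    then show "Cinf_on (mdim (F r)) (\<phi>r ` (Ur \<inter> W')) (\<lambda>y. f (t, x(r := inv_into Ur \<phi>r y)))"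
    proof (rule Cinf_on_cong[OF V, rotated])
      fix y assume "y \<in> \<phi>r ` (Ur \<inter> W')"
      then have "inv_into Ur \<phi>r y \<in> Ur" using Fr.chart_inv_in[OF cr] by blast
      from inv_product_coords[OF c' inbox[OF this]]
      show "f (inv_into (cube U') \<Phi> (G y)) = f (t, x(r := inv_into Ur \<phi>r y))"
        by (simp add: G_def \<Phi>_def)
    qed
  qed
qed

lemma smooth_at_slice_inclusion:
  assumes p: "(t, x) \<in> points M" and r: "r \<in> {1..m}" and f: "smooth_at M (t, x) f"
  shows "smooth_at (F r) (x r) (\<lambda>q. f (t, x(r := q)))"
proof -
  obtain W where W: "openin (mtop M) W" "(t, x) \<in> W" "smooth_on M W f"
    using f unfolding smooth_at_def by blast
  show ?thesis
    by (rule smooth_atlas.smooth_atI[OF F[OF r] smooth_on_slice_inclusion(1)[OF p r W(1,3)] _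
          smooth_on_slice_inclusion(2)[OF p r W(1,3)]])
      (use p r W(2) in \<open>auto simp: in_points_M\<close>)
qed

end


section \<open>Projections, inclusions of slices and the time field\<close>

context interval_product begin

abbreviation push :: "nat \<Rightarrow> real \<times> (nat \<Rightarrow> 'a) \<Rightarrow> (real \<times> (nat \<Rightarrow> 'a)) tangent \<Rightarrow> 'a tangent" where
  "push i q u \<equiv> pushforward (F i) (snd q i) (\<lambda>p. snd p i) u"

definition incl :: "nat \<Rightarrow> real \<times> (nat \<Rightarrow> 'a) \<Rightarrow> 'a tangent \<Rightarrow> (real \<times> (nat \<Rightarrow> 'a)) tangent" where
  "incl r q v = pushforward M q (\<lambda>z. (fst q, (snd q)(r := z))) v"

text \<open>The coordinate field d/dt, written without a chart; as for every tangent vector, its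
  value at functions that are not smooth at \<open>q\<close> is 0.\<close>

definition dt :: "(real \<times> (nat \<Rightarrow> 'a)) vfield" where
  "dt q f = (if smooth_at M q f then deriv (\<lambda>s. f (s, snd q)) (fst q) else 0)"

abbreviation "lift \<equiv> lift_field M"

lemma lift_eq: "lift r X q = incl r q (X (snd q r))"
  by (cases q) (simp add: lift_field_def incl_def)

lemma snd_in_points: "q \<in> points M \<Longrightarrow> i \<in> {1..m} \<Longrightarrow> snd q i \<in> points (F i)"
  by (cases q) (auto simp: in_points_M)

lemma smooth_at_factor': "i \<in> {1..m} \<Longrightarrow> q \<in> points M \<Longrightarrow> smooth_at (F i) (snd q i) f \<Longrightarrow>
    smooth_at M q (\<lambda>q. f (snd q i))"
  using smooth_at_factor[of i "fst q" "snd q" f] by simp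

lemma smooth_at_slice': "r \<in> {1..m} \<Longrightarrow> q \<in> points M \<Longrightarrow> smooth_at M q f \<Longrightarrow>
    smooth_at (F r) (snd q r) (\<lambda>z. f (fst q, (snd q)(r := z)))"
  using smooth_at_slice_inclusion[of "fst q" "snd q" r f] by simp

lemma tangent_factor: "smooth_at (F i) (snd q i) f \<Longrightarrow> u (\<lambda>p. f (snd p i)) = push i q u f"
  by (simp add: pushforward_def)

lemma push_tangent:
  assumes i: "i \<in> {1..m}" and q: "q \<in> points M" and u: "u \<in> tangent_space M q"
  shows "push i q u \<in> tangent_space (F i) (snd q i)"
proof -
  interpret Fi: smooth_atlas "F i" by (rule F[OF i])
  note s = smooth_at_factor'[OF i q]
  show ?thesis
    unfolding tangent_space_def
  proof (intro CollectI conjI allI impI)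
    fix f h c assume f: "smooth_at (F i) (snd q i) f"
    show "push i q u (\<lambda>z. c * f z) = c * push i q u f"
      using M.tangent_cmult[OF u s[OF f]] f
        Fi.smooth_at_mult[OF Fi.smooth_at_const[OF snd_in_points[OF q i]] f]
      by (simp add: pushforward_def)
    assume h: "smooth_at (F i) (snd q i) h"
    show "push i q u (\<lambda>z. f z + h z) = push i q u f + push i q u h"
      using M.tangent_add[OF u s[OF f] s[OF h]] f h Fi.smooth_at_add[OF f h] by (simp add: pushforward_def)
    show "push i q u (\<lambda>z. f z * h z) = f (snd q i) * push i q u h + push i q u f * h (snd q i)"
      using M.tangent_mult[OF u s[OF f] s[OF h]] f h Fi.smooth_at_mult[OF f h] by (simp add: pushforward_def)
  qed (simp add: pushforward_def)
qed

lemma incl_tangent: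
  assumes r: "r \<in> {1..m}" and q: "q \<in> points M" and v: "v \<in> tangent_space (F r) (snd q r)"
  shows "incl r q v \<in> tangent_space M q"
proof -
  interpret Fr: smooth_atlas "F r" by (rule F[OF r])
  note s = smooth_at_slice'[OF r q]
  show ?thesis
    unfolding tangent_space_def incl_def
  proof (intro CollectI conjI allI impI, goal_cases)
    case (1 f h)
    then show ?case using Fr.tangent_add[OF v s[OF 1(1)] s[OF 1(2)]] M.smooth_at_add[OF 1]
      by (simp add: pushforward_def)
  next
    case (2 c f)
    then show ?case using Fr.tangent_cmult[OF v s[OF 2]] M.smooth_at_mult[OF M.smooth_at_const[OF q] 2]
      by (simp add: pushforward_def)
  next
    case (3 f h)
    then show ?case using Fr.tangent_mult[OF v s[OF 3(1)] s[OF 3(2)]] M.smooth_at_mult[OF 3]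
      by (simp add: pushforward_def)
  next
    case (4 f)
    then show ?case by (simp add: pushforward_def)
  qed
qed

lemma smooth_at_fst: "q \<in> points M \<Longrightarrow> smooth_at M q fst"
  by (rule M.smooth_atI[OF openin_topspace _ smooth_on_fst])

lemma incl_time:
  assumes r: "r \<in> {1..m}" and q: "q \<in> points M" and v: "v \<in> tangent_space (F r) (snd q r)"
  shows "incl r q v (\<lambda>p. \<beta> (fst p)) = 0"
  using smooth_atlas.tangent_const[OF F[OF r] v snd_in_points[OF q r]]
  by (simp add: incl_def pushforward_def)

lemma incl_fst:
  assumes r: "r \<in> {1..m}" and q: "q \<in> points M" and v: "v \<in> tangent_space (F r) (snd q r)"
  shows "incl r q v fst = 0"
  using incl_time[OF assms, of "\<lambda>t. t"] by simp

lemma push_incl: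
  assumes i: "i \<in> {1..m}" and r: "r \<in> {1..m}" and q: "q \<in> points M" and v: "v \<in> tangent_space (F r) (snd q r)"
  shows "push i q (incl r q v) = (if i = r then v else (\<lambda>f. 0))"
proof
  fix f
  show "push i q (incl r q v) f = (if i = r then v else (\<lambda>f. 0)) f"
  proof (cases "smooth_at (F i) (snd q i) f")
    case True
    then show ?thesis
      using smooth_at_factor'[OF i q True] smooth_atlas.tangent_const[OF F[OF r] v snd_in_points[OF q r]]
      by (simp add: pushforward_def incl_def)
  next
    case False
    then show ?thesis using smooth_atlas.tangent_not_smooth[OF F[OF r] v]
      by (cases "i = r") (simp_all add: pushforward_def)
  qed
qed

text \<open>A coordinate function of a product chart is \<open>fst\<close> or factors through the
  projection to one factor, so the hypotheses fix the values on all coordinate functions.\<close>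

lemma tangent_M_eqI:
  assumes q: "q \<in> points M" and u: "u \<in> tangent_space M q" and v: "v \<in> tangent_space M q"
    and t: "u fst = v fst" and p: "\<And>i. i \<in> {1..m} \<Longrightarrow> push i q u = push i q v"
  shows "u = v"
proof -
  obtain U \<phi> where c: "chart_family U \<phi>" "q \<in> cube U"
    using chart_family_cover[of "fst q" "snd q"] q by auto
  show ?thesis
  proof (rule M.tangent_chart_eqI[OF u v charts_MI[OF c(1)] c(2)])
    fix k assume "k < mdim M"
    then show "u (\<lambda>q. product_coords m F \<phi> q k) = v (\<lambda>q. product_coords m F \<phi> q k)"
    proof (cases rule: coord_index_cases)
      case 1
      have "(\<lambda>q. product_coords m F \<phi> q k) = fst" by (auto simp: 1 product_coords_0)
      then show ?thesis using t by simp
    next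
      case (2 i j)
      interpret Fi: smooth_atlas "F i" by (rule F[OF 2(1)])
      have ci: "(U i, \<phi> i) \<in> charts (F i)" "snd q i \<in> U i" using chart_familyD[OF c(1)] c(2) 2 by auto
      have s: "smooth_at (F i) (snd q i) (\<lambda>z. \<phi> i z j)"
        by (rule Fi.smooth_atI[OF Fi.chart_open[OF ci(1)] ci(2) Fi.smooth_on_coord[OF ci(1) 2(2)]])
      have "(\<lambda>q. product_coords m F \<phi> q k) = (\<lambda>q. \<phi> i (snd q i) j)"
        unfolding 2(3) using product_coords_offset[OF 2(1,2)] by blast
      then show ?thesis using p[OF 2(1)] tangent_factor[OF s, of u] tangent_factor[OF s, of v] by simp
    qed
  qed
qed

lemma dt_coord_field:
  assumes c: "chart_family U \<phi>" and q: "q \<in> cube U"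
  shows "dt q = M.coord_field (cube U) (product_coords m F \<phi>) 0 q"
proof
  fix f
  obtain t x where tx: "q = (t, x)" by (cases q)
  have upd: "(product_coords m F \<phi> (t, x))(0 := s) = product_coords m F \<phi> (s, x)" for s
  proof
    fix k
    show "((product_coords m F \<phi> (t, x))(0 := s)) k = product_coords m F \<phi> (s, x) k"
    proof (cases "k < mdim M")
      case True
      then show ?thesis
      proof (cases rule: coord_index_cases)
        case 1
        then show ?thesis by (simp add: product_coords_0)
      next
        case (2 i j)
        have "k \<noteq> 0" using offset_index(2)[OF 2(1,2)] 2(3) by simp
        then have "((product_coords m F \<phi> (t, x))(0 := s)) k = product_coords m F \<phi> (t, x) k" by simp
        then show ?thesis unfolding 2(3) product_coords_offset[OF 2(1,2)] by simp
      qed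
    next
      case False
      then have "k \<noteq> 0" by (simp add: mdim_M)
      then show ?thesis using False by (simp add: product_coords_eq_0)
    qed
  qed
  have "deriv (\<lambda>s. f (s, x)) t =
      deriv (\<lambda>s. f (inv_into (cube U) (product_coords m F \<phi>) ((product_coords m F \<phi> (t, x))(0 := s)))) t"
  proof (rule deriv_cong_ev[OF _ refl])
    have "eventually (\<lambda>s. s \<in> I) (nhds t)"
      using open_I q tx by (auto intro: eventually_nhds_in_open)
    then show "eventually (\<lambda>s. f (s, x) =
        f (inv_into (cube U) (product_coords m F \<phi>) ((product_coords m F \<phi> (t, x))(0 := s)))) (nhds t)"
    proof eventually_elim
      case (elim s)
      then have "(s, x) \<in> cube U" using q tx by auto
      then show ?case unfolding upd using inv_product_coords[OF c] by simp
    qed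
  qed
  then show "dt q f = M.coord_field (cube U) (product_coords m F \<phi>) 0 q f"
    by (simp add: dt_def M.coord_field_def partial_def tx product_coords_0 del: fun_upd_apply)
qed

lemma vector_field_dt: "vector_field M (points M) dt"
proof (rule M.vector_field_local)
  fix q assume "q \<in> points M"
  then obtain U \<phi> where c: "chart_family U \<phi>" "q \<in> cube U"
    using chart_family_cover[of "fst q" "snd q"] by auto
  have "vector_field M (cube U) dt"
    by (rule M.vector_field_cong[OF M.vector_field_coord_field[OF charts_MI[OF c(1)], of 0]])
      (use dt_coord_field[OF c(1)] in \<open>auto simp: mdim_M\<close>)
  then show "\<exists>W. openin (mtop M) W \<and> q \<in> W \<and> vector_field M W dt"
    using c(2) M.chart_open[OF charts_MI[OF c(1)]] by blast
qed

lemma dt_tangent: "q \<in> points M \<Longrightarrow> dt q \<in> tangent_space M q"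
  using M.vector_field_tangent[OF vector_field_dt] .

lemma dt_fst: "q \<in> points M \<Longrightarrow> dt q fst = 1"
  using smooth_at_fst by (simp add: dt_def)

lemma push_dt: "push i q (dt q) = (\<lambda>f. 0)"
  by (auto simp: pushforward_def dt_def)

lemma offset_inj:
  assumes "i \<in> {1..m}" "i' \<in> {1..m}" "j < mdim (F i)" "j' < mdim (F i')" "off i + j = off i' + j'"
  shows "i = i' \<and> j = j'"
  using offset_le[of i i'] offset_le[of i' i] assms by (cases i i' rule: linorder_cases) auto

text \<open>In a product chart the lift is the combination \<open>Y\<close> of the coordinate fields
  of block \<open>r\<close>. Its coefficients are the components of \<open>X\<close> composed with
  the projection, and these are smooth.\<close>

lemma vector_field_lift:
  assumes r: "r \<in> {1..m}" and W: "openin (mtop (F r)) W" and X: "vector_field (F r) W X"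
  shows "vector_field M (cylinder r W) (lift r X)"
proof (rule M.vector_field_local)
  interpret Fr: smooth_atlas "F r" by (rule F[OF r])
  fix p assume p: "p \<in> cylinder r W"
  then have pM: "p \<in> points M" by (simp add: cylinder_def)
  then obtain U \<phi> where c: "chart_family U \<phi>" "p \<in> cube U"
    using chart_family_cover[of "fst p" "snd p"] by auto
  note cM = charts_MI[OF c(1)] and cr = chart_familyD[OF c(1) r]
  define W' where "W' = cube U \<inter> cylinder r W"
  have W': "openin (mtop M) W'" "p \<in> W'" "W' \<subseteq> cube U" "W' \<subseteq> cylinder r (U r \<inter> W)"
    using M.chart_open[OF cM] openin_cylinder[OF r W] c(2) p r by (auto simp: W'_def cylinder_def)
  define Y where "Y q f = (\<Sum>k<mdim (F r). X (snd q r) (\<lambda>z. \<phi> r z k) *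
      M.coord_field (cube U) (product_coords m F \<phi>) (off r + k) q f)" for q f
  have UW: "openin (mtop (F r)) (U r \<inter> W)" using Fr.chart_open[OF cr] W by blast
  have sm: "smooth_on M W' (\<lambda>q. X (snd q r) (\<lambda>z. \<phi> r z k))" if "k < mdim (F r)" for k
  proof (rule M.smooth_on_subset[OF smooth_on_factor[OF r UW] W'(4)])
    show "smooth_on (F r) (U r \<inter> W) (\<lambda>z. X z (\<lambda>z. \<phi> r z k))"
      by (rule Fr.vector_field_smooth[OF X UW]) (use Fr.smooth_on_subset[OF Fr.smooth_on_coord[OF cr that]] in auto)
  qed
  have Y: "vector_field M W' Y"
    unfolding Y_def
    by (intro M.vector_field_sum W' M.vector_field_scale sm
        M.vector_field_subset[OF M.vector_field_coord_field[OF cM] W'(3)]) (auto simp: offset_index[OF r])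
  have "lift r X q = Y q" if q: "q \<in> W'" for q
  proof (rule M.tangent_chart_eqI[OF _ M.vector_field_tangent[OF Y q] cM subsetD[OF W'(3) q]])
    have qM: "q \<in> points M" and Xq: "X (snd q r) \<in> tangent_space (F r) (snd q r)" and qU: "q \<in> cube U"
      using q Fr.vector_field_tangent[OF X] by (auto simp: W'_def cylinder_def)
    show "lift r X q \<in> tangent_space M q" unfolding lift_eq by (rule incl_tangent[OF r qM Xq])
    fix l assume l: "l < mdim M"
    have Yl: "Y q (\<lambda>p. product_coords m F \<phi> p l) =
        (\<Sum>k<mdim (F r). X (snd q r) (\<lambda>z. \<phi> r z k) * (if l = off r + k then 1 else 0))"
      unfolding Y_def by (intro sum.cong refl)
        (use M.coord_field_coord[OF cM qU _ l] offset_index[OF r] in simp)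
    from l show "lift r X q (\<lambda>p. product_coords m F \<phi> p l) = Y q (\<lambda>p. product_coords m F \<phi> p l)"
    proof (cases rule: coord_index_cases)
      case 1
      have "(\<lambda>p. product_coords m F \<phi> p l) = fst" by (auto simp: 1 product_coords_0)
      moreover have "Y q (\<lambda>p. product_coords m F \<phi> p l) = 0"
        unfolding Yl by (rule sum.neutral) (simp add: 1 coord_offset_def)
      ultimately show ?thesis using incl_fst[OF r qM Xq] by (simp add: lift_eq)
    next
      case (2 i j)
      interpret Fi: smooth_atlas "F i" by (rule F[OF 2(1)])
      have ci: "(U i, \<phi> i) \<in> charts (F i)" "snd q i \<in> U i" using chart_familyD[OF c(1)] qU 2 by auto
      have s: "smooth_at (F i) (snd q i) (\<lambda>z. \<phi> i z j)"
        by (rule Fi.smooth_atI[OF Fi.chart_open[OF ci(1)] ci(2) Fi.smooth_on_coord[OF ci(1) 2(2)]])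
      have "(\<lambda>q. product_coords m F \<phi> q l) = (\<lambda>q. \<phi> i (snd q i) j)"
        unfolding 2(3) using product_coords_offset[OF 2(1,2)] by blast
      then have "lift r X q (\<lambda>p. product_coords m F \<phi> p l) = push i q (incl r q (X (snd q r))) (\<lambda>z. \<phi> i z j)"
        using tangent_factor[of i q "\<lambda>z. \<phi> i z j", OF s] by (simp add: lift_eq)
      also have "\<dots> = (if i = r then X (snd q r) (\<lambda>z. \<phi> r z j) else 0)"
        unfolding push_incl[OF 2(1) r qM Xq] by simp
      also have "\<dots> = (\<Sum>k<mdim (F r). if i = r \<and> k = j then X (snd q r) (\<lambda>z. \<phi> r z j) else 0)"
        using 2(2) by (cases "i = r") auto
      also have "\<dots> = Y q (\<lambda>p. product_coords m F \<phi> p l)"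
        unfolding Yl by (intro sum.cong refl) (use 2 r offset_inj[OF 2(1) r 2(2)] in auto)
      finally show ?thesis .
    qed
  qed
  then have "vector_field M W' (lift r X)" using M.vector_field_cong[OF Y] by simp
  then show "\<exists>W. openin (mtop M) W \<and> p \<in> W \<and> vector_field M W (lift r X)" using W' by blast
qed

end


section \<open>The warped metric\<close>

locale warped_product = interval_product I m F for I m and F :: "nat \<Rightarrow> 'a manifold" +
  fixes gF :: "nat \<Rightarrow> 'a metric" and b :: "nat \<Rightarrow> real \<Rightarrow> real"
  assumes gF: "\<And>i. i \<in> {1..m} \<Longrightarrow> metric_manifold (F i) (gF i)"
    and b_pos: "\<And>i t. i \<in> {1..m} \<Longrightarrow> t \<in> I \<Longrightarrow> b i t > 0"
    and b_smooth: "\<And>i k. i \<in> {1..m} \<Longrightarrow> (deriv ^^ k) (b i) differentiable_on I"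
begin

abbreviation "g \<equiv> warped_metric m F gF b"

lemma g_eq: "g q u v = - (u fst * v fst) +
    (\<Sum>i=1..m. (b i (fst q))\<^sup>2 * gF i (snd q i) (push i q u) (push i q v))"
  by (cases q) (simp add: warped_metric_def)

lemma fst_in_I: "q \<in> points M \<Longrightarrow> fst q \<in> I"
  by (cases q) (simp add: in_points_M)

lemma b_fst_pos: "q \<in> points M \<Longrightarrow> i \<in> {1..m} \<Longrightarrow> b i (fst q) > 0"
  using b_pos fst_in_I by blast

lemma smooth_on_b: "i \<in> {1..m} \<Longrightarrow> smooth_on M (points M) (\<lambda>q. b i (fst q))"
  using smooth_on_time[OF b_smooth, of i 0] by simp

lemma push_add: "push i q (\<lambda>f. u f + v f) = (\<lambda>f. push i q u f + push i q v f)"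
  by (auto simp: pushforward_def)

lemma push_cmult: "push i q (\<lambda>f. c * u f) = (\<lambda>f. c * push i q u f)"
  by (auto simp: pushforward_def)

lemma g_dt:
  assumes q: "q \<in> points M" and u: "u \<in> tangent_space M q"
  shows "g q u (dt q) = - u fst"
proof -
  have "gF i (snd q i) (push i q u) (push i q (dt q)) = 0" if i: "i \<in> {1..m}" for i
    unfolding push_dt
    by (rule metric_manifold.g_zero_right[OF gF[OF i] snd_in_points[OF q i] push_tangent[OF i q u]])
  then show ?thesis by (simp add: g_eq dt_fst[OF q])
qed

lemma g_incl:
  assumes q: "q \<in> points M" and u: "u \<in> tangent_space M q" and r: "r \<in> {1..m}"
    and v: "v \<in> tangent_space (F r) (snd q r)"
  shows "g q u (incl r q v) = (b r (fst q))\<^sup>2 * gF r (snd q r) (push r q u) v"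
proof -
  have "g q u (incl r q v) = (\<Sum>i=1..m. if i = r then (b r (fst q))\<^sup>2 * gF r (snd q r) (push r q u) v else 0)"
    unfolding g_eq incl_fst[OF r q v]
  proof (simp only: mult_zero_right minus_zero add_0_left, rule sum.cong[OF refl])
    fix i assume i: "i \<in> {1..m}"
    show "(b i (fst q))\<^sup>2 * gF i (snd q i) (push i q u) (push i q (incl r q v)) =
        (if i = r then (b r (fst q))\<^sup>2 * gF r (snd q r) (push r q u) v else 0)"
      unfolding push_incl[OF i r q v]
      using metric_manifold.g_zero_right[OF gF[OF i] snd_in_points[OF q i] push_tangent[OF i q u]] by simp
  qed
  then show ?thesis using r by simp
qed

text \<open>Nondegeneracy holds because pairing with dt detects the time component, and pairing with
  included vectors of factor \<open>i\<close> gives a positive multiple of the metric of that factor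
  on the projection.\<close>

sublocale M: metric_manifold M g
proof
  fix q u v assume q: "q \<in> points M" and u: "u \<in> tangent_space M q" and v: "v \<in> tangent_space M q"
  note pt = push_tangent[OF _ q]
  show "g q u v = g q v u"
    unfolding g_eq using metric_manifold.g_sym[OF gF snd_in_points[OF q] pt[OF _ u] pt[OF _ v]]
    by (simp add: mult.commute)
  show "g q (\<lambda>f. c * u f) v = c * g q u v" for c
    unfolding g_eq push_cmult
    using metric_manifold.g_cmult_left[OF gF snd_in_points[OF q] pt[OF _ u] pt[OF _ v]]
    by (simp add: sum_distrib_left algebra_simps)
  show "g q (\<lambda>f. u f + v f) w = g q u w + g q v w" if w: "w \<in> tangent_space M q" for w
    unfolding g_eq push_add
    using metric_manifold.g_add_left[OF gF snd_in_points[OF q] pt[OF _ u] pt[OF _ v] pt[OF _ w]]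
    by (simp add: sum.distrib algebra_simps)
next
  fix q u assume q: "q \<in> points M" and u: "u \<in> tangent_space M q"
    and z: "\<And>v. v \<in> tangent_space M q \<Longrightarrow> g q u v = 0"
  show "u = (\<lambda>f. 0)"
  proof (rule tangent_M_eqI[OF q u M.tangent_space_zero[OF q]])
    show "u fst = 0" using z[OF dt_tangent[OF q]] g_dt[OF q u] by simp
    fix i assume i: "i \<in> {1..m}"
    have "push i q u = (\<lambda>f. 0)"
    proof (rule metric_manifold.g_nondegenerate[OF gF[OF i] snd_in_points[OF q i] push_tangent[OF i q u]])
      fix v assume v: "v \<in> tangent_space (F i) (snd q i)"
      then show "gF i (snd q i) (push i q u) v = 0"
        using z[OF incl_tangent[OF i q v]] g_incl[OF q u i v] b_fst_pos[OF q i] by simp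
    qed
    then show "push i q u = push i q (\<lambda>f. 0)" by (auto simp: pushforward_def)
  qed
next
  fix W X Y assume W: "openin (mtop M) W" and X: "vector_field M W X" and Y: "vector_field M W Y"
  have WM: "W \<subseteq> points M" using openin_subset[OF W] .
  have fs: "smooth_on M W fst" using M.smooth_on_subset[OF smooth_on_fst WM] .
  \<comment> \<open>The projection of \<open>X\<close> to factor \<open>i\<close> varies with all of
    \<open>q\<close> and is no vector field on that factor. Both arguments are therefore expanded in
    coordinate fields of the factor, with coefficients that are smooth on the product.\<close>
  have "smooth_on M W (\<lambda>q. gF i (snd q i) (push i q (X q)) (push i q (Y q)))" if i: "i \<in> {1..m}" for i
  proof (rule M.smooth_on_local)
    interpret Fi: metric_manifold "F i" "gF i" by (rule gF[OF i])
    fix p assume p: "p \<in> W"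
    obtain U \<phi> where c: "(U, \<phi>) \<in> charts (F i)" "snd p i \<in> U"
      using Fi.chart_cover[OF snd_in_points[OF subsetD[OF WM p] i]] by blast
    define n where "n = mdim (F i)"
    define W' where "W' = W \<inter> cylinder i U"
    have W': "openin (mtop M) W'" "p \<in> W'" "W' \<subseteq> W" "W' \<subseteq> cylinder i U"
      using W openin_cylinder[OF i Fi.chart_open[OF c(1)]] p c(2) WM by (auto simp: W'_def cylinder_def)
    define e where "e k = Fi.coord_field U \<phi> k" for k
    have ev: "vector_field (F i) U (e k)" if "k < n" for k
      using Fi.vector_field_coord_field[OF c(1)] that by (simp add: e_def n_def)
    have cs: "smooth_on M W' (\<lambda>q. \<phi> (snd q i) k)" if "k < n" for k
      by (rule M.smooth_on_subset[OF smooth_on_factor[OF i Fi.chart_open[OF c(1)] Fi.smooth_on_coord[OF c(1)]] W'(4)])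
        (use that in \<open>simp add: n_def\<close>)
    have gs: "smooth_on M W' (\<lambda>q. gF i (snd q i) (e k (snd q i)) (e l (snd q i)))" if "k < n" "l < n" for k l
      by (rule M.smooth_on_subset[OF smooth_on_factor[OF i Fi.chart_open[OF c(1)]
            Fi.g_smooth[OF Fi.chart_open[OF c(1)] ev[OF that(1)] ev[OF that(2)]]] W'(4)])
    have S: "smooth_on M W' (\<lambda>q. \<Sum>k<n. X q (\<lambda>p. \<phi> (snd p i) k) * (\<Sum>l<n. Y q (\<lambda>p. \<phi> (snd p i) l) *
        gF i (snd q i) (e k (snd q i)) (e l (snd q i))))"
      by (intro M.smooth_on_sum M.smooth_on_mult W' gs M.vector_field_smooth[OF X] M.vector_field_smooth[OF Y] cs)
        auto
    have "smooth_on M W' (\<lambda>q. gF i (snd q i) (push i q (X q)) (push i q (Y q)))"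
    proof (rule M.smooth_on_cong[OF W'(1) _ S])
      fix q assume q: "q \<in> W'"
      have qM: "q \<in> points M" and qU: "snd q i \<in> U" and qW: "q \<in> W" using q WM by (auto simp: W'_def cylinder_def)
      note sM = snd_in_points[OF qM i]
      have ex: "push i q u = (\<lambda>f. \<Sum>k<n. u (\<lambda>p. \<phi> (snd p i) k) * e k (snd q i) f)" if "u \<in> tangent_space M q" for u
      proof -
        have "push i q u (\<lambda>z. \<phi> z k) = u (\<lambda>p. \<phi> (snd p i) k)" if "k < n" for k
          using tangent_factor[of i q "\<lambda>z. \<phi> z k" u]
            Fi.smooth_atI[OF Fi.chart_open[OF c(1)] qU Fi.smooth_on_coord[OF c(1)]] that by (simp add: n_def)
        then show ?thesis
          using Fi.tangent_coord_field[OF push_tangent[OF i qM that] c(1) qU] by (simp add: e_def n_def)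
      qed
      have eT: "e k (snd q i) \<in> tangent_space (F i) (snd q i)" if "k \<in> {..<n}" for k
        using Fi.vector_field_tangent[OF ev qU] that by simp
      note XT = M.vector_field_tangent[OF X qW] and YT = M.vector_field_tangent[OF Y qW]
      show "(\<Sum>k<n. X q (\<lambda>p. \<phi> (snd p i) k) * (\<Sum>l<n. Y q (\<lambda>p. \<phi> (snd p i) l) *
          gF i (snd q i) (e k (snd q i)) (e l (snd q i)))) = gF i (snd q i) (push i q (X q)) (push i q (Y q))"
      proof -
        have "gF i (snd q i) (push i q (X q)) (push i q (Y q)) =
            (\<Sum>k<n. X q (\<lambda>p. \<phi> (snd p i) k) * gF i (snd q i) (e k (snd q i)) (push i q (Y q)))"
          unfolding ex[OF XT] by (rule Fi.g_lincomb_left[OF sM push_tangent[OF i qM YT] eT])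
        also have "\<dots> = (\<Sum>k<n. X q (\<lambda>p. \<phi> (snd p i) k) * (\<Sum>l<n. Y q (\<lambda>p. \<phi> (snd p i) l) *
            gF i (snd q i) (e k (snd q i)) (e l (snd q i))))"
          unfolding ex[OF YT]
          by (intro sum.cong refl arg_cong2[where f = times] Fi.g_lincomb_right[OF sM eT eT])
        finally show ?thesis ..
      qed
    qed
    then show "\<exists>T. openin (mtop M) T \<and> p \<in> T \<and> T \<subseteq> W \<and>
        smooth_on M T (\<lambda>q. gF i (snd q i) (push i q (X q)) (push i q (Y q)))"
      using W' by blast
  qed
  then show "smooth_on M W (\<lambda>p. g p (X p) (Y p))"
    unfolding g_eq power2_eq_square
    by (intro M.smooth_on_add M.smooth_on_uminus M.smooth_on_mult M.smooth_on_sum W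
        M.vector_field_smooth[OF X W _ fs] M.vector_field_smooth[OF Y W _ fs]
        M.smooth_on_subset[OF smooth_on_b WM]) auto
qed

end


section \<open>The Levi-Civita connection of the warped product\<close>

context warped_product begin

lemma g_dt_dt: "q \<in> points M \<Longrightarrow> g q (dt q) (dt q) = -1"
  using g_dt[OF _ dt_tangent] dt_fst by simp

lemma dt_factor: "dt q (\<lambda>p. f (snd p k)) = 0"
  by (simp add: dt_def)

lemma dt_time: "smooth_at M q (\<lambda>p. \<beta> (fst p)) \<Longrightarrow> dt q (\<lambda>p. \<beta> (fst p)) = deriv \<beta> (fst q)"
  by (simp add: dt_def)

definition time_smooth :: "(real \<Rightarrow> real) \<Rightarrow> bool" where
  "time_smooth \<beta> \<longleftrightarrow> smooth_on M (points M) (\<lambda>q. \<beta> (fst q))"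

lemma time_smooth_at: "time_smooth \<beta> \<Longrightarrow> q \<in> points M \<Longrightarrow> smooth_at M q (\<lambda>p. \<beta> (fst p))"
  unfolding time_smooth_def by (rule M.smooth_atI[OF openin_topspace])

text \<open>The logarithmic derivative of b_i, by which differentiation along dt scales the lifts
  from factor \<open>i\<close>; in cosmology it is the Hubble rate.\<close>

definition hubble :: "nat \<Rightarrow> real \<Rightarrow> real" where
  "hubble i t = deriv (b i) t / b i t"

text \<open>Half the derivative of b_i^2; it governs the dt-component of D_X Y for lifts from one
  factor.\<close>

definition bdb :: "nat \<Rightarrow> real \<Rightarrow> real" where
  "bdb i t = b i t * deriv (b i) t"

lemma smooth_on_db: "i \<in> {1..m} \<Longrightarrow> smooth_on M (points M) (\<lambda>q. deriv (b i) (fst q))"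
  using smooth_on_time[OF b_smooth, of i 1] by simp

lemma time_smooth_b2: "i \<in> {1..m} \<Longrightarrow> time_smooth (\<lambda>t. (b i t)\<^sup>2)"
  unfolding time_smooth_def power2_eq_square by (intro M.smooth_on_mult smooth_on_b) auto

lemma time_smooth_bdb: "i \<in> {1..m} \<Longrightarrow> time_smooth (bdb i)"
  unfolding time_smooth_def bdb_def by (intro M.smooth_on_mult smooth_on_b smooth_on_db) auto

lemma time_smooth_hubble: "i \<in> {1..m} \<Longrightarrow> time_smooth (hubble i)"
  unfolding time_smooth_def hubble_def
  by (intro M.smooth_on_divide smooth_on_b smooth_on_db) (use b_fst_pos in force)+

lemma deriv_b2:
  assumes "i \<in> {1..m}" "t \<in> I"
  shows "deriv (\<lambda>t. (b i t)\<^sup>2) t = 2 * bdb i t"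
proof -
  have "b i differentiable at t"
    using b_smooth[OF assms(1), of 0] assms(2) open_I by (simp add: differentiable_on_eq_differentiable_at)
  then have "(b i has_real_derivative deriv (b i) t) (at t)"
    by (simp add: DERIV_deriv_iff_real_differentiable)
  then have "((\<lambda>t. (b i t)\<^sup>2) has_real_derivative 2 * bdb i t) (at t)"
    by (auto intro!: derivative_eq_intros simp: bdb_def)
  then show ?thesis by (rule DERIV_imp_deriv)
qed

lemma hubble_bdb: "i \<in> {1..m} \<Longrightarrow> t \<in> I \<Longrightarrow> hubble i t * (b i t)\<^sup>2 = bdb i t"
  using b_pos[of i t] by (simp add: hubble_def bdb_def power2_eq_square)

end

locale warped_levi_civita = warped_product I m F gF b
  for I m and F :: "nat \<Rightarrow> 'a manifold" and gF b +
  fixes DF :: "nat \<Rightarrow> 'a connection" and D :: "(real \<times> (nat \<Rightarrow> 'a)) connection"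
  assumes DF: "\<And>i. i \<in> {1..m} \<Longrightarrow> levi_civita (F i) (gF i) (DF i)"
    and D: "levi_civita M g D"
begin

sublocale M: levi_civita_manifold M g D
  by unfold_locales (rule D)

lemma factor: "i \<in> {1..m} \<Longrightarrow> levi_civita_manifold (F i) (gF i) (DF i)"
  using gF DF by (simp add: levi_civita_manifold_def levi_civita_manifold_axioms_def)

end

text \<open>On a product of open sets, fields on the \<open>N i\<close> lift to all of
  \<open>W\<close>. As each \<open>N i\<close> lies inside one chart, every tangent vector at a
  point of it extends to a field on it.\<close>

locale warped_patch = warped_levi_civita I m F gF b DF D
  for I m and F :: "nat \<Rightarrow> 'a manifold" and gF b DF D +
  fixes N :: "nat \<Rightarrow> 'a set"
  assumes N_open: "\<And>i. i \<in> {1..m} \<Longrightarrow> openin (mtop (F i)) (N i)"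
    and N_chart: "\<And>i. i \<in> {1..m} \<Longrightarrow> \<exists>U \<phi>. (U, \<phi>) \<in> charts (F i) \<and> N i \<subseteq> U"
begin

abbreviation "W \<equiv> cube N"

lemma W_open: "openin (mtop M) W"
  by (rule openin_M_box[OF _ N_open]) simp

lemma W_points: "q \<in> W \<Longrightarrow> q \<in> points M"
  using openin_subset[OF W_open] by blast

lemma W_snd: "q \<in> W \<Longrightarrow> i \<in> {1..m} \<Longrightarrow> snd q i \<in> N i"
  by auto

lemma W_fst: "q \<in> W \<Longrightarrow> fst q \<in> I"
  by auto

lemma dt_W: "vector_field M W dt"
  by (rule M.vector_field_subset[OF vector_field_dt]) (use W_points in blast)

lemma lift_W:
  assumes "i \<in> {1..m}" "vector_field (F i) (N i) X"
  shows "vector_field M W (lift i X)"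
  by (rule M.vector_field_subset[OF vector_field_lift[OF assms(1) N_open[OF assms(1)] assms(2)]])
    (use W_points W_snd assms(1) in \<open>auto simp: cylinder_def simp del: One_nat_def\<close>)

lemma time_smooth_W: "time_smooth \<beta> \<Longrightarrow> smooth_on M W (\<lambda>q. \<beta> (fst q))"
  unfolding time_smooth_def by (rule M.smooth_on_subset[OF _ openin_subset[OF W_open]])

lemma smooth_on_W_factor:
  assumes "i \<in> {1..m}" "smooth_on (F i) (N i) h"
  shows "smooth_on M W (\<lambda>q. h (snd q i))"
  by (rule M.smooth_on_subset[OF smooth_on_factor[OF assms(1) N_open[OF assms(1)] assms(2)]])
    (use W_points W_snd assms(1) in \<open>auto simp: cylinder_def simp del: One_nat_def\<close>)

context
  fixes q i X
  assumes q: "q \<in> W" and i: "i \<in> {1..m}" and X: "vector_field (F i) (N i) X"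
begin

lemma X_tangent: "X (snd q i) \<in> tangent_space (F i) (snd q i)"
  by (rule smooth_atlas.vector_field_tangent[OF F[OF i] X W_snd[OF q i]])

lemma lift_fst: "lift i X q fst = 0"
  unfolding lift_eq by (rule incl_fst[OF i W_points[OF q] X_tangent])

lemma lift_time: "lift i X q (\<lambda>p. \<beta> (fst p)) = 0"
  unfolding lift_eq by (rule incl_time[OF i W_points[OF q] X_tangent])

lemma push_lift: "k \<in> {1..m} \<Longrightarrow> push k q (lift i X q) = (if k = i then X (snd q i) else (\<lambda>f. 0))"
  unfolding lift_eq by (rule push_incl[OF _ i W_points[OF q] X_tangent])

lemma lift_factor:
  assumes "k \<in> {1..m}" "smooth_at (F k) (snd q k) f"
  shows "lift i X q (\<lambda>p. f (snd p k)) = (if k = i then X (snd q k) f else 0)"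
  using push_lift[OF assms(1)] assms(2) by (simp add: tangent_factor)

lemma g_lift:
  assumes u: "u \<in> tangent_space M q"
  shows "g q u (lift i X q) = (b i (fst q))\<^sup>2 * gF i (snd q i) (push i q u) (X (snd q i))"
  unfolding lift_eq by (rule g_incl[OF W_points[OF q] u i X_tangent])

lemma lift_tangent: "lift i X q \<in> tangent_space M q"
  by (rule M.vector_field_tangent[OF lift_W[OF i X] q])

lemma g_lift_dt: "g q (lift i X q) (dt q) = 0" "g q (dt q) (lift i X q) = 0"
  using g_dt[OF W_points[OF q] lift_tangent] lift_fst
    M.g_sym[OF W_points[OF q] lift_tangent dt_tangent[OF W_points[OF q]]] by simp_all

text \<open>The derivative of a function of factor \<open>k\<close> along a lift is again a function
  of factor \<open>k\<close>, and 0 if the lift comes from another factor. So the iterated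
  derivatives in a bracket stay within one factor.\<close>

lemma tangent_lift_factor:
  assumes A: "A \<in> tangent_space M q" and k: "k \<in> {1..m}" and f: "smooth_at (F k) (snd q k) f"
  shows "A (\<lambda>p. lift i X p (\<lambda>z. f (snd z k))) = (if k = i then A (\<lambda>p. X (snd p k) f) else 0)"
proof -
  obtain S where S: "openin (mtop (F k)) S" "snd q k \<in> S" "smooth_on (F k) S f"
    using f unfolding smooth_at_def by blast
  have O: "openin (mtop M) (W \<inter> cylinder k S)" using W_open openin_cylinder[OF k S(1)] by blast
  have "A (\<lambda>p. lift i X p (\<lambda>z. f (snd z k))) = A (\<lambda>p. if k = i then X (snd p k) f else 0)"
  proof (rule M.tangent_cong[OF A O])
    show "q \<in> W \<inter> cylinder k S" using q S(2) W_points by (simp add: cylinder_def)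
    fix p assume p: "p \<in> W \<inter> cylinder k S"
    then have "X (snd p i) \<in> tangent_space (F i) (snd p i)"
      using smooth_atlas.vector_field_tangent[OF F[OF i] X] W_snd[OF _ i] by blast
    then have "push k p (lift i X p) = (if k = i then X (snd p i) else (\<lambda>f. 0))"
      unfolding lift_eq using push_incl[OF k i] W_points p by blast
    moreover have "smooth_at (F k) (snd p k) f"
      using smooth_atlas.smooth_atI[OF F[OF k] S(1) _ S(3)] p by (simp add: cylinder_def)
    ultimately show "lift i X p (\<lambda>z. f (snd z k)) = (if k = i then X (snd p k) f else 0)"
      using tangent_factor[of k p f "lift i X p"] by simp
  qed
  then show ?thesis using M.tangent_const[OF A W_points[OF q], of 0] by (cases "k = i") simp_all
qed

end

lemma g_lift_lift:
  assumes q: "q \<in> W" and i: "i \<in> {1..m}" and X: "vector_field (F i) (N i) X"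
    and j: "j \<in> {1..m}" and Y: "vector_field (F j) (N j) Y"
  shows "g q (lift i X q) (lift j Y q) =
    (if i = j then (b i (fst q))\<^sup>2 * gF i (snd q i) (X (snd q i)) (Y (snd q i)) else 0)"
  using g_lift[OF q j Y lift_tangent[OF q i X]] push_lift[OF q i X j]
    metric_manifold.g_zero_left[OF gF[OF j] snd_in_points[OF W_points[OF q] j] X_tangent[OF q j Y]]
  by auto

lemma lie_bracket_dt_lift:
  assumes q: "q \<in> W" and i: "i \<in> {1..m}" and X: "vector_field (F i) (N i) X"
  shows "lie_bracket M dt (lift i X) q = (\<lambda>f. 0)" "lie_bracket M (lift i X) dt q = (\<lambda>f. 0)"
proof -
  note qM = W_points[OF q]
  note dT = dt_tangent[OF qM] and lT = lift_tangent[OF q i X]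
  show *: "lie_bracket M dt (lift i X) q = (\<lambda>f. 0)"
  proof (rule tangent_M_eqI[OF qM M.lie_bracket_tangent[OF W_open dt_W lift_W[OF i X] q] M.tangent_space_zero[OF qM]])
    have "dt q (\<lambda>p. lift i X p fst) = 0"
      by (rule M.tangent_locally_const[OF dT W_open q]) (rule lift_fst[OF _ i X])
    moreover have "lift i X q (\<lambda>p. dt p fst) = 0"
      by (rule M.tangent_locally_const[OF lT W_open q]) (rule dt_fst[OF W_points])
    ultimately show "lie_bracket M dt (lift i X) q fst = 0" by (simp add: lie_bracket_def)
    fix k assume k: "k \<in> {1..m}"
    show "push k q (lie_bracket M dt (lift i X) q) = push k q (\<lambda>f. 0)"
    proof
      fix f
      have "lie_bracket M dt (lift i X) q (\<lambda>p. f (snd p k)) = 0" if f: "smooth_at (F k) (snd q k) f"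
        using tangent_lift_factor[OF q i X dT k f] M.tangent_const[OF lT qM, of 0]
          dt_factor[of q "\<lambda>z. X z f" k] by (cases "k = i") (simp_all add: lie_bracket_def dt_factor)
      then show "push k q (lie_bracket M dt (lift i X) q) f = push k q (\<lambda>f. 0) f"
        by (simp add: pushforward_def)
    qed
  qed
  show "lie_bracket M (lift i X) dt q = (\<lambda>f. 0)"
    using * M.lie_bracket_swap[of "lift i X" dt q] by (simp add: fun_eq_iff)
qed

text \<open>Neither side has a time component, and on functions of a single factor the iterated
  derivatives vanish unless both fields come from that factor.\<close>

lemma lie_bracket_lift_lift:
  assumes q: "q \<in> W" and i: "i \<in> {1..m}" and X: "vector_field (F i) (N i) X"
    and j: "j \<in> {1..m}" and Y: "vector_field (F j) (N j) Y"
  shows "lie_bracket M (lift i X) (lift j Y) q =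
    (if i = j then lift i (lie_bracket (F i) X Y) q else (\<lambda>f. 0))" (is "?B = ?R")
proof -
  interpret Fi: smooth_atlas "F i" by (rule F[OF i])
  note qM = W_points[OF q]
  note XT = lift_tangent[OF q i X] and YT = lift_tangent[OF q j Y]
  have BXY: "vector_field (F i) (N i) (lie_bracket (F i) X Y)" if "i = j"
    using Fi.lie_bracket_vector_field[OF N_open[OF i] X] Y that by simp
  have RT: "?R \<in> tangent_space M q"
    using lift_tangent[OF q i BXY] M.tangent_space_zero[OF qM] by simp
  show ?thesis
  proof (rule tangent_M_eqI[OF qM M.lie_bracket_tangent[OF W_open lift_W[OF i X] lift_W[OF j Y] q] RT])
    have "lift i X q (\<lambda>p. lift j Y p fst) = 0"
      by (rule M.tangent_locally_const[OF XT W_open q]) (rule lift_fst[OF _ j Y])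
    moreover have "lift j Y q (\<lambda>p. lift i X p fst) = 0"
      by (rule M.tangent_locally_const[OF YT W_open q]) (rule lift_fst[OF _ i X])
    ultimately show "?B fst = ?R fst"
      using lift_fst[OF q i BXY] by (simp add: lie_bracket_def)
    fix k assume k: "k \<in> {1..m}"
    interpret Fk: smooth_atlas "F k" by (rule F[OF k])
    show "push k q ?B = push k q ?R"
    proof
      fix f
      show "push k q ?B f = push k q ?R f"
      proof (cases "smooth_at (F k) (snd q k) f")
        case True
        note NK = N_open[OF k] W_snd[OF q k]
        have sX: "smooth_at (F k) (snd q k) (\<lambda>z. X z f)" if "k = i"
          using Fk.vector_field_smooth_at[OF _ NK True] X that by simp
        have sY: "smooth_at (F k) (snd q k) (\<lambda>z. Y z f)" if "k = j"
          using Fk.vector_field_smooth_at[OF _ NK True] Y that by simp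
        have "?B (\<lambda>p. f (snd p k)) = (if k = j then lift i X q (\<lambda>p. Y (snd p k) f) else 0) -
            (if k = i then lift j Y q (\<lambda>p. X (snd p k) f) else 0)"
          using tangent_lift_factor[OF q j Y XT k True] tangent_lift_factor[OF q i X YT k True]
            smooth_at_factor'[OF k qM True] by (simp add: lie_bracket_def)
        also have "\<dots> = (if k = i \<and> k = j then lie_bracket (F k) X Y (snd q k) f else 0)"
          using lift_factor[OF q i X k sY] lift_factor[OF q j Y k sX] True
          by (cases "k = i"; cases "k = j") (simp_all add: lie_bracket_def)
        also have "\<dots> = ?R (\<lambda>p. f (snd p k))"
          using lift_factor[OF q i BXY k True] by auto
        finally show ?thesis using True by (simp add: pushforward_def)
      next
        case False
        then show ?thesis by (simp add: pushforward_def)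
      qed
    qed
  qed
qed

lemma derivative_time_factor:
  assumes q: "q \<in> W" and i: "i \<in> {1..m}" and \<beta>: "time_smooth \<beta>" and h: "smooth_on (F i) (N i) h"
  shows "dt q (\<lambda>p. \<beta> (fst p) * h (snd p i)) = deriv \<beta> (fst q) * h (snd q i)"
    and "k \<in> {1..m} \<Longrightarrow> vector_field (F k) (N k) Z \<Longrightarrow>
      lift k Z q (\<lambda>p. \<beta> (fst p) * h (snd p i)) = (if k = i then \<beta> (fst q) * Z (snd q i) h else 0)"
proof -
  note qM = W_points[OF q]
  have hs: "smooth_at (F i) (snd q i) h"
    by (rule smooth_atlas.smooth_atI[OF F[OF i] N_open[OF i] W_snd[OF q i] h])
  note s1 = time_smooth_at[OF \<beta> qM] and s2 = smooth_at_factor'[OF i qM hs]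
  show "dt q (\<lambda>p. \<beta> (fst p) * h (snd p i)) = deriv \<beta> (fst q) * h (snd q i)"
    using M.tangent_mult[OF dt_tangent[OF qM] s1 s2] dt_factor[of q h i] dt_time[OF s1] by simp
  assume k: "k \<in> {1..m}" and Z: "vector_field (F k) (N k) Z"
  show "lift k Z q (\<lambda>p. \<beta> (fst p) * h (snd p i)) = (if k = i then \<beta> (fst q) * Z (snd q i) h else 0)"
    using M.tangent_mult[OF lift_tangent[OF q k Z] s1 s2] lift_factor[OF q k Z i hs] lift_time[OF q k Z]
    by auto
qed

text \<open>The inner product is b_i^2 times a function on the factor: dt differentiates only the
  first factor of this product, a lift only the second.\<close>

lemma derivative_metric:
  assumes q: "q \<in> W" and i: "i \<in> {1..m}" and X: "vector_field (F i) (N i) X"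
    and j: "j \<in> {1..m}" and Y: "vector_field (F j) (N j) Y"
  shows "dt q (\<lambda>p. g p (lift i X p) (lift j Y p)) =
      (if i = j then 2 * bdb i (fst q) * gF i (snd q i) (X (snd q i)) (Y (snd q i)) else 0)"
    and "k \<in> {1..m} \<Longrightarrow> vector_field (F k) (N k) Z \<Longrightarrow> lift k Z q (\<lambda>p. g p (lift i X p) (lift j Y p)) =
      (if i = j \<and> i = k then (b i (fst q))\<^sup>2 * Z (snd q i) (\<lambda>z. gF i z (X z) (Y z)) else 0)"
proof -
  note qM = W_points[OF q]
  have *: "A (\<lambda>p. g p (lift i X p) (lift j Y p)) =
      (if i = j then A (\<lambda>p. (b i (fst p))\<^sup>2 * (\<lambda>z. gF i z (X z) (Y z)) (snd p i)) else 0)"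
    if A: "A \<in> tangent_space M q" for A
  proof -
    have "A (\<lambda>p. g p (lift i X p) (lift j Y p)) =
        A (\<lambda>p. if i = j then (b i (fst p))\<^sup>2 * gF i (snd p i) (X (snd p i)) (Y (snd p i)) else 0)"
      by (rule M.tangent_cong[OF A W_open q]) (rule g_lift_lift[OF _ i X j Y])
    then show ?thesis using M.tangent_const[OF A qM, of 0] by (cases "i = j") simp_all
  qed
  have h: "smooth_on (F i) (N i) (\<lambda>z. gF i z (X z) (Y z))" if "i = j"
    using metric_manifold.g_smooth[OF gF[OF i] N_open[OF i] X] Y that by simp
  note d = derivative_time_factor[OF q i time_smooth_b2[OF i] h]
  show "dt q (\<lambda>p. g p (lift i X p) (lift j Y p)) =
      (if i = j then 2 * bdb i (fst q) * gF i (snd q i) (X (snd q i)) (Y (snd q i)) else 0)"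
    unfolding *[OF dt_tangent[OF qM]] using d(1) deriv_b2[OF i W_fst[OF q]] by (cases "i = j") simp_all
  assume k: "k \<in> {1..m}" and Z: "vector_field (F k) (N k) Z"
  show "lift k Z q (\<lambda>p. g p (lift i X p) (lift j Y p)) =
      (if i = j \<and> i = k then (b i (fst q))\<^sup>2 * Z (snd q i) (\<lambda>z. gF i z (X z) (Y z)) else 0)"
    unfolding *[OF lift_tangent[OF q k Z]] using d(2)[OF _ k Z] by auto
qed

lemma derivative_const_metric:
  assumes q: "q \<in> W" and i: "i \<in> {1..m}" and X: "vector_field (F i) (N i) X" and A: "A \<in> tangent_space M q"
  shows "A (\<lambda>p. g p (lift i X p) (dt p)) = 0" "A (\<lambda>p. g p (dt p) (lift i X p)) = 0"
    "A (\<lambda>p. g p (dt p) (dt p)) = 0"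
  by (rule M.tangent_locally_const[OF A W_open q]; use g_lift_dt[OF _ i X] g_dt_dt[OF W_points] in blast)+

text \<open>Pairing with lifts determines the projections, since every vector of a factor is the
  value of some field on \<open>N k\<close> and the factor metric is nondegenerate. In this form the
  results of the Koszul formula are turned into equations between vectors.\<close>

lemma tangent_W_eqI:
  assumes q: "q \<in> W" and u: "u \<in> tangent_space M q" and v: "v \<in> tangent_space M q"
    and t: "g q u (dt q) = g q v (dt q)"
    and l: "\<And>k Z. k \<in> {1..m} \<Longrightarrow> vector_field (F k) (N k) Z \<Longrightarrow> g q u (lift k Z q) = g q v (lift k Z q)"
  shows "u = v"
proof (rule tangent_M_eqI[OF W_points[OF q] u v])
  note qM = W_points[OF q]
  show "u fst = v fst" using t g_dt[OF qM u] g_dt[OF qM v] by simp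
  fix k assume k: "k \<in> {1..m}"
  interpret Fk: metric_manifold "F k" "gF k" by (rule gF[OF k])
  note sM = snd_in_points[OF qM k] and pu = push_tangent[OF k qM u] and pv = push_tangent[OF k qM v]
  have "(\<lambda>f. push k q u f - push k q v f) = (\<lambda>f. 0)"
  proof (rule Fk.g_nondegenerate[OF sM Fk.tangent_space_diff[OF sM pu pv]])
    fix w assume w: "w \<in> tangent_space (F k) (snd q k)"
    obtain U \<phi> where c: "(U, \<phi>) \<in> charts (F k)" "N k \<subseteq> U" using N_chart[OF k] by blast
    obtain Z where Z: "vector_field (F k) U Z" "Z (snd q k) = w"
      using Fk.vector_field_extension[OF w c(1)] c(2) W_snd[OF q k] by blast
    note Z' = Fk.vector_field_subset[OF Z(1) c(2)]
    have "gF k (snd q k) (push k q u) w = gF k (snd q k) (push k q v) w"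
      using l[OF k Z'] g_lift[OF q k Z' u] g_lift[OF q k Z' v] Z(2) b_fst_pos[OF qM k] by simp
    then show "gF k (snd q k) (\<lambda>f. push k q u f - push k q v f) w = 0"
      using Fk.g_diff_left[OF sM pu pv w] by simp
  qed
  then show "push k q u = push k q v" by (simp add: fun_eq_iff)
qed

lemma D_dt_dt:
  assumes q: "q \<in> W"
  shows "D dt dt q = (\<lambda>f. 0)"
proof (rule tangent_W_eqI[OF q M.vector_field_tangent[OF M.D_vector_field[OF W_open dt_W dt_W] q]
      M.tangent_space_zero[OF W_points[OF q]]])
  note qM = W_points[OF q] and dT = dt_tangent[OF W_points[OF q]]
  have br: "lie_bracket M dt dt q = (\<lambda>f. 0)" by (simp add: lie_bracket_def fun_eq_iff)
  have c: "dt q (\<lambda>p. g p (dt p) (dt p)) = 0"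
    by (rule M.tangent_locally_const[OF dT W_open q g_dt_dt[OF W_points]])
  show "g q (D dt dt q) (dt q) = g q (\<lambda>f. 0) (dt q)"
    using M.koszul[OF W_open dt_W dt_W dt_W q] c M.g_zero_left[OF qM dT] by (simp add: br)
  fix k Z assume k: "k \<in> {1..m}" and Z: "vector_field (F k) (N k) Z"
  show "g q (D dt dt q) (lift k Z q) = g q (\<lambda>f. 0) (lift k Z q)"
    using M.koszul[OF W_open dt_W dt_W lift_W[OF k Z] q] derivative_const_metric[OF q k Z dT]
      derivative_const_metric[OF q k Z lift_tangent[OF q k Z]] M.g_zero_left[OF qM dT]
      M.g_zero_left[OF qM lift_tangent[OF q k Z]]
    by (simp add: br lie_bracket_dt_lift[OF q k Z])
qed

text \<open>All Koszul terms vanish except the derivative of g(X,Z) along dt, which is 2 b_i b_i'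
  g_i(X,Z) = 2 (b_i'/b_i) g(X,Z). The second equation follows because dt commutes with
  lifts.\<close>

lemma D_dt_lift:
  assumes q: "q \<in> W" and i: "i \<in> {1..m}" and X: "vector_field (F i) (N i) X"
  shows "D dt (lift i X) q = (\<lambda>f. hubble i (fst q) * lift i X q f)"
    and "D (lift i X) dt q = (\<lambda>f. hubble i (fst q) * lift i X q f)"
proof -
  note qM = W_points[OF q] and dT = dt_tangent[OF W_points[OF q]] and lT = lift_tangent[OF q i X]
  note lW = lift_W[OF i X]
  note br = lie_bracket_dt_lift[OF q]
  have br0: "lie_bracket M dt dt q = (\<lambda>f. 0)" by (simp add: lie_bracket_def fun_eq_iff)
  show *: "D dt (lift i X) q = (\<lambda>f. hubble i (fst q) * lift i X q f)"
  proof (rule tangent_W_eqI[OF q M.vector_field_tangent[OF M.D_vector_field[OF W_open dt_W lW] q]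
        M.tangent_space_cmult[OF lT]])
    show "g q (D dt (lift i X) q) (dt q) = g q (\<lambda>f. hubble i (fst q) * lift i X q f) (dt q)"
      using M.koszul[OF W_open dt_W lW dt_W q] derivative_const_metric[OF q i X dT]
        derivative_const_metric[OF q i X lT] M.g_zero_left[OF qM dT] M.g_zero_left[OF qM lT]
        M.g_cmult_left[OF qM lT dT] g_lift_dt[OF q i X]
      by (simp add: br[OF i X] br0)
    fix k Z assume k: "k \<in> {1..m}" and Z: "vector_field (F k) (N k) Z"
    note kT = lift_tangent[OF q k Z]
    have "g q (lie_bracket M (lift i X) (lift k Z) q) (dt q) = 0"
    proof (cases "i = k")
      case True
      have "vector_field (F i) (N i) (lie_bracket (F i) X Z)"
        by (rule smooth_atlas.lie_bracket_vector_field[OF F[OF i] N_open[OF i] X]) (use Z True in simp)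
      then show ?thesis using lie_bracket_lift_lift[OF q i X k Z] g_lift_dt[OF q i] True by simp
    next
      case False
      then show ?thesis using lie_bracket_lift_lift[OF q i X k Z] M.g_zero_left[OF qM dT] by simp
    qed
    then have "2 * g q (D dt (lift i X) q) (lift k Z q) = dt q (\<lambda>p. g p (lift i X p) (lift k Z p))"
      using M.koszul[OF W_open dt_W lW lift_W[OF k Z] q] derivative_const_metric[OF q i X kT]
        derivative_const_metric[OF q k Z lT] M.g_zero_left[OF qM kT] M.g_zero_left[OF qM lT]
      by (simp add: br[OF i X] br[OF k Z])
    then show "g q (D dt (lift i X) q) (lift k Z q) = g q (\<lambda>f. hubble i (fst q) * lift i X q f) (lift k Z q)"
      using derivative_metric(1)[OF q i X k Z] M.g_cmult_left[OF qM lT kT] g_lift_lift[OF q i X k Z]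
        hubble_bdb[OF i W_fst[OF q]] by (auto simp: mult.assoc[symmetric])
  qed
  have "D (lift i X) dt q f = D dt (lift i X) q f" for f
    using M.D_torsion_free[OF W_open lW dt_W q, of f] br[OF i X] by simp
  then show "D (lift i X) dt q = (\<lambda>f. hubble i (fst q) * lift i X q f)" using * by (simp add: fun_eq_iff)
qed

lemma g_lie_bracket_lift:
  assumes q: "q \<in> W" and i: "i \<in> {1..m}" and X: "vector_field (F i) (N i) X"
    and j: "j \<in> {1..m}" and Y: "vector_field (F j) (N j) Y"
    and k: "k \<in> {1..m}" and Z: "vector_field (F k) (N k) Z"
  shows "g q (lie_bracket M (lift i X) (lift j Y) q) (lift k Z q) =
      (if i = j \<and> i = k then (b i (fst q))\<^sup>2 *
        gF i (snd q i) (lie_bracket (F i) X Y (snd q i)) (Z (snd q i)) else 0)"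
    and "g q (lie_bracket M (lift i X) (lift j Y) q) (dt q) = 0"
proof -
  note qM = W_points[OF q]
  have BXY: "vector_field (F i) (N i) (lie_bracket (F i) X Y)" if "i = j"
    by (rule smooth_atlas.lie_bracket_vector_field[OF F[OF i] N_open[OF i] X]) (use Y that in simp)
  show "g q (lie_bracket M (lift i X) (lift j Y) q) (lift k Z q) =
      (if i = j \<and> i = k then (b i (fst q))\<^sup>2 *
        gF i (snd q i) (lie_bracket (F i) X Y (snd q i)) (Z (snd q i)) else 0)"
    unfolding lie_bracket_lift_lift[OF q i X j Y]
    using g_lift_lift[OF q i BXY k Z] M.g_zero_left[OF qM lift_tangent[OF q k Z]] by auto
  show "g q (lie_bracket M (lift i X) (lift j Y) q) (dt q) = 0"
    unfolding lie_bracket_lift_lift[OF q i X j Y]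
    using g_lift_dt(1)[OF q i BXY] M.g_zero_left[OF qM dt_tangent[OF qM]] by simp
qed

text \<open>Pairing with lifts gives b_i^2 times the Koszul formula of the factor. Pairing with dt
  gives - b_i b_i' g_i(X,Y), and as g(dt,dt) = -1, the coefficient of dt has the opposite
  sign.\<close>

lemma D_lift_lift:
  assumes q: "q \<in> W" and i: "i \<in> {1..m}" and X: "vector_field (F i) (N i) X"
    and j: "j \<in> {1..m}" and Y: "vector_field (F j) (N j) Y"
  shows "i \<noteq> j \<Longrightarrow> D (lift i X) (lift j Y) q = (\<lambda>f. 0)"
    and "i = j \<Longrightarrow> D (lift i X) (lift j Y) q = (\<lambda>f. lift i (DF i X Y) q f +
      bdb i (fst q) * gF i (snd q i) (X (snd q i)) (Y (snd q i)) * dt q f)"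
proof -
  note qM = W_points[OF q]
  note dT = dt_tangent[OF qM] and XW = lift_W[OF i X] and YW = lift_W[OF j Y]
  note XT = lift_tangent[OF q i X] and YT = lift_tangent[OF q j Y]
  note br = lie_bracket_dt_lift[OF q]
  note DT = M.vector_field_tangent[OF M.D_vector_field[OF W_open XW YW] q]
  have gdt: "2 * g q (D (lift i X) (lift j Y) q) (dt q) = - dt q (\<lambda>p. g p (lift i X p) (lift j Y p))"
    using M.koszul[OF W_open XW YW dt_W q] derivative_const_metric[OF q i X YT]
      derivative_const_metric[OF q j Y XT] g_lie_bracket_lift(2)[OF q i X j Y i X]
      M.g_zero_left[OF qM XT] M.g_zero_left[OF qM YT]
    by (simp add: br[OF i X] br[OF j Y])
  have glift: "2 * g q (D (lift i X) (lift j Y) q) (lift k Z q) =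
      (if i = j \<and> i = k then (b i (fst q))\<^sup>2 * (2 * gF i (snd q i) (DF i X Y (snd q i)) (Z (snd q i))) else 0)"
    if k: "k \<in> {1..m}" and Z: "vector_field (F k) (N k) Z" for k Z
  proof (cases "i = j \<and> i = k")
    case True
    interpret Fi: levi_civita_manifold "F i" "gF i" "DF i" by (rule factor[OF i])
    have Yi: "vector_field (F i) (N i) Y" and Zi: "vector_field (F i) (N i) Z" using Y Z True by auto
    have "2 * g q (D (lift i X) (lift j Y) q) (lift k Z q) = (b i (fst q))\<^sup>2 * (
        X (snd q i) (\<lambda>z. gF i z (Y z) (Z z)) + Y (snd q i) (\<lambda>z. gF i z (X z) (Z z))
        - Z (snd q i) (\<lambda>z. gF i z (X z) (Y z)) + gF i (snd q i) (lie_bracket (F i) X Y (snd q i)) (Z (snd q i))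
        - gF i (snd q i) (lie_bracket (F i) X Z (snd q i)) (Y (snd q i))
        - gF i (snd q i) (lie_bracket (F i) Y Z (snd q i)) (X (snd q i)))"
      unfolding M.koszul[OF W_open XW YW lift_W[OF k Z] q] derivative_metric(2)[OF q j Y k Z i X]
        derivative_metric(2)[OF q i X k Z j Y] derivative_metric(2)[OF q i X j Y k Z]
        g_lie_bracket_lift(1)[OF q i X j Y k Z] g_lie_bracket_lift(1)[OF q i X k Z j Y]
        g_lie_bracket_lift(1)[OF q j Y k Z i X] using True
      by (simp add: algebra_simps)
    then show ?thesis using Fi.koszul[OF N_open[OF i] X Yi Zi W_snd[OF q i]] True by simp
  next
    case False
    then show ?thesis
      using M.koszul[OF W_open XW YW lift_W[OF k Z] q] derivative_metric(2)[OF q j Y k Z i X]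
        derivative_metric(2)[OF q i X k Z j Y] derivative_metric(2)[OF q i X j Y k Z]
        g_lie_bracket_lift(1)[OF q i X j Y k Z] g_lie_bracket_lift(1)[OF q i X k Z j Y]
        g_lie_bracket_lift(1)[OF q j Y k Z i X] by (auto split: if_splits)
  qed
  show "D (lift i X) (lift j Y) q = (\<lambda>f. 0)" if "i \<noteq> j"
  proof (rule tangent_W_eqI[OF q DT M.tangent_space_zero[OF qM]])
    show "g q (D (lift i X) (lift j Y) q) (dt q) = g q (\<lambda>f. 0) (dt q)"
      using gdt derivative_metric(1)[OF q i X j Y] that M.g_zero_left[OF qM dT] by simp
    fix k Z assume k: "k \<in> {1..m}" and Z: "vector_field (F k) (N k) Z"
    show "g q (D (lift i X) (lift j Y) q) (lift k Z q) = g q (\<lambda>f. 0) (lift k Z q)"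
      using glift[OF k Z] that M.g_zero_left[OF qM lift_tangent[OF q k Z]] by simp
  qed
  assume ij: "i = j"
  interpret Fi: levi_civita_manifold "F i" "gF i" "DF i" by (rule factor[OF i])
  have DXY: "vector_field (F i) (N i) (DF i X Y)"
    using Fi.D_vector_field[OF N_open[OF i] X] Y ij by simp
  define c where "c = bdb i (fst q) * gF i (snd q i) (X (snd q i)) (Y (snd q i))"
  note lT = lift_tangent[OF q i DXY] and cT = M.tangent_space_cmult[OF dT, of c]
  show "D (lift i X) (lift j Y) q = (\<lambda>f. lift i (DF i X Y) q f +
      bdb i (fst q) * gF i (snd q i) (X (snd q i)) (Y (snd q i)) * dt q f)"
    unfolding c_def[symmetric]
  proof (rule tangent_W_eqI[OF q DT M.tangent_space_add[OF lT cT]])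
    show "g q (D (lift i X) (lift j Y) q) (dt q) = g q (\<lambda>f. lift i (DF i X Y) q f + c * dt q f) (dt q)"
      using gdt derivative_metric(1)[OF q i X j Y] ij M.g_add_left[OF qM lT cT dT]
        M.g_cmult_left[OF qM dT dT, of c] g_dt_dt[OF qM] g_lift_dt(1)[OF q i DXY] by (simp add: c_def)
    fix k Z assume k: "k \<in> {1..m}" and Z: "vector_field (F k) (N k) Z"
    note kT = lift_tangent[OF q k Z]
    show "g q (D (lift i X) (lift j Y) q) (lift k Z q) = g q (\<lambda>f. lift i (DF i X Y) q f + c * dt q f) (lift k Z q)"
      using glift[OF k Z] ij M.g_add_left[OF qM lT cT kT] M.g_cmult_left[OF qM dT kT, of c]
        g_lift_dt(2)[OF q k Z] g_lift_lift[OF q i DXY k Z] by (auto split: if_splits)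
  qed
qed

end


section \<open>Curvature of the warped product in a product frame\<close>

context warped_product begin

text \<open>The pair (0, 0) stands for the unit field dt, and (i, a) for the a-th frame field of the factor i.\<close>

definition frame_index :: "(nat \<times> nat) set" where
  "frame_index = insert (0, 0) (SIGMA i:{1..m}. {..<mdim (F i)})"

lemma finite_frame_index: "finite frame_index"
  by (simp add: frame_index_def)

lemma frame_index_cases:
  assumes "A \<in> frame_index"
  obtains "A = (0, 0)" | i a where "A = (i, a)" "i \<in> {1..m}" "a < mdim (F i)" "i \<noteq> 0"
  using assms unfolding frame_index_def by auto

lemma sum_frame_index: "(\<Sum>A\<in>frame_index. f A) = f (0, 0) + (\<Sum>i=1..m. \<Sum>a<mdim (F i). f (i, a))"
proof -
  have "(\<Sum>A\<in>frame_index. f A) = f (0, 0) + (\<Sum>A\<in>(SIGMA i:{1..m}. {..<mdim (F i)}). f A)"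
    unfolding frame_index_def by (rule sum.insert) auto
  then show ?thesis by (simp add: sum.Sigma)
qed

text \<open>The values of g(R(A,B)A,B) / (g(A,A) g(B,B)) on pairs of frame fields, up to the contribution of the
  curvature of a factor to pairs from that factor.\<close>

definition time_curvature :: "real \<Rightarrow> nat \<times> nat \<Rightarrow> nat \<times> nat \<Rightarrow> real" where
  "time_curvature t = (\<lambda>(i, a) (j, c).
     if i = 0 then (if j = 0 then 0 else - (deriv (hubble j) t + (hubble j t)\<^sup>2))
     else if j = 0 then (hubble i t * bdb i t - deriv (bdb i) t) / (b i t)\<^sup>2
     else if i \<noteq> j then - bdb i t * hubble j t / (b i t)\<^sup>2
     else (if a = c then 0 else - hubble i t * bdb i t / (b i t)\<^sup>2))"

end

context warped_patch begin

lemma D_zero: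
  assumes q: "q \<in> W" and A: "vector_field M (W) A"
  shows "D A (\<lambda>p f. 0) q = (\<lambda>f. 0)" "D (\<lambda>p f. 0) A q = (\<lambda>f. 0)"
  using M.D_scale_right[OF W_open A A M.smooth_on_const[of _ 0] q] M.D_scale_left[OF W_open A A M.smooth_on_const[of _ 0] q]
    M.tangent_const[OF M.vector_field_tangent[OF A q] W_points[OF q], of 0] by (simp_all add: fun_eq_iff)

lemma D_bracket_zero:
  assumes q: "q \<in> W" and A: "vector_field M (W) A"
    and z: "\<And>p. p \<in> W \<Longrightarrow> lie_bracket M X Y p = (\<lambda>f. 0)"
  shows "D (lie_bracket M X Y) A q = (\<lambda>f. 0)"
  using M.D_cong[OF W_open M.vector_field_zero[OF W_open] A q z refl] D_zero(2)[OF q A] by simp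

text \<open>With H = b_i'/b_i, the term D_dt (H X) produces H' + H^2, which is b_i''/b_i; the other
  two terms of the curvature vanish.\<close>

lemma curvature_dt_lift_dt:
  assumes q: "q \<in> W" and i: "i \<in> {1..m}" and X: "vector_field (F i) (N i) X"
  shows "curvature M D dt (lift i X) dt q h =
    (deriv (hubble i) (fst q) + (hubble i (fst q))\<^sup>2) * lift i X q h"
proof -
  note LW = lift_W[OF i X] and Hs = time_smooth_W[OF time_smooth_hubble[OF i]]
  have "D dt (D (lift i X) dt) q = D dt (\<lambda>p f. hubble i (fst p) * lift i X p f) q"
    by (rule M.D_cong[OF W_open dt_W M.vector_field_scale[OF LW Hs] q refl]) (rule D_dt_lift(2)[OF _ i X])
  moreover have "D (lift i X) (D dt dt) q = (\<lambda>f. 0)"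
    using M.D_cong[OF W_open LW M.vector_field_zero[OF W_open] q refl D_dt_dt] D_zero(1)[OF q LW] by simp
  ultimately show ?thesis
    using M.D_scale_right[OF W_open dt_W LW Hs q, of h] dt_time[OF time_smooth_at[OF time_smooth_hubble[OF i] W_points[OF q]]]
      D_bracket_zero[OF q dt_W lie_bracket_dt_lift(1)[OF _ i X]] D_dt_lift(1)[OF q i X]
    by (simp add: curvature_def power2_eq_square algebra_simps)
qed

context
  fixes i X Y
  assumes i: "i \<in> {1..m}" and X: "vector_field (F i) (N i) X" and Y: "vector_field (F i) (N i) Y"
begin

lemma smooth_DLL_coefficient:
  "smooth_on M (W) (\<lambda>p. bdb i (fst p) * gF i (snd p i) (X (snd p i)) (Y (snd p i)))"
  by (rule M.smooth_on_mult[OF W_open time_smooth_W[OF time_smooth_bdb[OF i]]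
        smooth_on_W_factor[OF i metric_manifold.g_smooth[OF gF[OF i] N_open[OF i] X Y]]])

lemma DF_vector_field: "vector_field (F i) (N i) (DF i X Y)"
  by (rule levi_civita_manifold.D_vector_field[OF factor[OF i] N_open[OF i] X Y])

lemma D_D_lift_lift:
  assumes q: "q \<in> W" and A: "vector_field M (W) A"
  shows "D A (D (lift i X) (lift i Y)) q h = D A (lift i (DF i X Y)) q h
    + bdb i (fst q) * gF i (snd q i) (X (snd q i)) (Y (snd q i)) * D A dt q h
    + A q (\<lambda>p. bdb i (fst p) * gF i (snd p i) (X (snd p i)) (Y (snd p i))) * dt q h"
proof -
  define c where "c p = bdb i (fst p) * gF i (snd p i) (X (snd p i)) (Y (snd p i))" for p
  note cs = smooth_DLL_coefficient[folded c_def]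
  note VW = lift_W[OF i DF_vector_field] and cW = M.vector_field_scale[OF dt_W cs]
  have "D A (D (lift i X) (lift i Y)) q = D A (\<lambda>p f. lift i (DF i X Y) p f + c p * dt p f) q"
    by (rule M.D_cong[OF W_open A M.vector_field_add[OF VW cW] q refl])
      (use D_lift_lift(2)[OF _ i X i Y] in \<open>simp add: c_def\<close>)
  then show ?thesis
    using M.D_add_right[OF W_open A VW cW q, of h] M.D_scale_right[OF W_open A dt_W cs q, of h] by (simp add: c_def)
qed

end

text \<open>The components along the factor cancel. The remaining coefficient equals - b_i b_i'' and
  is left unsimplified, because later only its dependence on t matters.\<close>

lemma curvature_lift_dt_lift:
  assumes q: "q \<in> W" and i: "i \<in> {1..m}" and X: "vector_field (F i) (N i) X"
  shows "curvature M D (lift i X) dt (lift i X) q h =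
    (hubble i (fst q) * bdb i (fst q) - deriv (bdb i) (fst q)) * gF i (snd q i) (X (snd q i)) (X (snd q i)) * dt q h"
proof -
  note LW = lift_W[OF i X] and Hs = time_smooth_W[OF time_smooth_hubble[OF i]]
  note hs = metric_manifold.g_smooth[OF gF[OF i] N_open[OF i] X X]
  have "D (lift i X) (D dt (lift i X)) q = D (lift i X) (\<lambda>p f. hubble i (fst p) * lift i X p f) q"
    by (rule M.D_cong[OF W_open LW M.vector_field_scale[OF LW Hs] q refl]) (rule D_dt_lift(1)[OF _ i X])
  then show ?thesis
    using M.D_scale_right[OF W_open LW LW Hs q, of h] lift_time[OF q i X, of "hubble i"]
      D_bracket_zero[OF q LW lie_bracket_dt_lift(2)[OF _ i X]] D_D_lift_lift[OF i X X q dt_W, of h]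
      D_dt_lift(1)[OF q i DF_vector_field[OF i X X]] D_dt_dt[OF q] D_lift_lift(2)[OF q i X i X]
      derivative_time_factor(1)[OF q i time_smooth_bdb[OF i] hs]
    by (simp add: curvature_def algebra_simps)
qed

text \<open>The only contribution is that of the dt-part of D_X X, through D_Y dt = (b_j'/b_j)
  Y.\<close>

lemma curvature_lift_lift_different:
  assumes q: "q \<in> W" and i: "i \<in> {1..m}" and X: "vector_field (F i) (N i) X"
    and j: "j \<in> {1..m}" and Y: "vector_field (F j) (N j) Y" and ij: "i \<noteq> j"
  shows "curvature M D (lift i X) (lift j Y) (lift i X) q h =
    - bdb i (fst q) * gF i (snd q i) (X (snd q i)) (X (snd q i)) * hubble j (fst q) * lift j Y q h"
proof -
  note XW = lift_W[OF i X] and YW = lift_W[OF j Y]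
  note hs = metric_manifold.g_smooth[OF gF[OF i] N_open[OF i] X X]
  have "D (lift i X) (D (lift j Y) (lift i X)) q = (\<lambda>f. 0)"
    using M.D_cong[OF W_open XW M.vector_field_zero[OF W_open] q refl D_lift_lift(1)[OF _ j Y i X ij[symmetric]]]
      D_zero(1)[OF q XW] by simp
  moreover have "lie_bracket M (lift i X) (lift j Y) p = (\<lambda>f. 0)" if "p \<in> W" for p
    using lie_bracket_lift_lift[OF that i X j Y] ij by simp
  ultimately show ?thesis
    using D_D_lift_lift[OF i X X q YW, of h] D_lift_lift(1)[OF q j Y i DF_vector_field[OF i X X] ij[symmetric]]
      D_dt_lift(2)[OF q j Y] derivative_time_factor(2)[OF q i time_smooth_bdb[OF i] hs j Y] ij D_bracket_zero[OF q XW]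
    by (simp add: curvature_def)
qed

lemma g_incl_lift:
  assumes q: "q \<in> W" and i: "i \<in> {1..m}" and w: "w \<in> tangent_space (F i) (snd q i)"
    and V: "vector_field (F i) (N i) V"
  shows "g q (incl i q w) (lift i V q) = (b i (fst q))\<^sup>2 * gF i (snd q i) w (V (snd q i))"
  using g_lift[OF q i V incl_tangent[OF i W_points[OF q] w]] push_incl[OF i i W_points[OF q] w] by simp

text \<open>An equation of Gauss type: the factor contributes its own curvature, and the dt-parts of
  D_Y Z and D_X Z return through D_X dt = (b_i'/b_i) X and D_Y dt. The product of
  \<open>hubble i\<close> and \<open>bdb i\<close> is the square of b_i'.\<close>

lemma curvature_lift_lift_same:
  assumes q: "q \<in> W" and i: "i \<in> {1..m}" and X: "vector_field (F i) (N i) X"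
    and Y: "vector_field (F i) (N i) Y" and Z: "vector_field (F i) (N i) Z" and V: "vector_field (F i) (N i) V"
  shows "g q (curvature M D (lift i X) (lift i Y) (lift i Z) q) (lift i V q) = (b i (fst q))\<^sup>2 *
    (gF i (snd q i) (curvature (F i) (DF i) X Y Z (snd q i)) (V (snd q i))
     + hubble i (fst q) * bdb i (fst q) *
       (gF i (snd q i) (Y (snd q i)) (Z (snd q i)) * gF i (snd q i) (X (snd q i)) (V (snd q i))
      - gF i (snd q i) (X (snd q i)) (Z (snd q i)) * gF i (snd q i) (Y (snd q i)) (V (snd q i))))"
proof -
  interpret Fi: levi_civita_manifold "F i" "gF i" "DF i" by (rule factor[OF i])
  note qM = W_points[OF q]
  define G where "G A B = gF i (snd q i) (A (snd q i)) (B (snd q i))" for A B :: "'a vfield"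
  define \<kappa> where "\<kappa> = hubble i (fst q) * bdb i (fst q)"
  define R where "R = curvature (F i) (DF i) X Y Z"
  \<comment> \<open>The dt-component is left as an unspecified \<open>k\<close>: it is orthogonal to
    the lift of \<open>V\<close>, with which the curvature is paired.\<close>
  have second: "\<exists>k. \<forall>h. D (lift i A) (D (lift i B) (lift i C)) q h =
      lift i (DF i A (DF i B C)) q h + \<kappa> * G B C * lift i A q h + k * dt q h"
    if A: "vector_field (F i) (N i) A" and B: "vector_field (F i) (N i) B" and C: "vector_field (F i) (N i) C"
    for A B C
  proof (intro exI allI)
    show "D (lift i A) (D (lift i B) (lift i C)) q h =
        lift i (DF i A (DF i B C)) q h + \<kappa> * G B C * lift i A q h + (bdb i (fst q) * G A (DF i B C) +
        lift i A q (\<lambda>p. bdb i (fst p) * gF i (snd p i) (B (snd p i)) (C (snd p i)))) * dt q h" for h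
      unfolding D_D_lift_lift[OF i B C q lift_W[OF i A]]
        D_lift_lift(2)[OF q i A i DF_vector_field[OF i B C] refl] D_dt_lift(2)[OF q i A]
      by (simp add: \<kappa>_def G_def algebra_simps)
  qed
  obtain k1 k2 where k1: "\<And>h. D (lift i X) (D (lift i Y) (lift i Z)) q h =
      lift i (DF i X (DF i Y Z)) q h + \<kappa> * G Y Z * lift i X q h + k1 * dt q h"
    and k2: "\<And>h. D (lift i Y) (D (lift i X) (lift i Z)) q h =
      lift i (DF i Y (DF i X Z)) q h + \<kappa> * G X Z * lift i Y q h + k2 * dt q h"
    using second[OF X Y Z] second[OF Y X Z] by blast
  note BXY = Fi.lie_bracket_vector_field[OF N_open[OF i] X Y]
  have "D (lie_bracket M (lift i X) (lift i Y)) (lift i Z) q = D (lift i (lie_bracket (F i) X Y)) (lift i Z) q"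
    by (rule M.D_cong[OF W_open lift_W[OF i BXY] lift_W[OF i Z] q]) (use lie_bracket_lift_lift[OF _ i X i Y] in simp_all)
  then have k3: "D (lie_bracket M (lift i X) (lift i Y)) (lift i Z) q h =
      lift i (DF i (lie_bracket (F i) X Y) Z) q h + bdb i (fst q) * G (lie_bracket (F i) X Y) Z * dt q h" for h
    using D_lift_lift(2)[OF q i BXY i Z refl] by (simp add: G_def)
  have "lift i R q h = lift i (DF i X (DF i Y Z)) q h - lift i (DF i Y (DF i X Z)) q h
      - lift i (DF i (lie_bracket (F i) X Y) Z) q h" for h
    by (simp add: R_def lift_eq incl_def pushforward_def curvature_def)
  then have eq: "curvature M D (lift i X) (lift i Y) (lift i Z) q = (\<lambda>h. lift i R q h
      + ((\<kappa> * G Y Z) * lift i X q h + ((- \<kappa> * G X Z) * lift i Y q h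
      + (k1 - k2 - bdb i (fst q) * G (lie_bracket (F i) X Y) Z) * dt q h)))"
    by (intro ext) (simp add: curvature_def k1 k2 k3 algebra_simps)
  have RT: "R (snd q i) \<in> tangent_space (F i) (snd q i)"
    unfolding R_def by (rule Fi.curvature_tangent[OF N_open[OF i] X Y Z W_snd[OF q i]])
  note t1 = incl_tangent[OF i qM RT, folded lift_eq] and t2 = lift_tangent[OF q i X] and t3 = lift_tangent[OF q i Y]
    and t4 = dt_tangent[OF qM] and tV = lift_tangent[OF q i V]
  note c2 = M.tangent_space_cmult[OF t2] and c3 = M.tangent_space_cmult[OF t3] and c4 = M.tangent_space_cmult[OF t4]
  note a3 = M.tangent_space_add[OF c3 c4] note a2 = M.tangent_space_add[OF c2 a3]
  show ?thesis
    unfolding eq M.g_add_left[OF qM t1 a2 tV] M.g_add_left[OF qM c2 a3 tV] M.g_add_left[OF qM c3 c4 tV]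
      M.g_cmult_left[OF qM t2 tV] M.g_cmult_left[OF qM t3 tV] M.g_cmult_left[OF qM t4 tV]
      g_lift_dt(2)[OF q i V] g_lift_lift[OF q i X i V] g_lift_lift[OF q i Y i V]
    using g_incl_lift[OF q i RT V]
    by (simp add: lift_eq[of i R] G_def \<kappa>_def R_def[symmetric] algebra_simps)
qed

end

locale warped_frame_patch = warped_patch I m F gF b DF D N
  for I m and F :: "nat \<Rightarrow> 'a manifold" and gF b DF D N +
  fixes E :: "nat \<Rightarrow> nat \<Rightarrow> 'a vfield"
  assumes E: "\<And>i. i \<in> {1..m} \<Longrightarrow> orthonormal_frame (F i) (gF i) (N i) (E i)"
begin

definition product_frame :: "nat \<times> nat \<Rightarrow> (real \<times> (nat \<Rightarrow> 'a)) vfield" where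
  "product_frame = (\<lambda>(i, a). if i = 0 then dt else lift i (E i a))"

lemma frame_factor: "i \<in> {1..m} \<Longrightarrow> metric_manifold.orthogonal_frame (F i) (gF i) (N i) {..<mdim (F i)} (E i)"
  by (rule metric_manifold.orthonormal_frame_imp_orthogonal_frame[OF gF N_open E])

lemma E_field: "i \<in> {1..m} \<Longrightarrow> a < mdim (F i) \<Longrightarrow> vector_field (F i) (N i) (E i a)"
  using E unfolding orthonormal_frame_def by blast

definition eps :: "real \<times> (nat \<Rightarrow> 'a) \<Rightarrow> nat \<Rightarrow> nat \<Rightarrow> real" where
  "eps q i a = gF i (snd q i) (E i a (snd q i)) (E i a (snd q i))"

lemma eps:
  assumes "q \<in> W" "i \<in> {1..m}" "a < mdim (F i)"
  shows "eps q i a * eps q i a = 1" "eps q i a \<noteq> 0"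
  using metric_manifold.orthonormal_frame_norm[OF gF[OF assms(2)] E[OF assms(2)] assms(3) W_snd[OF assms(1,2)]]
  by (auto simp: eps_def)

lemma E_orth:
  assumes "q \<in> W" "i \<in> {1..m}" "a < mdim (F i)" "c < mdim (F i)" "a \<noteq> c"
  shows "gF i (snd q i) (E i a (snd q i)) (E i c (snd q i)) = 0"
  using metric_manifold.orthogonal_frameD(4)[OF gF[OF assms(2)] frame_factor[OF assms(2)] _ _ assms(5)
      W_snd[OF assms(1,2)]] assms(3,4) by simp

lemma g_product_frame:
  assumes "q \<in> W"
  shows "g q (product_frame (0, 0) q) (product_frame (0, 0) q) = -1"
    and "i \<in> {1..m} \<Longrightarrow> a < mdim (F i) \<Longrightarrow>
      g q (product_frame (i, a) q) (product_frame (i, a) q) = (b i (fst q))\<^sup>2 * eps q i a"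
  using g_dt_dt[OF W_points[OF assms]] g_lift_lift[OF assms _ E_field _ E_field, of i a i a]
  by (auto simp: product_frame_def eps_def)

text \<open>For the expansion property, the remainder after projection has no time component, and
  its projections are orthogonal to the frames of the factors; hence it is zero.\<close>

lemma orthogonal_frame_product_frame: "M.orthogonal_frame (W) frame_index product_frame"
proof -
  have v: "vector_field M (W) (product_frame A)" if "A \<in> frame_index" for A
    using that by (cases rule: frame_index_cases) (use dt_W lift_W[OF _ E_field] in \<open>auto simp: product_frame_def simp del: One_nat_def\<close>)
  have o: "g q (product_frame A q) (product_frame B q) = 0" if A: "A \<in> frame_index" and B: "B \<in> frame_index" and ne: "A \<noteq> B" and q: "q \<in> W" for A B q
    using A
  proof (cases rule: frame_index_cases)
    case 1
    from B show ?thesis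
      by (cases rule: frame_index_cases) (use 1 ne g_lift_dt(2)[OF q _ E_field] in \<open>auto simp: product_frame_def\<close>)
  next
    case A: (2 i a)
    from B show ?thesis
    proof (cases rule: frame_index_cases)
      case 1
      then show ?thesis using g_lift_dt(1)[OF q A(2) E_field[OF A(2,3)]] A by (simp add: product_frame_def)
    next
      case (2 j c)
      then show ?thesis
        using g_lift_lift[OF q A(2) E_field[OF A(2,3)] 2(2) E_field[OF 2(2,3)]] E_orth[OF q A(2,3), of c] A ne
        by (auto simp: product_frame_def)
    qed
  qed
  have nz: "g q (product_frame A q) (product_frame A q) \<noteq> 0" if A: "A \<in> frame_index" and q: "q \<in> W" for A q
    using A
  proof (cases rule: frame_index_cases)
    case (2 i a)
    then show ?thesis using g_product_frame(2)[OF q 2(2,3)] eps(2)[OF q 2(2,3)] b_fst_pos[OF W_points[OF q] 2(2)] by simp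
  qed (use g_product_frame(1)[OF q] in simp)
  have ex: "u = (\<lambda>f. \<Sum>A\<in>frame_index. g q u (product_frame A q) / g q (product_frame A q) (product_frame A q) * product_frame A q f)"
    if q: "q \<in> W" and u: "u \<in> tangent_space M q" for q u
  proof -
    note qM = W_points[OF q]
    define w where "w f = u f - (\<Sum>A\<in>frame_index. g q u (product_frame A q) / g q (product_frame A q) (product_frame A q) * product_frame A q f)" for f
    have w: "w \<in> tangent_space M q" "\<And>A. A \<in> frame_index \<Longrightarrow> g q w (product_frame A q) = 0"
      using M.orthogonal_projection[OF qM finite_frame_index, of "\<lambda>A. product_frame A q" u]
        M.vector_field_tangent[OF v q] o nz q u unfolding w_def[abs_def] by blast+
    have "w = (\<lambda>f. 0)"
    proof (rule tangent_M_eqI[OF qM w(1) M.tangent_space_zero[OF qM]])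
      show "w fst = 0" using w(2)[of "(0, 0)"] g_dt[OF qM w(1)] by (simp add: frame_index_def product_frame_def)
      fix i assume i: "i \<in> {1..m}"
      have "gF i (snd q i) (push i q w) (E i a (snd q i)) = 0" if a: "a < mdim (F i)" for a
        using w(2)[of "(i, a)"] g_lift[OF q i E_field[OF i a] w(1)] b_fst_pos[OF qM i] a i
        by (auto simp: frame_index_def product_frame_def)
      then show "push i q w = push i q (\<lambda>f. 0)"
        using metric_manifold.orthogonal_frameD(6)[OF gF[OF i] frame_factor[OF i] W_snd[OF q i] push_tangent[OF i qM w(1)]]
        by (auto simp: fun_eq_iff pushforward_def)
    qed
    then show ?thesis by (auto simp: w_def fun_eq_iff)
  qed
  show ?thesis unfolding M.orthogonal_frame_def
    using W_open finite_frame_index v o nz ex by (intro conjI ballI impI)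
qed

text \<open>The curvature pairing scales by b_i^2 and the two norms together by b_i^4, which leaves
  one division by b_i^2.\<close>

definition factor_curvature :: "real \<times> (nat \<Rightarrow> 'a) \<Rightarrow> nat \<times> nat \<Rightarrow> nat \<times> nat \<Rightarrow> real" where
  "factor_curvature q = (\<lambda>(i, a) (j, c). if i = j \<and> i \<noteq> 0 then
     gF i (snd q i) (curvature (F i) (DF i) (E i a) (E i c) (E i a) (snd q i)) (E i c (snd q i))
       / (eps q i a * eps q i c) / (b i (fst q))\<^sup>2 else 0)"

text \<open>The signs \<open>eps\<close> cancel between the pairing and the norms in the terms that
  come from warping, so these depend on t and the indices alone.\<close>

lemma sectional_product_frame:
  assumes q: "q \<in> W" and A: "A \<in> frame_index" and B: "B \<in> frame_index"
  shows "g q (curvature M D (product_frame A) (product_frame B) (product_frame A) q) (product_frame B q) /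
      (g q (product_frame A q) (product_frame A q) * g q (product_frame B q) (product_frame B q)) =
    time_curvature (fst q) A B + factor_curvature q A B"
proof -
  note qM = W_points[OF q] and dT = dt_tangent[OF W_points[OF q]]
  from A show ?thesis
  proof (cases rule: frame_index_cases)
    case A: 1
    from B show ?thesis
    proof (cases rule: frame_index_cases)
      case 1
      have "curvature M D dt dt dt q = (\<lambda>f. 0)"
        using M.curvature_swap[OF W_open dt_W dt_W dt_W q] by (simp add: fun_eq_iff)
      then show ?thesis using A 1 M.g_zero_left[OF qM dT]
        by (simp add: product_frame_def time_curvature_def factor_curvature_def)
    next
      case (2 j c)
      note Ej = E_field[OF 2(2,3)] note LT = lift_tangent[OF q 2(2) Ej]
      define x where "x = deriv (hubble j) (fst q) + (hubble j (fst q))\<^sup>2"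
      have "curvature M D dt (lift j (E j c)) dt q = (\<lambda>h. x * lift j (E j c) q h)"
        unfolding x_def by (rule ext) (rule curvature_dt_lift_dt[OF q 2(2) Ej])
      then have "g q (curvature M D (product_frame A) (product_frame B) (product_frame A) q) (product_frame B q)
          = x * g q (product_frame B q) (product_frame B q)"
        using A 2 M.g_cmult_left[OF qM LT LT] by (simp add: product_frame_def)
      then show ?thesis
        using A 2 g_product_frame(1)[OF q] g_product_frame(2)[OF q 2(2,3)] eps(2)[OF q 2(2,3)] b_fst_pos[OF qM 2(2)]
        by (simp add: time_curvature_def factor_curvature_def x_def[symmetric])
    qed
  next
    case A: (2 i a)
    note Ei = E_field[OF A(2,3)] note LT = lift_tangent[OF q A(2) Ei]
    note gA = g_product_frame(2)[OF q A(2,3)] and nA = eps(2)[OF q A(2,3)] b_fst_pos[OF qM A(2)]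
    from B show ?thesis
    proof (cases rule: frame_index_cases)
      case 1
      define x where "x = hubble i (fst q) * bdb i (fst q) - deriv (bdb i) (fst q)"
      have "curvature M D (lift i (E i a)) dt (lift i (E i a)) q = (\<lambda>h. (x * eps q i a) * dt q h)"
        unfolding x_def eps_def by (rule ext) (rule curvature_lift_dt_lift[OF q A(2) Ei])
      then have "g q (curvature M D (product_frame A) (product_frame B) (product_frame A) q) (product_frame B q) = - (x * eps q i a)"
        using A 1 M.g_cmult_left[OF qM dT dT] g_dt_dt[OF qM] by (simp add: product_frame_def)
      then show ?thesis
        using A 1 g_product_frame(1)[OF q] gA nA
        by (simp add: time_curvature_def factor_curvature_def x_def[symmetric])
    next
      case B: (2 j c)
      note Ej = E_field[OF B(2,3)] note LT' = lift_tangent[OF q B(2) Ej]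
      note gB = g_product_frame(2)[OF q B(2,3)] and nB = eps(2)[OF q B(2,3)] b_fst_pos[OF qM B(2)]
      show ?thesis
      proof (cases "i = j")
        case False
        define x where "x = - bdb i (fst q) * eps q i a * hubble j (fst q)"
        have "curvature M D (lift i (E i a)) (lift j (E j c)) (lift i (E i a)) q = (\<lambda>h. x * lift j (E j c) q h)"
          unfolding x_def eps_def by (rule ext) (rule curvature_lift_lift_different[OF q A(2) Ei B(2) Ej False])
        then have "g q (curvature M D (product_frame A) (product_frame B) (product_frame A) q) (product_frame B q)
            = x * g q (product_frame B q) (product_frame B q)"
          using A B M.g_cmult_left[OF qM LT' LT'] by (simp add: product_frame_def)
        then have "g q (curvature M D (product_frame A) (product_frame B) (product_frame A) q) (product_frame B q) /
            (g q (product_frame A q) (product_frame A q) * g q (product_frame B q) (product_frame B q)) = x / ((b i (fst q))\<^sup>2 * eps q i a)"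
          using gA gB nB A B by simp
        then show ?thesis
          using A B False nA by (simp add: time_curvature_def factor_curvature_def x_def)
      next
        case True
        have c: "c < mdim (F i)" using B(3) True by simp
        note Ec = E_field[OF A(2) c] and nc = eps[OF q A(2) c]
        define R where "R = gF i (snd q i) (curvature (F i) (DF i) (E i a) (E i c) (E i a) (snd q i)) (E i c (snd q i))"
        have o: "gF i (snd q i) (E i a (snd q i)) (E i c (snd q i)) *
            gF i (snd q i) (E i c (snd q i)) (E i a (snd q i)) = (if a = c then eps q i a * eps q i c else 0)"
          using E_orth[OF q A(2,3) c] by (auto simp: eps_def)
        have "g q (curvature M D (product_frame A) (product_frame B) (product_frame A) q) (product_frame B q) = (b i (fst q))\<^sup>2 *
            (R + hubble i (fst q) * bdb i (fst q) *
              ((if a = c then eps q i a * eps q i c else 0) - eps q i a * eps q i c))"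
          using curvature_lift_lift_same[OF q A(2) Ei Ec Ei Ec] o A B True
          by (simp add: product_frame_def R_def eps_def mult.commute)
        then have "g q (curvature M D (product_frame A) (product_frame B) (product_frame A) q) (product_frame B q) /
            (g q (product_frame A q) (product_frame A q) * g q (product_frame B q) (product_frame B q)) =
            (R / (eps q i a * eps q i c) + hubble i (fst q) * bdb i (fst q) * (if a = c then 0 else -1)) / (b i (fst q))\<^sup>2"
          using gA gB nA nc A B True by (simp add: field_simps power2_eq_square split: if_splits)
        then show ?thesis
          using A B True by (simp add: time_curvature_def factor_curvature_def R_def add_divide_distrib)
      qed
    qed
  qed
qed

lemma scalar_curvature_local:
  assumes q: "q \<in> W"
  shows "scalar_curvature M g D q = (\<Sum>A\<in>frame_index. \<Sum>B\<in>frame_index. time_curvature (fst q) A B) +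
    (\<Sum>i=1..m. scalar_curvature (F i) (gF i) (DF i) (snd q i) / (b i (fst q))\<^sup>2)"
proof -
  have "scalar_curvature M g D q = (\<Sum>A\<in>frame_index. \<Sum>B\<in>frame_index. time_curvature (fst q) A B + factor_curvature q A B)"
    unfolding M.scalar_curvature_eq[OF orthogonal_frame_product_frame q] by (intro sum.cong refl sectional_product_frame[OF q])
  also have "\<dots> = (\<Sum>A\<in>frame_index. \<Sum>B\<in>frame_index. time_curvature (fst q) A B) + (\<Sum>A\<in>frame_index. \<Sum>B\<in>frame_index. factor_curvature q A B)"
    by (simp add: sum.distrib)
  also have "(\<Sum>A\<in>frame_index. \<Sum>B\<in>frame_index. factor_curvature q A B) =
      (\<Sum>i=1..m. \<Sum>a<mdim (F i). \<Sum>j=1..m. \<Sum>c<mdim (F j). factor_curvature q (i, a) (j, c))"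
    by (simp add: sum_frame_index factor_curvature_def del: One_nat_def)
  also have "\<dots> = (\<Sum>i=1..m. scalar_curvature (F i) (gF i) (DF i) (snd q i) / (b i (fst q))\<^sup>2)"
  proof (rule sum.cong[OF refl])
    fix i assume i: "i \<in> {1..m}"
    interpret Fi: levi_civita_manifold "F i" "gF i" "DF i" by (rule factor[OF i])
    have "(\<Sum>j=1..m. \<Sum>c<mdim (F j). factor_curvature q (i, a) (j, c)) =
        (\<Sum>c<mdim (F i). factor_curvature q (i, a) (i, c))" for a
    proof -
      have "(\<Sum>j=1..m. \<Sum>c<mdim (F j). factor_curvature q (i, a) (j, c)) =
          (\<Sum>j=1..m. if j = i then \<Sum>c<mdim (F i). factor_curvature q (i, a) (i, c) else 0)"
        by (rule sum.cong) (auto simp: factor_curvature_def)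
      then show ?thesis using i by simp
    qed
    then show "(\<Sum>a<mdim (F i). \<Sum>j=1..m. \<Sum>c<mdim (F j). factor_curvature q (i, a) (j, c)) =
        scalar_curvature (F i) (gF i) (DF i) (snd q i) / (b i (fst q))\<^sup>2"
      using i unfolding Fi.scalar_curvature_eq[OF frame_factor[OF i] W_snd[OF q i]]
      by (simp add: factor_curvature_def eps_def sum_divide_distrib)
  qed
  finally show ?thesis .
qed

text \<open>The field dt contributes 0 because D_dt P is a multiple of P, the other factors because
  D_X P = 0 there; in factor \<open>r\<close> the scale b_r^2 cancels between pairing and
  norm.\<close>

lemma divergence_local:
  assumes q: "q \<in> W" and r: "r \<in> {1..m}" and P: "vector_field (F r) (N r) P"
  shows "divergence M g D (lift r P) q = divergence (F r) (gF r) (DF r) P (snd q r)"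
proof -
  interpret Fr: levi_civita_manifold "F r" "gF r" "DF r" by (rule factor[OF r])
  note qM = W_points[OF q] and dT = dt_tangent[OF W_points[OF q]] and PT = lift_tangent[OF q r P]
  define G where "G A = g q (D (product_frame A) (lift r P) q) (product_frame A q) / g q (product_frame A q) (product_frame A q)" for A
  have G0: "G (0, 0) = 0"
    using D_dt_lift(1)[OF q r P] M.g_cmult_left[OF qM PT dT] g_lift_dt(1)[OF q r P] by (simp add: G_def product_frame_def)
  have Gi: "(\<Sum>a<mdim (F i). G (i, a)) = (if i = r then divergence (F r) (gF r) (DF r) P (snd q r) else 0)"
    if i: "i \<in> {1..m}" for i
  proof (cases "i = r")
    case False
    have "G (i, a) = 0" if a: "a < mdim (F i)" for a
      using D_lift_lift(1)[OF q i E_field[OF i a] r P False] M.g_zero_left[OF qM lift_tangent[OF q i E_field[OF i a]]] i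
      by (simp add: G_def product_frame_def)
    then show ?thesis using False by simp
  next
    case True
    have "G (r, a) = gF r (snd q r) (DF r (E r a) P (snd q r)) (E r a (snd q r)) /
        gF r (snd q r) (E r a (snd q r)) (E r a (snd q r))" if a: "a < mdim (F r)" for a
    proof -
      note Ea = E_field[OF r a]
      note V = DF_vector_field[OF r Ea P] note VT = lift_tangent[OF q r V] and AT = lift_tangent[OF q r Ea]
      define k where "k = bdb r (fst q) * gF r (snd q r) (E r a (snd q r)) (P (snd q r))"
      have "D (lift r (E r a)) (lift r P) q = (\<lambda>f. lift r (DF r (E r a) P) q f + k * dt q f)"
        unfolding k_def by (rule D_lift_lift(2)[OF q r Ea r P refl])
      then have "g q (D (lift r (E r a)) (lift r P) q) (lift r (E r a) q) =
          (b r (fst q))\<^sup>2 * gF r (snd q r) (DF r (E r a) P (snd q r)) (E r a (snd q r))"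
        using M.g_add_left[OF qM VT M.tangent_space_cmult[OF dT] AT] M.g_cmult_left[OF qM dT AT]
          g_lift_dt(2)[OF q r Ea] g_lift_lift[OF q r V r Ea] by simp
      then show ?thesis
        using g_lift_lift[OF q r Ea r Ea] b_fst_pos[OF qM r] r by (simp add: G_def product_frame_def)
    qed
    then show ?thesis
      using Fr.divergence_eq[OF frame_factor[OF r] W_snd[OF q r] P] True by simp
  qed
  have "divergence M g D (lift r P) q = (\<Sum>A\<in>frame_index. G A)"
    unfolding G_def by (rule M.divergence_eq[OF orthogonal_frame_product_frame q lift_W[OF r P]])
  also have "\<dots> = divergence (F r) (gF r) (DF r) P (snd q r)"
    unfolding sum_frame_index G0 using r by (simp add: Gi del: One_nat_def)
  finally show ?thesis .
qed

end


section \<open>Global formulas and comparison along one factor\<close>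

context warped_levi_civita begin

lemma frame_patch_exists:
  assumes q: "q \<in> points M"
  obtains N E where "warped_frame_patch I m F gF b DF D N E" "q \<in> cube N"
proof -
  have "\<exists>N E U \<phi>. openin (mtop (F i)) N \<and> snd q i \<in> N \<and> (U, \<phi>) \<in> charts (F i) \<and> N \<subseteq> U \<and>
      orthonormal_frame (F i) (gF i) N E" if i: "i \<in> {1..m}" for i
  proof -
    interpret Fi: metric_manifold "F i" "gF i" by (rule gF[OF i])
    note x = snd_in_points[OF q i]
    obtain V where V: "openin (mtop (F i)) V" "snd q i \<in> V"
      "orthonormal_frame (F i) (gF i) V (frame_at (F i) (gF i) (snd q i))"
      using Fi.frame_at[OF x] .
    obtain U \<phi> where c: "(U, \<phi>) \<in> charts (F i)" "snd q i \<in> U" using Fi.chart_cover[OF x] by blast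
    have "openin (mtop (F i)) (V \<inter> U)" using V(1) Fi.chart_open[OF c(1)] by blast
    then show ?thesis
      using V c Fi.orthonormal_frame_subset[OF V(3), of "V \<inter> U"] by (meson IntI inf_le1 inf_le2)
  qed
  then obtain N E U \<phi> where *: "\<And>i. i \<in> {1..m} \<Longrightarrow> openin (mtop (F i)) (N i) \<and> snd q i \<in> N i \<and>
      (U i, \<phi> i) \<in> charts (F i) \<and> N i \<subseteq> U i \<and> orthonormal_frame (F i) (gF i) (N i) (E i)" by metis
  show thesis
  proof (rule that[of N E])
    show "warped_frame_patch I m F gF b DF D N E"
      by unfold_locales (use * in blast)+
    show "q \<in> cube N" using q * by (cases q) (auto simp: in_points_M PiE_iff)
  qed
qed

text \<open>Nothing in the local formula refers to the patch or its frames, so a patch around each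
  point is enough.\<close>

theorem scalar_curvature_warped_product:
  assumes "q \<in> points M"
  shows "scalar_curvature M g D q = (\<Sum>A\<in>frame_index. \<Sum>B\<in>frame_index. time_curvature (fst q) A B) +
    (\<Sum>i=1..m. scalar_curvature (F i) (gF i) (DF i) (snd q i) / (b i (fst q))\<^sup>2)"
proof -
  obtain N E where N: "warped_frame_patch I m F gF b DF D N E" "q \<in> cube N"
    using frame_patch_exists[OF assms] .
  from warped_frame_patch.scalar_curvature_local[OF N] show ?thesis .
qed

theorem divergence_lift:
  assumes q: "q \<in> points M" and r: "r \<in> {1..m}" and P: "vector_field (F r) (points (F r)) P"
  shows "divergence M g D (lift r P) q = divergence (F r) (gF r) (DF r) P (snd q r)"
proof -
  obtain N E where N: "warped_frame_patch I m F gF b DF D N E" "q \<in> cube N"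
    using frame_patch_exists[OF q] .
  interpret N: warped_frame_patch I m F gF b DF D N E by (rule N(1))
  have "vector_field (F r) (N r) P"
    by (rule smooth_atlas.vector_field_subset[OF F[OF r] P openin_subset[OF N.N_open[OF r]]])
  from N.divergence_local[OF N(2) r this] show ?thesis .
qed

theorem scalar_curvature_quarter_symmetric_lift:
  fixes l1 l2 :: real
  assumes q: "q \<in> points M" and r: "r \<in> {1..m}" and P: "vector_field (F r) (points (F r)) P"
  defines "n \<equiv> real (mdim M)"
  shows "scalar_curvature M g (quarter_symmetric g D (lift r P) l1 l2) q =
    (\<Sum>A\<in>frame_index. \<Sum>B\<in>frame_index. time_curvature (fst q) A B)
    + (\<Sum>i=1..m. scalar_curvature (F i) (gF i) (DF i) (snd q i) / (b i (fst q))\<^sup>2)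
    + (n - 1) * (l1 + l2) * divergence (F r) (gF r) (DF r) P (snd q r)
    - (n - 1) * (l1\<^sup>2 + l2\<^sup>2 - n * l1 * l2) *
      ((b r (fst q))\<^sup>2 * gF r (snd q r) (P (snd q r)) (P (snd q r)))"
proof -
  have oF: "openin (mtop (F r)) (points (F r))" by simp
  have lift: "vector_field M (points M) (lift r P)"
    by (rule M.vector_field_subset[OF vector_field_lift[OF r oF P]])
      (use snd_in_points[OF _ r] in \<open>auto simp: cylinder_def\<close>)
  have PT: "P (snd q r) \<in> tangent_space (F r) (snd q r)"
    by (rule smooth_atlas.vector_field_tangent[OF F[OF r] P snd_in_points[OF q r]])
  have "g q (lift r P q) (lift r P q) = (b r (fst q))\<^sup>2 * gF r (snd q r) (P (snd q r)) (P (snd q r))"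
    unfolding lift_eq using g_incl[OF q incl_tangent[OF r q PT] r PT] push_incl[OF r r q PT] by simp
  then show ?thesis
    using M.scalar_curvature_quarter_symmetric[OF openin_topspace lift q, of l1 l2]
    by (simp add: n_def scalar_curvature_warped_product[OF q] divergence_lift[OF q r P])
qed

text \<open>Two points of the product that differ in a single factor have the same time coordinate, so the
  constancy of the scalar curvature compares the contributions of this factor.\<close>

lemma quarter_symmetric_constant_factor:
  fixes l1 l2 :: real
  assumes r: "r \<in> {1..m}" and P: "vector_field (F r) (points (F r)) P"
    and const: "scalar_curvature M g (quarter_symmetric g D (lift r P) l1 l2) constant_on points M"
    and t: "t \<in> I" and x: "x \<in> Pi\<^sub>E {1..m} (\<lambda>i. points (F i))" and i: "i \<in> {1..m}"
  defines "n \<equiv> real (mdim M)"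
  shows "(\<lambda>z. scalar_curvature (F i) (gF i) (DF i) z / (b i t)\<^sup>2 +
      (if i = r then (n - 1) * (l1 + l2) * divergence (F r) (gF r) (DF r) P z
        - (n - 1) * (l1\<^sup>2 + l2\<^sup>2 - n * l1 * l2) * ((b r t)\<^sup>2 * gF r z (P z) (P z)) else 0))
    constant_on points (F i)"
proof -
  obtain c where c: "\<And>q. q \<in> points M \<Longrightarrow>
      scalar_curvature M g (quarter_symmetric g D (lift r P) l1 l2) q = c"
    using const unfolding constant_on_def by blast
  define S where "S j z = scalar_curvature (F j) (gF j) (DF j) z / (b j t)\<^sup>2" for j z
  define Q where "Q z = (n - 1) * (l1 + l2) * divergence (F r) (gF r) (DF r) P z
      - (n - 1) * (l1\<^sup>2 + l2\<^sup>2 - n * l1 * l2) * ((b r t)\<^sup>2 * gF r z (P z) (P z))" for z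
  define T where "T = (\<Sum>A\<in>frame_index. \<Sum>B\<in>frame_index. time_curvature t A B)"
  \<comment> \<open>The right-hand side does not involve \<open>z\<close>: for \<open>i = r\<close>
    all of \<open>Q\<close> stands on the left, and for other \<open>i\<close> the point
    \<open>x r\<close> is kept.\<close>
  have "S i z + (if i = r then Q z else 0) =
      c - T - (\<Sum>j\<in>{1..m} - {i}. S j (x j)) - (if i = r then 0 else Q (x r))"
    if z: "z \<in> points (F i)" for z
  proof -
    have q: "(t, x(i := z)) \<in> points M"
      by (rule fun_upd_in_points[OF _ i z]) (use t x in \<open>simp add: in_points_M\<close>)
    have "c = T + (\<Sum>j=1..m. S j ((x(i := z)) j)) + Q ((x(i := z)) r)"
      using scalar_curvature_quarter_symmetric_lift[OF q r P, of l1 l2] c[OF q]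
      by (simp add: S_def Q_def T_def n_def del: One_nat_def)
    moreover have "(\<Sum>j=1..m. S j ((x(i := z)) j)) = S i z + (\<Sum>j\<in>{1..m} - {i}. S j (x j))"
    proof -
      have "(\<Sum>j=1..m. S j ((x(i := z)) j)) = S i ((x(i := z)) i) + (\<Sum>j\<in>{1..m} - {i}. S j ((x(i := z)) j))"
        by (rule sum.remove) (use i in simp_all)
      moreover have "(\<Sum>j\<in>{1..m} - {i}. S j ((x(i := z)) j)) = (\<Sum>j\<in>{1..m} - {i}. S j (x j))"
        by (rule sum.cong) auto
      ultimately show ?thesis by simp
    qed
    ultimately show ?thesis by auto
  qed
  then show ?thesis unfolding constant_on_def S_def Q_def by blast
qed

end

theorem theorem4p14:
  fixes I :: "real set" and m r :: nat
    and F :: "nat \<Rightarrow> 'a manifold" and gF :: "nat \<Rightarrow> 'a metric" and DF :: "nat \<Rightarrow> 'a connection"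
    and b :: "nat \<Rightarrow> real \<Rightarrow> real"
    and M :: "(real \<times> (nat \<Rightarrow> 'a)) manifold" and g :: "(real \<times> (nat \<Rightarrow> 'a)) metric"
    and D Dbar :: "(real \<times> (nat \<Rightarrow> 'a)) connection"
    and P :: "'a vfield" and l1 l2 nbar :: real
  assumes "open I" and "is_interval I" and "I \<noteq> {}"
    and "\<And>i. i \<in> {1..m} \<Longrightarrow> pseudo_riemannian (F i) (gF i)"
    and "\<And>i. i \<in> {1..m} \<Longrightarrow> levi_civita (F i) (gF i) (DF i)"
    and "\<And>i t. i \<in> {1..m} \<Longrightarrow> t \<in> I \<Longrightarrow> b i t > 0"
    and "\<And>i k. i \<in> {1..m} \<Longrightarrow> (deriv ^^ k) (b i) differentiable_on I"
    and "M = product_manifold I m F"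
    and "g = warped_metric m F gF b"
    and "nbar = real (mdim M)"
    and "levi_civita M g D"
    and "l1 \<noteq> 0" and "l2 \<noteq> 0"
    and "r \<in> {1..m}"
    and "vector_field (F r) (points (F r)) P"
    and "Dbar = quarter_symmetric g D (lift_field M r P) l1 l2"
    and "scalar_curvature M g Dbar constant_on points M"
  shows "(\<forall>i\<in>{1..m} - {r}. scalar_curvature (F i) (gF i) (DF i) constant_on points (F i)) \<and>
    (l1 + l2 \<noteq> 0 \<and> l1\<^sup>2 + l2\<^sup>2 - nbar * l1 * l2 = 0 \<and>
       divergence (F r) (gF r) (DF r) P constant_on points (F r) \<longrightarrow>
       scalar_curvature (F r) (gF r) (DF r) constant_on points (F r)) \<and>
    (l1 = - l2 \<and> l1 \<noteq> 0 \<and>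
       (\<lambda>p. gF r p (P p) (P p)) constant_on points (F r) \<longrightarrow>
       scalar_curvature (F r) (gF r) (DF r) constant_on points (F r)) \<and>
    (l1 + l2 \<noteq> 0 \<and> l1\<^sup>2 + l2\<^sup>2 - nbar * l1 * l2 \<noteq> 0 \<and>
       divergence (F r) (gF r) (DF r) P constant_on points (F r) \<and>
       (\<lambda>p. gF r p (P p) (P p)) constant_on points (F r) \<longrightarrow>
       scalar_curvature (F r) (gF r) (DF r) constant_on points (F r))"
proof -
  have mm: "metric_manifold (F i) (gF i)" if "i \<in> {1..m}" for i
    by (rule pseudo_riemannian_imp_metric_manifold[OF assms(4)[OF that]])
  interpret warped_levi_civita I m F gF b DF D
    by (intro warped_levi_civita.intro warped_product.intro interval_product.intro
        warped_product_axioms.intro warped_levi_civita_axioms.intro metric_manifold.axioms(1)[OF mm])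
      (use assms mm in simp_all)
  \<comment> \<open>A single time is enough; at it the squares of the warping functions are positive
    constants.\<close>
  obtain t where t: "t \<in> I" using assms(3) by blast
  have nonempty: "points (F i) \<noteq> {}" if "i \<in> {1..m}" for i
    using assms(4)[OF that] by (simp add: pseudo_riemannian_def smooth_manifold_def)
  \<comment> \<open>An arbitrary base point, at which the factors stay while one of them is
    varied.\<close>
  define x where "x = restrict (\<lambda>i. SOME z. z \<in> points (F i)) {1..m}"
  have x: "x \<in> Pi\<^sub>E {1..m} (\<lambda>i. points (F i))"
    unfolding x_def by (rule restrict_PiE_iff[THEN iffD2]) (use nonempty some_in_eq in blast)
  define S where "S i = scalar_curvature (F i) (gF i) (DF i)" for i
  define u where "u = (nbar - 1) * (l1 + l2)"
  define v where "v = (nbar - 1) * (l1\<^sup>2 + l2\<^sup>2 - nbar * l1 * l2)"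
  define dv where "dv = divergence (F r) (gF r) (DF r) P"
  define no where "no z = gF r z (P z) (P z)" for z
  have sc: "scalar_curvature (product_manifold I m F) (warped_metric m F gF b)
      (quarter_symmetric (warped_metric m F gF b) D (lift_field (product_manifold I m F) r P) l1 l2)
      constant_on points (product_manifold I m F)"
    using assms(17) unfolding assms(16) assms(8,9) .
  have const: "(\<lambda>z. S i z / (b i t)\<^sup>2 + (if i = r then u * dv z - v * ((b r t)\<^sup>2 * no z) else 0))
      constant_on points (F i)" if "i \<in> {1..m}" for i
    unfolding S_def u_def v_def dv_def no_def assms(10) assms(8)
    by (rule quarter_symmetric_constant_factor[OF assms(14,15) sc t x that])
  have S: "S i constant_on points (F i)"
    if i: "i \<in> {1..m}" and other: "(\<lambda>z. if i = r then u * dv z - v * ((b r t)\<^sup>2 * no z) else 0) constant_on points (F i)"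
    for i
  proof -
    obtain c c' where c: "\<And>z. z \<in> points (F i) \<Longrightarrow>
        S i z / (b i t)\<^sup>2 + (if i = r then u * dv z - v * ((b r t)\<^sup>2 * no z) else 0) = c"
      and c': "\<And>z. z \<in> points (F i) \<Longrightarrow> (if i = r then u * dv z - v * ((b r t)\<^sup>2 * no z) else 0) = c'"
      using const[OF i] other unfolding constant_on_def by blast
    have "S i z = (c - c') * (b i t)\<^sup>2" if "z \<in> points (F i)" for z
      using c[OF that] c'[OF that] b_pos[OF i t] by (simp add: field_simps)
    then show ?thesis unfolding constant_on_def by blast
  qed
  have 1: "S i constant_on points (F i)" if "i \<in> {1..m} - {r}" for i
    by (rule S) (use that in \<open>auto simp: constant_on_def\<close>)
  \<comment> \<open>The last three claims in one: v = 0 in the first of them, u = 0 in the second,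
    and both functions are constant in the third.\<close>
  have 2: "S r constant_on points (F r)"
    if uv: "u = 0 \<or> dv constant_on points (F r)" "v = 0 \<or> no constant_on points (F r)"
  proof (rule S[OF assms(14)])
    obtain c where c: "\<And>z. z \<in> points (F r) \<Longrightarrow> u * dv z = c"
    proof (cases "u = 0")
      case True
      then show ?thesis by (intro that[of 0]) simp
    next
      case False
      then obtain k where "\<And>z. z \<in> points (F r) \<Longrightarrow> dv z = k" using uv(1) unfolding constant_on_def by blast
      then show ?thesis by (intro that[of "u * k"]) simp
    qed
    obtain c' where c': "\<And>z. z \<in> points (F r) \<Longrightarrow> v * ((b r t)\<^sup>2 * no z) = c'"
    proof (cases "v = 0")
      case True
      then show ?thesis by (intro that[of 0]) simp
    next
      case False
      then obtain k where "\<And>z. z \<in> points (F r) \<Longrightarrow> no z = k" using uv(2) unfolding constant_on_def by blast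
      then show ?thesis by (intro that[of "v * ((b r t)\<^sup>2 * k)"]) simp
    qed
    show "(\<lambda>z. if r = r then u * dv z - v * ((b r t)\<^sup>2 * no z) else 0) constant_on points (F r)"
      unfolding constant_on_def by (rule exI[of _ "c - c'"]) (simp add: c c')
  qed
  have no: "(\<lambda>p. gF r p (P p) (P p)) = no" by (rule ext) (simp add: no_def)
  show ?thesis
    unfolding S_def[symmetric] dv_def[symmetric] no
    using 1 2 by (auto simp: u_def v_def)
qed

end
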